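(* Let $\mu,M$ be positive integers, let $\widehat\mu:=\min\{\mu,M+1\}$, let $s$ be an integer with $0\le s\le\widehat\mu$, and let $\theta>-1$, $\beta>-1$, $0<\gamma<1$. If $u\in\mathcal{A}_{\theta,\beta,\gamma}^{\mu}(\Lambda)$, then $$\big\|\mathscr{D}_{\beta,\gamma}^{\,s}\big(u-\Pi_M^{\theta,\beta,\gamma}u\big)\big\|_{\varrho^{\theta+s,\beta,\gamma}}\le\left[\frac{(M-\widehat\mu+1)!}{(M-s+1)!}\right]^{1/2}\big\|\mathscr{D}_{\beta,\gamma}^{\,\widehat\mu}u\big\|_{\varrho^{\theta+\widehat\mu,\beta,\gamma}}.$$ In particular, for $\theta=s=0$ and $\mu<M+1$, writing $\Pi_M=\Pi_M^{0,\beta,\gamma}$, $$\|u-\Pi_Mu\|_{\varrho^{0,\beta,\gamma}}\le C\,M^{-\mu/2}\,\big\|\mathscr{D}_{\beta,\gamma}^{\,\mu}u\big\|_{\varrho^{\mu,\beta,\gamma}},$$ where $C>0$ is a constant independent of $M$ and $u$ (it may depend on $\mu$).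
   Context: $\Lambda=(0,\infty)$. For $\theta>-1$, $\beta>-1$, $0<\gamma<1$ set $\varrho^{\theta,\beta,\gamma}(x):=(\beta+1)^{\theta+1}\gamma\,x^{\gamma(\theta+1)-1}e^{-(\beta+1)x^\gamma}$ for $x\in\Lambda$. For a weight $\varrho$, $L^2_\varrho(\Lambda)$ is the weighted space with norm $\|v\|_\varrho=(\int_0^\infty|v|^2\varrho\,dx)^{1/2}$ and inner product $(v,w)_\varrho=\int_0^\infty vw\varrho\,dx$ (real-valued functions). The mapped derivative is $\mathscr{D}_{\beta,\gamma}u(x):=\frac{x^{1-\gamma}}{(\beta+1)\gamma}\,\partial_xu(x)$, with $\partial_x$ understood in the weak sense; $\mathscr{D}_{\beta,\gamma}^{\,r}$ is its $r$-fold iterate, $\mathscr{D}_{\beta,\gamma}^{\,0}v=v$. For an integer $\mu\ge0$, $$\mathcal{A}_{\theta,\beta,\gamma}^{\mu}(\Lambda):=\big\{v\in L^2_{\varrho^{\theta,\beta,\gamma}}(\Lambda):\ \mathscr{D}_{\beta,\gamma}^{\,r}v\in L^2_{\varrho^{\theta+r,\beta,\gamma}}(\Lambda),\ 1\le r\le\mu\big\}.$$ $\mathbb{P}_M^\gamma:=\operatorname{span}\{1,x^\gamma,x^{2\gamma},\dots,x^{M\gamma}\}$, and for $u\in L^2_{\varrho^{\theta,\beta,\gamma}}(\Lambda)$, $\Pi_M^{\theta,\beta,\gamma}u\in\mathbb{P}_M^\gamma$ is the weighted orthogonal projection, defined by $(u-\Pi_M^{\theta,\beta,\gamma}u,w)_{\varrho^{\theta,\beta,\gamma}}=0$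 for all $w\in\mathbb{P}_M^\gamma$. *)

theory Defs
  imports "HOL-Analysis.Analysis"
begin

text \<open>
  Functions on the half-line are represented by total functions of type
  \<open>real \<Rightarrow> real\<close>; their values outside \<open>{0<..}\<close> are irrelevant.
\<close>

abbreviation half_line :: "real set" where
  "half_line \<equiv> {0<..}"

definition weight :: "real \<Rightarrow> real \<Rightarrow> real \<Rightarrow> real \<Rightarrow> real" where
  "weight \<theta> \<beta> \<gamma> x =
     (\<beta> + 1) powr (\<theta> + 1) * \<gamma> * x powr (\<gamma> * (\<theta> + 1) - 1) * exp (- (\<beta> + 1) * x powr \<gamma>)"

definition L2_space :: "(real \<Rightarrow> real) \<Rightarrow> (real \<Rightarrow> real) set" where
  "L2_space \<rho> =
     {v. v \<in> borel_measurable (lebesgue_on half_line) \<and>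
         integrable (lebesgue_on half_line) (\<lambda>x. (v x)\<^sup>2 * \<rho> x)}"

definition L2_inner :: "(real \<Rightarrow> real) \<Rightarrow> (real \<Rightarrow> real) \<Rightarrow> (real \<Rightarrow> real) \<Rightarrow> real" where
  "L2_inner \<rho> v w = (LINT x|lebesgue_on half_line. v x * w x * \<rho> x)"

text \<open>
  Since the Bochner integral of a non-integrable function is 0, the norm is meaningful only
  for members of \<open>L2_space \<rho>\<close>.
\<close>

definition L2_norm :: "(real \<Rightarrow> real) \<Rightarrow> (real \<Rightarrow> real) \<Rightarrow> real" where
  "L2_norm \<rho> v = sqrt (LINT x|lebesgue_on half_line. (v x)\<^sup>2 * \<rho> x)"

definition locally_integrable :: "(real \<Rightarrow> real) \<Rightarrow> bool" where
  "locally_integrable f \<longleftrightarrow>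
     (\<forall>K. compact K \<and> K \<subseteq> half_line \<longrightarrow> integrable (lebesgue_on K) f)"

definition test_function :: "(real \<Rightarrow> real) \<Rightarrow> bool" where
  "test_function \<phi> \<longleftrightarrow>
     (\<forall>k. (deriv ^^ k) \<phi> differentiable_on UNIV) \<and>
     compact (closure {x. \<phi> x \<noteq> 0}) \<and> closure {x. \<phi> x \<noteq> 0} \<subseteq> half_line"

definition has_weak_deriv :: "(real \<Rightarrow> real) \<Rightarrow> (real \<Rightarrow> real) \<Rightarrow> bool" where
  "has_weak_deriv f g \<longleftrightarrow>
     locally_integrable f \<and> locally_integrable g \<and>
     (\<forall>\<phi>. test_function \<phi> \<longrightarrow>
        (LINT x|lebesgue_on half_line. f x * deriv \<phi> x) =
        - (LINT x|lebesgue_on half_line. g x * \<phi> x))"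

definition weakly_differentiable :: "(real \<Rightarrow> real) \<Rightarrow> bool" where
  "weakly_differentiable f \<longleftrightarrow> (\<exists>g. has_weak_deriv f g)"

text \<open>
  The weak derivative is determined only almost everywhere on the half-line; an arbitrary
  representative is chosen. It is unspecified unless \<open>weakly_differentiable f\<close>.
\<close>

definition weak_deriv :: "(real \<Rightarrow> real) \<Rightarrow> real \<Rightarrow> real" where
  "weak_deriv f = (SOME g. has_weak_deriv f g)"

definition mapped_deriv :: "real \<Rightarrow> real \<Rightarrow> (real \<Rightarrow> real) \<Rightarrow> real \<Rightarrow> real" where
  "mapped_deriv \<beta> \<gamma> u x = x powr (1 - \<gamma>) / ((\<beta> + 1) * \<gamma>) * weak_deriv u x"

text \<open>
  Membership includes the existence of the weak derivatives that enter
  \<open>(mapped_deriv \<beta> \<gamma> ^^ r) v\<close> for \<open>1 \<le> r \<le> \<mu>\<close>.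
\<close>

definition A_space :: "real \<Rightarrow> real \<Rightarrow> real \<Rightarrow> nat \<Rightarrow> (real \<Rightarrow> real) set" where
  "A_space \<theta> \<beta> \<gamma> \<mu> =
     {v \<in> L2_space (weight \<theta> \<beta> \<gamma>).
        \<forall>r. 1 \<le> r \<and> r \<le> \<mu> \<longrightarrow>
          weakly_differentiable ((mapped_deriv \<beta> \<gamma> ^^ (r - 1)) v) \<and>
          (mapped_deriv \<beta> \<gamma> ^^ r) v \<in> L2_space (weight (\<theta> + real r) \<beta> \<gamma>)}"

text \<open>
  The span of \<open>1, x\<^sup>\<gamma>, \<dots>, x\<^sup>M\<^sup>\<gamma>\<close>, written out because the function type carries no
  vector space structure in the library.
\<close>

definition P_space :: "real \<Rightarrow> nat \<Rightarrow> (real \<Rightarrow> real) set" where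
  "P_space \<gamma> M = {\<lambda>x. \<Sum>k\<le>M. c k * x powr (real k * \<gamma>) | c. True}"

text \<open>
  The description is unique for \<open>0 < \<gamma>\<close>: the generators are linearly independent on the
  half-line, so two elements of \<open>P_space \<gamma> M\<close> that agree almost everywhere there are equal
  as total functions.
\<close>

definition proj :: "real \<Rightarrow> real \<Rightarrow> real \<Rightarrow> nat \<Rightarrow> (real \<Rightarrow> real) \<Rightarrow> real \<Rightarrow> real" where
  "proj \<theta> \<beta> \<gamma> M u =
     (THE p. p \<in> P_space \<gamma> M \<and>
        (\<forall>w \<in> P_space \<gamma> M. L2_inner (weight \<theta> \<beta> \<gamma>) (\<lambda>x. u x - p x) w = 0))"

end

theory Submission imports Defs "HOL-Real_Asymp.Real_Asymp" begin

text \<open>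
  In the variable \<open>z = (\<beta> + 1) * x powr \<gamma>\<close> the weight \<open>weight \<theta> \<beta> \<gamma>\<close> is the Laguerre weight
  \<open>z powr \<theta> * exp (- z)\<close>, the mapped derivative is \<open>d/dz\<close>, and the approximating functions are
  the polynomials in \<open>z\<close>. If \<open>f\<close> is orthogonal to all polynomials of degree less than \<open>n\<close>, then \<open>df/dz\<close>
  is orthogonal, for the weight with parameter \<open>\<theta> + 1\<close>, to those of degree less than \<open>n - 1\<close>, and
  \<open>n \<parallel>f\<parallel>\<^sup>2 \<le> \<parallel>df/dz\<parallel>\<^sup>2\<close>. Iterating this from order \<open>s\<close> to order \<open>m\<close> produces the
  quotient of factorials.

  Completeness of the Laguerre polynomials is not needed for the inequality. Since \<open>f\<close> is orthogonal to 1, it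
  is the adjoint of \<open>d/dz\<close> applied to an explicit primitive \<open>g\<close>; the commutation relation between \<open>d/dz\<close> and
  its adjoint gives \<open>\<parallel>f\<parallel>\<^sup>2 = \<parallel>g\<parallel>\<^sup>2 + \<parallel>dg/dz\<parallel>\<^sup>2\<close>, and \<open>g\<close> is orthogonal to the polynomials of degree
  less than \<open>n - 1\<close>. By induction \<open>n \<parallel>g\<parallel>\<^sup>2 \<le> \<parallel>f\<parallel>\<^sup>2\<close>, and \<open>\<parallel>f\<parallel>\<^sup>2 = \<langle>g, df/dz\<rangle>\<close> concludes.
\<close>

section \<open>Functions with a locally integrable derivative\<close>

text \<open>The obstacle is the behaviour at the two ends of the half-line: members of the weighted
  spaces may grow there, while every integration by parts leaves boundary terms. When both factors
  are known to be square integrable, the boundary terms vanish by an integrability argument in the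
  variable \<open>ln z\<close>. For the explicit primitive \<open>g\<close> integrability is not
  known beforehand; there the boundary terms are estimated by Cauchy-Schwarz on the two tails, and
  the orthogonality of \<open>f\<close> to 1 makes the tail at infinity small. A second obstacle is
  that a weak derivative is only a chosen representative, so that identities between iterated
  derivatives hold almost everywhere. The analysis is therefore done for \<open>ac_deriv\<close>,
  absolute continuity on compact subintervals expressed by an integral identity, and is carried over
  by the du Bois-Reymond lemma. The projection leaves the right-hand side at order \<open>m\<close>:
  its derivative there is a polynomial in \<open>z\<close> with \<open>M + 1 - m\<close>
  coefficients, orthogonal to the derivative of the error, so Pythagoras applies.\<close>

definition ac_deriv :: "(real \<Rightarrow> real) \<Rightarrow> (real \<Rightarrow> real) \<Rightarrow> bool" where
  "ac_deriv f f' \<longleftrightarrow>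
     (\<forall>a b. 0 < a \<and> a \<le> b \<longrightarrow> f' absolutely_integrable_on {a..b} \<and> integral {a..b} f' = f b - f a)"

lemma ac_derivD:
  assumes "ac_deriv f f'" "0 < a" "a \<le> b"
  shows "f' absolutely_integrable_on {a..b}" "f' integrable_on {a..b}" "integral {a..b} f' = f b - f a"
  using assms set_lebesgue_integral_eq_integral(1) unfolding ac_deriv_def by blast+

lemma ac_deriv_cong:
  assumes "\<And>x. 0 < x \<Longrightarrow> f x = g x" "\<And>x. 0 < x \<Longrightarrow> f' x = g' x"
  shows "ac_deriv f f' \<longleftrightarrow> ac_deriv g g'"
proof -
  have "f' absolutely_integrable_on {a..b} \<longleftrightarrow> g' absolutely_integrable_on {a..b}"
       "integral {a..b} f' = integral {a..b} g'" if "0 < a" for a b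
    using assms(2) that
    by (intro set_integrable_cong Henstock_Kurzweil_Integration.integral_cong; force)+
  then show ?thesis
    unfolding ac_deriv_def using assms(1) by fastforce
qed

lemma ac_deriv_continuous:
  assumes "ac_deriv f f'" shows "continuous_on {0<..} f"
proof -
  have "isCont f x" if "0 < x" for x
  proof -
    have "continuous_on {x/2..2*x} (\<lambda>y. f (x/2) + integral {x/2..y} f')"
      using ac_derivD(2)[OF assms, of "x/2" "2*x"] that
      by (intro continuous_intros indefinite_integral_continuous_1) auto
    then have "continuous_on {x/2..2*x} f"
      using ac_derivD(3)[OF assms] that by (subst (asm) continuous_on_cong[where g = f]) auto
    then show ?thesis
      using that by (auto intro: continuous_on_interior)
  qed
  then show ?thesis by (auto simp: continuous_on_eq_continuous_at)
qed

lemma ac_deriv_continuous_Icc: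
  assumes "ac_deriv f f'" "0 < a" shows "continuous_on {a..b} f"
  by (rule continuous_on_subset[OF ac_deriv_continuous[OF assms(1)]]) (use assms in auto)

lemma ac_deriv_C1:
  assumes "\<And>x. 0 < x \<Longrightarrow> (f has_real_derivative f' x) (at x)" "continuous_on {0<..} f'"
  shows "ac_deriv f f'"
  unfolding ac_deriv_def
proof (intro allI impI conjI)
  fix a b :: real assume ab: "0 < a \<and> a \<le> b"
  then show "f' absolutely_integrable_on {a..b}"
    by (intro absolutely_integrable_continuous_real continuous_on_subset[OF assms(2)]) auto
  have "(f' has_integral (f b - f a)) {a..b}"
    using ab by (intro fundamental_theorem_of_calculus)
      (auto simp flip: has_real_derivative_iff_has_vector_derivative
        intro!: DERIV_subset[OF assms(1)])
  then show "integral {a..b} f' = f b - f a" by (rule integral_unique)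
qed

lemma ac_deriv_add:
  assumes "ac_deriv f f'" "ac_deriv g g'"
  shows "ac_deriv (\<lambda>x. f x + g x) (\<lambda>x. f' x + g' x)"
  unfolding ac_deriv_def
  using ac_derivD[OF assms(1)] ac_derivD[OF assms(2)]
  by (auto simp: Henstock_Kurzweil_Integration.integral_add intro!: set_integral_add)

lemma ac_deriv_const: "ac_deriv (\<lambda>x. c) (\<lambda>x. 0)"
  by (rule ac_deriv_C1) auto

lemma absolutely_integrable_continuous_mult:
  fixes f g :: "real \<Rightarrow> real"
  assumes "continuous_on {a..b} f" "g absolutely_integrable_on {a..b}"
  shows "(\<lambda>x. f x * g x) absolutely_integrable_on {a..b}"
  using assms
  by (intro absolutely_integrable_bounded_measurable_product_real)
    (auto intro!: continuous_imp_measurable_on_sets_lebesgue compact_imp_bounded compact_continuous_image)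

text \<open>A local bound by increments of \<open>\<Phi>\<close> telescopes along equally spaced
  points of mesh below \<open>d\<close>. With \<open>\<Phi>\<close> a multiple of an indefinite
  integral, local errors add up to a global one.\<close>

lemma increment_bound_uniform_mesh:
  fixes H \<Phi> :: "real \<Rightarrow> real"
  assumes "a \<le> b" "0 < d"
    and H: "\<And>x y. a \<le> x \<Longrightarrow> x \<le> y \<Longrightarrow> y \<le> b \<Longrightarrow> y - x < d \<Longrightarrow> \<bar>H y - H x\<bar> \<le> \<Phi> y - \<Phi> x"
  shows "\<bar>H b - H a\<bar> \<le> \<Phi> b - \<Phi> a"
proof -
  obtain n :: nat where n: "(b - a) / d < real n"
    using reals_Archimedean2 by blast
  have "0 \<le> (b - a) / d" using assms by simp
  with n have "0 < real n" by linarith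
  define p where "p i = a + (b - a) * real i / real n" for i
  have incr: "p (Suc i) - p i = (b - a) / real n" for i
    using \<open>0 < real n\<close> by (simp add: p_def field_simps)
  moreover have "(b - a) / real n < d" "0 \<le> (b - a) / real n"
    using n \<open>0 < real n\<close> \<open>0 < d\<close> \<open>a \<le> b\<close> by (auto simp: field_simps)
  ultimately have step: "p (Suc i) - p i < d" "p i \<le> p (Suc i)" for i
    using incr[of i] by linarith+
  have le_b: "p i \<le> b" if "i \<le> n" for i
  proof -
    have "(b - a) * real i \<le> (b - a) * real n"
      using that assms by (intro mult_left_mono) auto
    then show ?thesis using \<open>0 < real n\<close> by (simp add: p_def field_simps)
  qed
  have ge_a: "a \<le> p i" for i
    using assms \<open>0 < real n\<close> by (simp add: p_def)
  have "\<bar>H (p i) - H a\<bar> \<le> \<Phi> (p i) - \<Phi> a" if "i \<le> n" for i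
    using that
  proof (induction i)
    case (Suc i)
    then have "\<bar>H (p (Suc i)) - H (p i)\<bar> \<le> \<Phi> (p (Suc i)) - \<Phi> (p i)"
      by (intro H) (use step ge_a le_b Suc in auto)
    with Suc show ?case by simp
  qed (simp add: p_def)
  from this[of n] show ?thesis using \<open>0 < real n\<close> by (simp add: p_def)
qed

text \<open>With \<open>g\<close> frozen at the right end and \<open>f\<close> at the left end the
  product rule is an exact identity. Unfreezing them costs at most the oscillation \<open>e\<close>
  times the integral of the absolute derivatives.\<close>

lemma ac_deriv_subinterval_bound:
  fixes f' g' :: "real \<Rightarrow> real"
  assumes f: "ac_deriv f f'" and g: "ac_deriv g g'" and xy: "0 < x" "x \<le> y"
    and osc: "\<And>s t. s \<in> {x..y} \<Longrightarrow> t \<in> {x..y} \<Longrightarrow> \<bar>f s - f t\<bar> \<le> e"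
             "\<And>s t. s \<in> {x..y} \<Longrightarrow> t \<in> {x..y} \<Longrightarrow> \<bar>g s - g t\<bar> \<le> e"
  shows "\<bar>f y * g y - f x * g x - integral {x..y} (\<lambda>t. f' t * g t + f t * g' t)\<bar>
           \<le> e * integral {x..y} (\<lambda>t. \<bar>f' t\<bar> + \<bar>g' t\<bar>)"
proof -
  note f' = ac_derivD[OF f xy] and g' = ac_derivD[OF g xy]
  note cf = ac_deriv_continuous_Icc[OF f xy(1), of y] and cg = ac_deriv_continuous_Icc[OF g xy(1), of y]
  have i1: "(\<lambda>t. f' t * g t) absolutely_integrable_on {x..y}"
    using absolutely_integrable_continuous_mult[OF cg f'(1)] by (simp add: mult.commute)
  have i2: "(\<lambda>t. f t * g' t) absolutely_integrable_on {x..y}"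
    by (rule absolutely_integrable_continuous_mult[OF cf g'(1)])
  have i12: "(\<lambda>t. f' t * g t + f t * g' t) integrable_on {x..y}"
    using i1 i2 by (intro integrable_add set_lebesgue_integral_eq_integral(1))
  have c: "(\<lambda>t. f' t * g y) integrable_on {x..y}" "(\<lambda>t. f x * g' t) integrable_on {x..y}"
    using integrable_on_cmult_left[OF f'(2), of "g y"] integrable_on_cmult_left[OF g'(2), of "f x"]
    by (auto simp: mult.commute)
  then have i3: "(\<lambda>t. f' t * g y + f x * g' t) integrable_on {x..y}"
    by (rule integrable_add)
  have e: "f y * g y - f x * g x = integral {x..y} (\<lambda>t. f' t * g y + f x * g' t)"
    by (simp add: Henstock_Kurzweil_Integration.integral_add[OF c] f'(3) g'(3)) algebra
  have "f y * g y - f x * g x - integral {x..y} (\<lambda>t. f' t * g t + f t * g' t)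
      = integral {x..y} (\<lambda>t. f' t * (g y - g t) + (f x - f t) * g' t)"
    unfolding e by (subst Henstock_Kurzweil_Integration.integral_diff[OF i3 i12, symmetric]) (simp add: algebra_simps)
  also have "norm \<dots> \<le> integral {x..y} (\<lambda>t. e * (\<bar>f' t\<bar> + \<bar>g' t\<bar>))"
  proof (rule integral_norm_bound_integral)
    show "(\<lambda>t. f' t * (g y - g t) + (f x - f t) * g' t) integrable_on {x..y}"
      using integrable_diff[OF i3 i12] by (simp add: algebra_simps)
    show "(\<lambda>t. e * (\<bar>f' t\<bar> + \<bar>g' t\<bar>)) integrable_on {x..y}"
      using f'(1) g'(1)
      by (intro integrable_cmul[where 'b = real, simplified] integrable_add)
        (auto simp: absolutely_integrable_on_def)
    fix t assume t: "t \<in> {x..y}"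
    have "\<bar>f' t * (g y - g t) + (f x - f t) * g' t\<bar> \<le> \<bar>f' t\<bar> * \<bar>g y - g t\<bar> + \<bar>f x - f t\<bar> * \<bar>g' t\<bar>"
      by (metis abs_mult abs_triangle_ineq)
    also have "\<dots> \<le> \<bar>f' t\<bar> * e + e * \<bar>g' t\<bar>"
      using t xy by (intro add_mono mult_left_mono mult_right_mono osc) auto
    finally show "norm (f' t * (g y - g t) + (f x - f t) * g' t) \<le> e * (\<bar>f' t\<bar> + \<bar>g' t\<bar>)"
      by (simp add: algebra_simps)
  qed
  finally show ?thesis by simp
qed

text \<open>The derivatives are only integrands, so the rule is not argued pointwise. The defect
  \<open>H\<close> of the integrated rule has an increment of at most \<open>e * J\<close> for every
  \<open>e > 0\<close>: uniform continuity gives a mesh on which the bound for subintervals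
  applies.\<close>

lemma ac_deriv_mult:
  assumes f: "ac_deriv f f'" and g: "ac_deriv g g'"
  shows "ac_deriv (\<lambda>x. f x * g x) (\<lambda>x. f' x * g x + f x * g' x)"
  unfolding ac_deriv_def
proof (intro allI impI conjI)
  fix a b :: real assume "0 < a \<and> a \<le> b"
  then have ab: "0 < a" "a \<le> b" by auto
  note f' = ac_derivD[OF f] and g' = ac_derivD[OF g]
  note cf = ac_deriv_continuous_Icc[OF f ab(1), of b] and cg = ac_deriv_continuous_Icc[OF g ab(1), of b]
  let ?p = "\<lambda>t. f' t * g t + f t * g' t"
  show abs: "?p absolutely_integrable_on {a..b}"
    using absolutely_integrable_continuous_mult[OF cg f'(1)[OF ab]]
      absolutely_integrable_continuous_mult[OF cf g'(1)[OF ab]]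
    by (intro set_integral_add) (auto simp: mult.commute)
  then have ip: "?p integrable_on {a..b}" by (rule set_lebesgue_integral_eq_integral)
  have iq: "(\<lambda>t. \<bar>f' t\<bar> + \<bar>g' t\<bar>) integrable_on {a..b}"
    using f'(1)[OF ab] g'(1)[OF ab] by (intro integrable_add) (auto simp: absolutely_integrable_on_def)
  define J where "J = integral {a..b} (\<lambda>t. \<bar>f' t\<bar> + \<bar>g' t\<bar>)"
  define H where "H x = f x * g x - integral {a..x} ?p" for x
  have bound: "\<bar>H b - H a\<bar> \<le> e * J" if "0 < e" for e
  proof -
    from compact_uniformly_continuous[OF cf compact_Icc] obtain d1 where
      d1: "0 < d1" "\<And>s t. s \<in> {a..b} \<Longrightarrow> t \<in> {a..b} \<Longrightarrow> dist s t < d1 \<Longrightarrow> dist (f s) (f t) < e"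
      using \<open>0 < e\<close> unfolding uniformly_continuous_on_def by metis
    from compact_uniformly_continuous[OF cg compact_Icc] obtain d2 where
      d2: "0 < d2" "\<And>s t. s \<in> {a..b} \<Longrightarrow> t \<in> {a..b} \<Longrightarrow> dist s t < d2 \<Longrightarrow> dist (g s) (g t) < e"
      using \<open>0 < e\<close> unfolding uniformly_continuous_on_def by metis
    let ?\<Phi> = "\<lambda>x. e * integral {a..x} (\<lambda>t. \<bar>f' t\<bar> + \<bar>g' t\<bar>)"
    have "\<bar>H b - H a\<bar> \<le> ?\<Phi> b - ?\<Phi> a"
    proof (rule increment_bound_uniform_mesh[OF ab(2), of "min d1 d2"])
      show "0 < min d1 d2" using d1 d2 by simp
      fix x y assume xy: "a \<le> x" "x \<le> y" "y \<le> b" "y - x < min d1 d2"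
      have s1: "integral {a..y} ?p = integral {a..x} ?p + integral {x..y} ?p"
        using xy by (intro Henstock_Kurzweil_Integration.integral_combine[symmetric]
            integrable_on_subinterval[OF ip]) auto
      have s2: "integral {a..y} (\<lambda>t. \<bar>f' t\<bar> + \<bar>g' t\<bar>) =
          integral {a..x} (\<lambda>t. \<bar>f' t\<bar> + \<bar>g' t\<bar>) + integral {x..y} (\<lambda>t. \<bar>f' t\<bar> + \<bar>g' t\<bar>)"
        using xy by (intro Henstock_Kurzweil_Integration.integral_combine[symmetric]
            integrable_on_subinterval[OF iq]) auto
      have "\<bar>f y * g y - f x * g x - integral {x..y} ?p\<bar> \<le> e * integral {x..y} (\<lambda>t. \<bar>f' t\<bar> + \<bar>g' t\<bar>)"
      proof (rule ac_deriv_subinterval_bound[OF f g])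
        fix s t assume "s \<in> {x..y}" "t \<in> {x..y}"
        then have "s \<in> {a..b}" "t \<in> {a..b}" "dist s t < d1" "dist s t < d2"
          using xy by (auto simp: dist_real_def)
        then show "\<bar>f s - f t\<bar> \<le> e" "\<bar>g s - g t\<bar> \<le> e"
          using d1(2)[of s t] d2(2)[of s t] by (auto simp: dist_real_def)
      qed (use xy ab in auto)
      then show "\<bar>H y - H x\<bar> \<le> ?\<Phi> y - ?\<Phi> x"
        unfolding H_def s1 s2 by (simp add: algebra_simps)
    qed
    then show ?thesis by (simp add: J_def)
  qed
  have "H b = H a"
  proof (rule ccontr)
    assume ne: "H b \<noteq> H a"
    have "0 \<le> J" unfolding J_def by (rule integral_nonneg[OF iq]) auto
    \<comment> \<open>This value of \<open>e\<close> contradicts \<open>bound\<close>; the summand 1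
      covers \<open>J = 0\<close>.\<close>
    then have "\<bar>H b - H a\<bar> / (2 * (J + 1)) * J < \<bar>H b - H a\<bar>"
      using ne \<open>0 \<le> J\<close> by (auto simp: field_simps intro: add_nonneg_pos)
    moreover have "\<bar>H b - H a\<bar> \<le> \<bar>H b - H a\<bar> / (2 * (J + 1)) * J"
      using ne \<open>0 \<le> J\<close> by (intro bound) auto
    ultimately show False by simp
  qed
  then show "integral {a..b} ?p = f b * g b - f a * g a"
    by (simp add: H_def)
qed

section \<open>Integrals over the whole half-line and limits at its ends\<close>

abbreviation half_lebesgue :: "real measure" where
  "half_lebesgue \<equiv> lebesgue_on half_line"

lemma half_line_Int: "half_line \<inter> space lebesgue \<in> sets lebesgue"
  by simp

lemma integrable_half_iff:
  fixes f :: "real \<Rightarrow> real"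
  shows "integrable half_lebesgue f \<longleftrightarrow> f absolutely_integrable_on half_line"
  by (simp add: integrable_restrict_space set_integrable_def)

lemma borel_measurable_indicator_half:
  assumes "G \<in> borel_measurable half_lebesgue" "S \<in> sets lebesgue"
  shows "(\<lambda>x. indicator S x * G x :: real) \<in> borel_measurable half_lebesgue"
  by (rule borel_measurable_times[OF measurable_restrict_space1[OF borel_measurable_indicator]]) (use assms in auto)

lemma integrable_indicator_half:
  assumes "integrable half_lebesgue G" "S \<in> sets lebesgue"
  shows "integrable half_lebesgue (\<lambda>x. indicator S x * G x :: real)"
proof (rule Bochner_Integration.integrable_bound[OF assms(1)])
  show "(\<lambda>x. indicator S x * G x) \<in> borel_measurable half_lebesgue"
    using assms by (intro borel_measurable_indicator_half) auto
qed (auto simp: abs_mult mult_left_le_one_le)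

lemma ac_deriv_eq_half_integral:
  assumes "ac_deriv F G" "0 < a" "a \<le> b"
  shows "integrable half_lebesgue (\<lambda>x. indicator {a..b} x * G x)"
    and "(LINT x|half_lebesgue. indicator {a..b} x * G x) = F b - F a"
proof -
  have *: "indicat_real half_line x * (indicat_real {a..b} x * G x) = indicat_real {a..b} x * G x" for x
    using assms by (auto simp: indicator_def)
  show "integrable half_lebesgue (\<lambda>x. indicator {a..b} x * G x)"
    using ac_derivD(1)[OF assms] unfolding integrable_restrict_space[OF half_line_Int] set_integrable_def real_scaleR_def * .
  have "(LINT x|half_lebesgue. indicator {a..b} x * G x) = (LINT x:{a..b}|lebesgue. G x)"
    unfolding integral_restrict_space[OF half_line_Int] set_lebesgue_integral_def real_scaleR_def * ..
  also have "\<dots> = F b - F a"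
    using ac_derivD[OF assms] set_lebesgue_integral_eq_integral(2)[of "{a..b}" G] by simp
  finally show "(LINT x|half_lebesgue. indicator {a..b} x * G x) = F b - F a" .
qed

text \<open>Dominated convergence with the absolute value of \<open>G\<close> as majorant. The set
  \<open>S\<close> is left general so that a single proof yields the limit at infinity, the limit at
  0 and the integral over the whole half-line.\<close>

lemma ac_deriv_exhaustion:
  assumes F: "ac_deriv F G" and G: "integrable half_lebesgue G"
    and ab: "eventually (\<lambda>t::real. 0 < a t \<and> a t \<le> b t) at_top"
    and S: "\<And>x. 0 < x \<Longrightarrow> eventually (\<lambda>t. x \<in> {a t..b t} \<longleftrightarrow> x \<in> S) at_top"
    and "S \<in> sets lebesgue"
  shows "((\<lambda>t. F (b t) - F (a t)) \<longlongrightarrow> (LINT x|half_lebesgue. indicator S x * G x)) at_top"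
proof -
  have "((\<lambda>t. LINT x|half_lebesgue. indicator {a t..b t} x * G x) \<longlongrightarrow>
      (LINT x|half_lebesgue. indicator S x * G x)) at_top"
  proof (rule integral_dominated_convergence_at_top[where w = "\<lambda>x. \<bar>G x\<bar>"])
    show "AE x in half_lebesgue. ((\<lambda>t. indicator {a t..b t} x * G x) \<longlongrightarrow> indicator S x * G x) at_top"
    proof (rule AE_I2)
      fix x assume "x \<in> space half_lebesgue"
      then have "eventually (\<lambda>t. indicator {a t..b t} x * G x = indicator S x * G x) at_top"
        by (intro eventually_mono[OF S]) (auto simp: indicator_def)
      then show "((\<lambda>t. indicator {a t..b t} x * G x) \<longlongrightarrow> indicator S x * G x) at_top"
        by (simp add: tendsto_eventually)
    qed
    show "integrable half_lebesgue (\<lambda>x. \<bar>G x\<bar>)" using G by simp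
  qed (use \<open>S \<in> sets lebesgue\<close> G in \<open>auto intro!: borel_measurable_indicator_half always_eventually AE_I2
    simp: abs_mult mult_left_le_one_le\<close>)
  moreover have "eventually (\<lambda>t. (LINT x|half_lebesgue. indicator {a t..b t} x * G x) = F (b t) - F (a t)) at_top"
    using ab by eventually_elim (simp add: ac_deriv_eq_half_integral[OF F])
  ultimately show ?thesis by (rule Lim_transform_eventually)
qed

lemma ac_deriv_limit_at_top:
  assumes "ac_deriv F G" "integrable half_lebesgue G"
  shows "(F \<longlongrightarrow> F 1 + (LINT x|half_lebesgue. indicator {1..} x * G x)) at_top"
proof -
  have "((\<lambda>t. F t - F 1) \<longlongrightarrow> (LINT x|half_lebesgue. indicator {1..} x * G x)) at_top"
  proof (rule ac_deriv_exhaustion[OF assms])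
    show "eventually (\<lambda>t::real. 0 < (1::real) \<and> 1 \<le> t) at_top"
      by (rule eventually_mono[OF eventually_ge_at_top[of 1]]) simp
    fix x :: real
    show "eventually (\<lambda>t. x \<in> {1..t} \<longleftrightarrow> x \<in> {1..}) at_top"
      using eventually_ge_at_top[of x] by eventually_elim auto
  qed auto
  from tendsto_add[OF tendsto_const[of "F 1"] this] show ?thesis by simp
qed

lemma ac_deriv_limit_at_right_0:
  assumes "ac_deriv F G" "integrable half_lebesgue G"
  shows "(F \<longlongrightarrow> F 1 - (LINT x|half_lebesgue. indicator {..1} x * G x)) (at_right 0)"
proof -
  have "((\<lambda>t. F 1 - F (inverse t)) \<longlongrightarrow> (LINT x|half_lebesgue. indicator {..1} x * G x)) at_top"
  proof (rule ac_deriv_exhaustion[OF assms])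
    show "eventually (\<lambda>t. 0 < inverse t \<and> inverse t \<le> (1::real)) at_top"
      using eventually_ge_at_top[of 1] by eventually_elim (auto simp: field_simps)
    fix x :: real assume "0 < x"
    show "eventually (\<lambda>t. x \<in> {inverse t..1} \<longleftrightarrow> x \<in> {..1}) at_top"
      using eventually_ge_at_top[of "inverse x"] eventually_gt_at_top[of 0]
      by eventually_elim (use \<open>0 < x\<close> in \<open>auto simp: field_simps\<close>)
  qed auto
  from tendsto_diff[OF tendsto_const[of "F 1"] this] show ?thesis
    by (simp add: filterlim_at_right_to_top)
qed

lemma ac_deriv_half_integral:
  assumes F: "ac_deriv F G" and G: "integrable half_lebesgue G"
    and A: "(F \<longlongrightarrow> A) (at_right 0)" and B: "(F \<longlongrightarrow> B) at_top"
  shows "(LINT x|half_lebesgue. G x) = B - A"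
proof -
  have "((\<lambda>t. F t - F (inverse t)) \<longlongrightarrow> (LINT x|half_lebesgue. indicator UNIV x * G x)) at_top"
  proof (rule ac_deriv_exhaustion[OF assms(1,2)])
    show "eventually (\<lambda>t. 0 < inverse t \<and> inverse t \<le> (t::real)) at_top"
      using eventually_ge_at_top[of 1]
      by eventually_elim (simp add: order_trans[of _ 1] inverse_le_1_iff)
    fix x :: real assume "0 < x"
    show "eventually (\<lambda>t. x \<in> {inverse t..t} \<longleftrightarrow> x \<in> UNIV) at_top"
      using eventually_ge_at_top[of "inverse x"] eventually_ge_at_top[of x]
      by eventually_elim (use \<open>0 < x\<close> in \<open>auto simp: field_simps\<close>)
  qed auto
  moreover have "((\<lambda>t. F t - F (inverse t)) \<longlongrightarrow> B - A) at_top"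
    using A by (intro tendsto_diff B) (simp add: filterlim_at_right_to_top)
  ultimately show ?thesis
    using tendsto_unique[OF trivial_limit_at_top_linorder] by fastforce
qed

text \<open>In the variable \<open>y = L x\<close>, which runs over the whole line, the hypotheses say that \<open>F\<close>
  and its derivative are integrable; a limit of \<open>F\<close> at either end can then only be 0.\<close>

lemma ac_deriv_half_integral_eq_0:
  assumes F: "ac_deriv F G" and G: "integrable half_lebesgue G"
    and L: "ac_deriv L l" "\<And>x. 0 < x \<Longrightarrow> 0 \<le> l x"
    and L0: "filterlim L at_bot (at_right 0)" and L1: "filterlim L at_top at_top"
    and Fl: "integrable half_lebesgue (\<lambda>x. F x * l x)"
  shows "(LINT x|half_lebesgue. G x) = 0"
proof -
  define J where "J = (LINT x|half_lebesgue. \<bar>F x * l x\<bar>)"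
  \<comment> \<open>An interval on which the absolute value of \<open>F\<close> stays above
    \<open>c\<close> can carry only a bounded increment of \<open>L\<close>. Since \<open>L\<close>
    is unbounded at both ends, a nonzero limit of \<open>F\<close> is impossible.\<close>
  have bound: "c * (L b - L a) \<le> J"
    if ab: "0 < a" "a \<le> b" and c: "\<And>x. x \<in> {a..b} \<Longrightarrow> c \<le> \<bar>F x\<bar>" for a b c
  proof -
    have "c * (L b - L a) = (LINT x|half_lebesgue. c * (indicator {a..b} x * l x))"
      by (simp add: ac_deriv_eq_half_integral[OF L(1) ab])
    also have "\<dots> \<le> J"
      unfolding J_def
    proof (rule integral_mono)
      show "integrable half_lebesgue (\<lambda>x. c * (indicator {a..b} x * l x))"
        by (intro integrable_mult_right ac_deriv_eq_half_integral[OF L(1) ab])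
      show "integrable half_lebesgue (\<lambda>x. \<bar>F x * l x\<bar>)"
        using Fl by simp
      fix x assume "x \<in> space half_lebesgue"
      then show "c * (indicator {a..b} x * l x) \<le> \<bar>F x * l x\<bar>"
        using L(2)[of x] c[of x] by (auto simp: indicator_def abs_mult mult_right_mono)
    qed
    finally show ?thesis .
  qed
  have "A = 0" if A: "(F \<longlongrightarrow> A) (at_right 0)" for A
  proof (rule ccontr)
    assume "A \<noteq> 0"
    have "((\<lambda>x. \<bar>F x\<bar>) \<longlongrightarrow> \<bar>A\<bar>) (at_right 0)" by (intro tendsto_intros A)
    then have "eventually (\<lambda>x. \<bar>A\<bar> / 2 < \<bar>F x\<bar>) (at_right 0)"
      using \<open>A \<noteq> 0\<close> by (intro order_tendstoD(1)) auto
    then obtain d where d: "0 < d" "\<And>x. 0 < x \<Longrightarrow> x < d \<Longrightarrow> \<bar>A\<bar> / 2 < \<bar>F x\<bar>"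
      by (auto simp: eventually_at_right_field)
    \<comment> \<open>An increment of \<open>L\<close> beyond \<open>2 * J / \<bar>A\<bar>\<close>,
      multiplied by the lower bound \<open>\<bar>A\<bar> / 2\<close>, exceeds
      \<open>J\<close>.\<close>
    have "eventually (\<lambda>x. L x < L (d/2) - 2 * J / \<bar>A\<bar>) (at_right 0)"
      using L0 by (auto simp: filterlim_at_bot_dense)
    moreover have "eventually (\<lambda>x. 0 < x \<and> x < d/2) (at_right 0)"
      using d by (auto simp: eventually_at_right_field intro!: exI[of _ "d/2"])
    ultimately have "eventually (\<lambda>x. L x < L (d/2) - 2 * J / \<bar>A\<bar> \<and> 0 < x \<and> x < d/2) (at_right 0)"
      by eventually_elim auto
    then obtain x where x: "L x < L (d/2) - 2 * J / \<bar>A\<bar>" "0 < x" "x < d/2"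
      using eventually_happens'[OF trivial_limit_at_right_real] by blast
    have "\<bar>A\<bar> / 2 * (L (d/2) - L x) \<le> J"
      using x d by (intro bound less_imp_le[OF d(2)]) auto
    with x \<open>A \<noteq> 0\<close> show False by (simp add: field_simps)
  qed
  moreover have "B = 0" if B: "(F \<longlongrightarrow> B) at_top" for B
  proof (rule ccontr)
    assume "B \<noteq> 0"
    have "((\<lambda>x. \<bar>F x\<bar>) \<longlongrightarrow> \<bar>B\<bar>) at_top" by (intro tendsto_intros B)
    then have "eventually (\<lambda>x. \<bar>B\<bar> / 2 < \<bar>F x\<bar>) at_top"
      using \<open>B \<noteq> 0\<close> by (intro order_tendstoD(1)) auto
    then obtain d where d: "\<And>x. d \<le> x \<Longrightarrow> \<bar>B\<bar> / 2 < \<bar>F x\<bar>"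
      by (auto simp: eventually_at_top_linorder)
    have "eventually (\<lambda>x. L (max d 1) + 2 * J / \<bar>B\<bar> < L x) at_top"
      using L1 by (auto simp: filterlim_at_top_dense)
    then have "eventually (\<lambda>x. L (max d 1) + 2 * J / \<bar>B\<bar> < L x \<and> max d 1 \<le> x) at_top"
      using eventually_ge_at_top[of "max d 1"] by eventually_elim auto
    then obtain x where x: "L (max d 1) + 2 * J / \<bar>B\<bar> < L x" "max d 1 \<le> x"
      using eventually_happens'[OF trivial_limit_at_top_linorder] by blast
    have "\<bar>B\<bar> / 2 * (L x - L (max d 1)) \<le> J"
      using x by (intro bound less_imp_le[OF d]) auto
    with x \<open>B \<noteq> 0\<close> show False by (simp add: field_simps)
  qed
  ultimately show ?thesis
    using ac_deriv_limit_at_right_0[OF F G] ac_deriv_limit_at_top[OF F G] ac_deriv_half_integral[OF F G]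
    by fastforce
qed

section \<open>Weighted square-integrable functions\<close>

lemma ac_deriv_mono:
  assumes "ac_deriv F G" "0 < a" "a \<le> b" "\<And>x. x \<in> {a..b} \<Longrightarrow> 0 \<le> G x"
  shows "F a \<le> F b"
  using integral_nonneg[OF ac_derivD(2)[OF assms(1-3)] assms(4)] ac_derivD(3)[OF assms(1-3)] by simp

text \<open>Monotone convergence along growing compact intervals: finite limits of the primitive
  imply integrability. In this way the weight, and later the squares of \<open>g\<close> and
  \<open>k\<close> in \<open>adjoint_preimage\<close>, are shown to be integrable.\<close>

lemma ac_deriv_nonneg_integrable:
  assumes F: "ac_deriv F G" and G: "\<And>x. 0 < x \<Longrightarrow> 0 \<le> G x" "G \<in> borel_measurable half_lebesgue"
    and A: "(F \<longlongrightarrow> A) (at_right 0)" and B: "(F \<longlongrightarrow> B) at_top"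
  shows "integrable half_lebesgue G"
proof (rule integrable_monotone_convergence)
  define a :: "nat \<Rightarrow> real" where "a n = inverse (real (Suc n))" for n
  define b :: "nat \<Rightarrow> real" where "b n = real (Suc n)" for n
  have ab: "0 < a n" "a n \<le> b n" for n
    using mult_mono[of 1 "real (Suc n)" 1 "real (Suc n)"] by (auto simp: a_def b_def divide_simps)
  let ?I = "\<lambda>n x. indicator {a n..b n} x * G x"
  show "integrable half_lebesgue (?I n)" for n
    by (rule ac_deriv_eq_half_integral[OF F ab])
  have "a m \<le> a n" "b n \<le> b m" if "n \<le> m" for n m
    using that by (auto simp: a_def b_def divide_simps)
  then show "AE x in half_lebesgue. mono (\<lambda>n. ?I n x)"
    using G(1) by (intro AE_I2 monoI mult_right_mono) (auto simp: indicator_def intro: order_trans)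
  show "AE x in half_lebesgue. (\<lambda>n. ?I n x) \<longlonglongrightarrow> G x"
  proof (rule AE_I2)
    fix x assume "x \<in> space half_lebesgue"
    then have "0 < x" by simp
    have "eventually (\<lambda>n. max x (inverse x) \<le> real n) sequentially"
      using filterlim_at_top filterlim_real_sequentially by blast
    then have "eventually (\<lambda>n. ?I n x = G x) sequentially"
    proof eventually_elim
      case (elim n)
      then have "inverse x \<le> real (Suc n)" "x \<le> b n" by (auto simp: b_def)
      then have "a n \<le> x" unfolding a_def using \<open>0 < x\<close>
        by (metis inverse_inverse_eq le_imp_inverse_le positive_imp_inverse_positive)
      with \<open>x \<le> b n\<close> show ?case by simp
    qed
    then show "(\<lambda>n. ?I n x) \<longlonglongrightarrow> G x" by (rule tendsto_eventually)
  qed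
  have la: "filterlim a (at_right 0) sequentially"
    unfolding a_def by real_asymp
  have lb: "filterlim b at_top sequentially"
    unfolding b_def by real_asymp
  show "(\<lambda>n. LINT x|half_lebesgue. ?I n x) \<longlonglongrightarrow> B - A"
    unfolding ac_deriv_eq_half_integral[OF F ab]
    by (intro tendsto_diff filterlim_compose[OF A la] filterlim_compose[OF B lb])
qed (rule G)

lemma ac_deriv_indefinite:
  assumes "integrable half_lebesgue G"
  shows "ac_deriv (\<lambda>x. LINT y|half_lebesgue. indicator {..x} y * G y) G"
  unfolding ac_deriv_def
proof (intro allI impI)
  fix a b :: real assume ab: "0 < a \<and> a \<le> b"
  note int = integrable_indicator_half[OF assms]
  have abs: "G absolutely_integrable_on {a..b}"
    using assms ab unfolding integrable_half_iff by (rule_tac set_integrable_subset) auto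
  have "integral {a..b} G = (LINT y:{a..b}|lebesgue. G y)"
    using set_lebesgue_integral_eq_integral(2)[OF abs] by simp
  \<comment> \<open>The indicators of \<open>{..b}\<close> and \<open>{..a}\<close> differ by that
    of a half-open interval, so the endpoint \<open>a\<close> is dropped here.\<close>
  also have "\<dots> = (LINT y:{a<..b}|lebesgue. G y)"
    unfolding set_lebesgue_integral_def
  proof (rule integral_cong_AE)
    have "G absolutely_integrable_on {a<..b}"
      by (rule set_integrable_subset[OF abs]) auto
    with abs show "(\<lambda>y. indicator {a..b} y *\<^sub>R G y) \<in> borel_measurable lebesgue"
      "(\<lambda>y. indicator {a<..b} y *\<^sub>R G y) \<in> borel_measurable lebesgue"
      by (auto simp: set_integrable_def)
    have "AE y in lebesgue. y \<noteq> a"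
      using AE_not_in[of "{a}" lebesgue] by simp
    then show "AE y in lebesgue. indicator {a..b} y *\<^sub>R G y = indicator {a<..b} y *\<^sub>R G y"
      by eventually_elim (auto simp: indicator_def)
  qed
  also have "\<dots> = (LINT y|half_lebesgue. indicator {a<..b} y * G y)"
    using ab unfolding set_lebesgue_integral_def integral_restrict_space[OF half_line_Int]
    by (intro Bochner_Integration.integral_cong) (auto simp: indicator_def)
  also have "\<dots> = (LINT y|half_lebesgue. indicator {..b} y * G y - indicator {..a} y * G y)"
    using ab by (intro Bochner_Integration.integral_cong) (auto simp: indicator_def)
  also have "\<dots> = (LINT y|half_lebesgue. indicator {..b} y * G y) - (LINT y|half_lebesgue. indicator {..a} y * G y)"
    by (intro Bochner_Integration.integral_diff int) auto
  finally show "G absolutely_integrable_on {a..b} \<and> integral {a..b} G =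
      (LINT y|half_lebesgue. indicator {..b} y * G y) - (LINT y|half_lebesgue. indicator {..a} y * G y)"
    using abs by simp
qed

text \<open>The integral of the square of \<open>f - t * g\<close> is a nonnegative quadratic in
  \<open>t\<close>. Its minimiser \<open>b / c\<close> gives the claim; if \<open>c = 0\<close>, the
  quadratic is affine and must be constant.\<close>

lemma Cauchy_Schwarz_integral:
  fixes f g :: "'a \<Rightarrow> real"
  assumes f: "integrable M (\<lambda>x. (f x)\<^sup>2)" and g: "integrable M (\<lambda>x. (g x)\<^sup>2)"
    and fg: "integrable M (\<lambda>x. f x * g x)"
  shows "(LINT x|M. f x * g x)\<^sup>2 \<le> (LINT x|M. (f x)\<^sup>2) * (LINT x|M. (g x)\<^sup>2)"
proof -
  define a b c where "a = (LINT x|M. (f x)\<^sup>2)" and "b = (LINT x|M. f x * g x)" and "c = (LINT x|M. (g x)\<^sup>2)"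
  have q: "0 \<le> a - 2 * t * b + t\<^sup>2 * c" for t
  proof -
    have "0 \<le> (LINT x|M. (f x - t * g x)\<^sup>2)" by simp
    also have "\<dots> = (LINT x|M. (f x)\<^sup>2 - 2 * t * (f x * g x) + t\<^sup>2 * (g x)\<^sup>2)"
      by (intro Bochner_Integration.integral_cong) (auto simp: power2_eq_square algebra_simps)
    also have "\<dots> = a - 2 * t * b + t\<^sup>2 * c"
      using f g fg by (simp add: a_def b_def c_def)
    finally show ?thesis .
  qed
  have "0 \<le> c" by (simp add: c_def)
  show ?thesis
  proof (cases "c = 0")
    case True
    have "b = 0"
    proof (rule ccontr)
      assume "b \<noteq> 0"
      \<comment> \<open>At this \<open>t\<close> the affine function has the value -1.\<close>
      with q[of "(a + 1) / (2 * b)"] True show False by (simp add: field_simps)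
    qed
    then show ?thesis using True by (simp flip: a_def b_def c_def)
  next
    case False
    with \<open>0 \<le> c\<close> have "0 < c" by simp
    have "0 \<le> a - 2 * (b / c) * b + (b / c)\<^sup>2 * c" by (rule q)
    also have "\<dots> = a - b\<^sup>2 / c" using \<open>0 < c\<close> by (simp add: power2_eq_square field_simps)
    finally show ?thesis using \<open>0 < c\<close> by (simp add: field_simps flip: a_def b_def c_def)
  qed
qed

locale L2_weight =
  fixes \<rho> :: "real \<Rightarrow> real"
  assumes \<rho>_measurable [measurable]: "\<rho> \<in> borel_measurable half_lebesgue"
    and \<rho>_nonneg: "\<And>x. 0 < x \<Longrightarrow> 0 \<le> \<rho> x"
begin

lemma L2_integrable_mult:
  assumes "f \<in> L2_space \<rho>" "g \<in> L2_space \<rho>"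
  shows "integrable half_lebesgue (\<lambda>x. f x * g x * \<rho> x)"
proof (rule Bochner_Integration.integrable_bound)
  show "integrable half_lebesgue (\<lambda>x. (f x)\<^sup>2 * \<rho> x + (g x)\<^sup>2 * \<rho> x)"
    using assms by (auto simp: L2_space_def)
  show "(\<lambda>x. f x * g x * \<rho> x) \<in> borel_measurable half_lebesgue"
    using assms by (auto simp: L2_space_def)
  show "AE x in half_lebesgue. norm (f x * g x * \<rho> x) \<le> norm ((f x)\<^sup>2 * \<rho> x + (g x)\<^sup>2 * \<rho> x)"
  proof (rule AE_I2)
    fix x assume "x \<in> space half_lebesgue"
    then have "0 \<le> \<rho> x" using \<rho>_nonneg by simp
    have "\<bar>f x * g x\<bar> \<le> (f x)\<^sup>2 + (g x)\<^sup>2"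
      using sum_squares_bound[of "\<bar>f x\<bar>" "\<bar>g x\<bar>"] mult_nonneg_nonneg[of "\<bar>f x\<bar>" "\<bar>g x\<bar>"]
      unfolding abs_mult power2_abs by linarith
    from mult_right_mono[OF this \<open>0 \<le> \<rho> x\<close>] \<open>0 \<le> \<rho> x\<close>
    show "norm (f x * g x * \<rho> x) \<le> norm ((f x)\<^sup>2 * \<rho> x + (g x)\<^sup>2 * \<rho> x)"
      by (simp add: abs_mult algebra_simps)
  qed
qed

lemma L2_square_integrable: "f \<in> L2_space \<rho> \<Longrightarrow> integrable half_lebesgue (\<lambda>x. (f x)\<^sup>2 * \<rho> x)"
  by (simp add: L2_space_def)

lemma L2_cmult: "f \<in> L2_space \<rho> \<Longrightarrow> (\<lambda>x. c * f x) \<in> L2_space \<rho>"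
  by (auto simp: L2_space_def power_mult_distrib mult.assoc)

lemma L2_add:
  assumes "f \<in> L2_space \<rho>" "g \<in> L2_space \<rho>"
  shows "(\<lambda>x. f x + g x) \<in> L2_space \<rho>"
proof -
  have "integrable half_lebesgue (\<lambda>x. (f x)\<^sup>2 * \<rho> x + (g x)\<^sup>2 * \<rho> x + 2 * (f x * g x * \<rho> x))"
    using assms by (intro Bochner_Integration.integrable_add integrable_mult_right L2_integrable_mult L2_square_integrable)
  also have "(\<lambda>x. (f x)\<^sup>2 * \<rho> x + (g x)\<^sup>2 * \<rho> x + 2 * (f x * g x * \<rho> x)) = (\<lambda>x. (f x + g x)\<^sup>2 * \<rho> x)"
    by (auto simp: power2_eq_square algebra_simps)
  finally show ?thesis using assms by (auto simp: L2_space_def)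
qed

lemma L2_diff:
  assumes "f \<in> L2_space \<rho>" "g \<in> L2_space \<rho>"
  shows "(\<lambda>x. f x - g x) \<in> L2_space \<rho>"
  using L2_add[OF assms(1) L2_cmult[OF assms(2), of "-1"]] by simp

lemma L2_sum:
  assumes "\<And>i. i \<in> I \<Longrightarrow> f i \<in> L2_space \<rho>"
  shows "(\<lambda>x. \<Sum>i\<in>I. f i x) \<in> L2_space \<rho>"
  using assms
proof (induction I rule: infinite_finite_induct)
  case (insert i I)
  then show ?case using L2_add[of "f i" "\<lambda>x. \<Sum>i\<in>I. f i x"] by simp
qed (auto simp: L2_space_def)

lemma L2_AE_cong:
  assumes "f \<in> L2_space \<rho>" "g \<in> borel_measurable half_lebesgue" "AE x in half_lebesgue. g x = f x"
  shows "g \<in> L2_space \<rho>"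
proof -
  have "integrable half_lebesgue (\<lambda>x. (g x)\<^sup>2 * \<rho> x) \<longleftrightarrow> integrable half_lebesgue (\<lambda>x. (f x)\<^sup>2 * \<rho> x)"
    using assms by (intro integrable_cong_AE) (auto simp: L2_space_def)
  then show ?thesis using assms by (simp add: L2_space_def)
qed

lemma L2_inner_commute: "L2_inner \<rho> f g = L2_inner \<rho> g f"
  by (simp add: L2_inner_def mult.commute)

text \<open>Unconditional: a nonzero factor preserves nonintegrability, and then both integrals are
  0. Additivity has no such escape and is stated for members of \<open>L2_space\<close>.\<close>

lemma L2_inner_cmult: "L2_inner \<rho> f (\<lambda>x. c * g x) = c * L2_inner \<rho> f g"
  by (simp add: L2_inner_def mult_ac)

lemma L2_inner_add:
  assumes "f \<in> L2_space \<rho>" "g \<in> L2_space \<rho>" "h \<in> L2_space \<rho>"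
  shows "L2_inner \<rho> f (\<lambda>x. g x + h x) = L2_inner \<rho> f g + L2_inner \<rho> f h"
  using Bochner_Integration.integral_add[OF L2_integrable_mult[OF assms(1,2)] L2_integrable_mult[OF assms(1,3)]]
  by (simp add: L2_inner_def algebra_simps)

lemma L2_inner_Pythagoras:
  assumes "f \<in> L2_space \<rho>" "g \<in> L2_space \<rho>" "L2_inner \<rho> f g = 0"
  shows "L2_inner \<rho> (\<lambda>x. f x + g x) (\<lambda>x. f x + g x) = L2_inner \<rho> f f + L2_inner \<rho> g g"
proof -
  let ?s = "\<lambda>x. f x + g x"
  have "L2_inner \<rho> ?s ?s = L2_inner \<rho> ?s f + L2_inner \<rho> ?s g"
    by (rule L2_inner_add[OF L2_add assms(1,2)]) (rule assms)+
  also have "L2_inner \<rho> ?s f = L2_inner \<rho> f f"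
    using L2_inner_add[OF assms(1,1,2)] assms(3) by (simp add: L2_inner_commute[of ?s f])
  also have "L2_inner \<rho> ?s g = L2_inner \<rho> g g"
    using L2_inner_add[OF assms(2,1,2)] assms(3) by (simp add: L2_inner_commute[of ?s g] L2_inner_commute[of g f])
  finally show ?thesis .
qed

lemma L2_inner_diff:
  assumes "f \<in> L2_space \<rho>" "g \<in> L2_space \<rho>" "h \<in> L2_space \<rho>"
  shows "L2_inner \<rho> f (\<lambda>x. g x - h x) = L2_inner \<rho> f g - L2_inner \<rho> f h"
  using Bochner_Integration.integral_diff[OF L2_integrable_mult[OF assms(1,2)] L2_integrable_mult[OF assms(1,3)]]
  by (simp add: L2_inner_def algebra_simps)

lemma L2_inner_sum:
  assumes "f \<in> L2_space \<rho>" "finite I" "\<And>i. i \<in> I \<Longrightarrow> g i \<in> L2_space \<rho>"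
  shows "L2_inner \<rho> f (\<lambda>x. \<Sum>i\<in>I. g i x) = (\<Sum>i\<in>I. L2_inner \<rho> f (g i))"
  using assms(2,3)
proof (induction I)
  case (insert i I)
  then show ?case using L2_inner_add[OF assms(1), of "g i" "\<lambda>x. \<Sum>i\<in>I. g i x"] by (simp add: L2_sum)
qed (simp add: L2_inner_def)

lemma L2_inner_AE_cong:
  assumes "f \<in> borel_measurable half_lebesgue" "f' \<in> borel_measurable half_lebesgue"
    "g \<in> borel_measurable half_lebesgue" "g' \<in> borel_measurable half_lebesgue"
    "AE x in half_lebesgue. f x = f' x" "AE x in half_lebesgue. g x = g' x"
  shows "L2_inner \<rho> f g = L2_inner \<rho> f' g'"
  unfolding L2_inner_def using assms by (intro integral_cong_AE) auto

lemma L2_inner_self_nonneg: "0 \<le> L2_inner \<rho> f f"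
  unfolding L2_inner_def
  by (intro integral_nonneg_AE AE_I2) (auto simp: \<rho>_nonneg)

lemma L2_norm_eq: "L2_norm \<rho> f = sqrt (L2_inner \<rho> f f)"
  by (simp add: L2_norm_def L2_inner_def power2_eq_square)

lemma L2_measurable: "f \<in> L2_space \<rho> \<Longrightarrow> f \<in> borel_measurable half_lebesgue"
  by (simp add: L2_space_def)

end

lemma continuous_half_measurable:
  fixes f :: "real \<Rightarrow> real"
  shows "continuous_on half_line f \<Longrightarrow> f \<in> borel_measurable half_lebesgue"
  by (rule continuous_imp_measurable_on_sets_lebesgue) auto

text \<open>The right-hand side is the value of the left-hand function at its critical point
  \<open>t = a - 1\<close>. The bound is \<open>ln y \<le> y - 1\<close> at
  \<open>y = (1 + t) / a\<close>.\<close>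

lemma powr_plus1_exp_bound:
  fixes t :: real
  assumes "0 < a" "0 \<le> t"
  shows "(1 + t) powr a * exp (- t) \<le> exp (1 - a + a * ln a)"
proof -
  have "ln ((1 + t) / a) \<le> (1 + t) / a - 1"
    using assms by (intro ln_le_minus_one) auto
  then have "a * (ln (1 + t) - ln a) \<le> a * ((1 + t) / a - 1)"
    using assms by (intro mult_left_mono) (auto simp: ln_div)
  also have "a * ((1 + t) / a - 1) = 1 + t - a"
    using assms by (simp add: right_diff_distrib)
  finally have "a * ln (1 + t) - t \<le> 1 - a + a * ln a"
    by (simp add: right_diff_distrib)
  then have "exp (a * ln (1 + t) - t) \<le> exp (1 - a + a * ln a)" by simp
  then show ?thesis
    using assms by (simp add: powr_def exp_diff exp_minus field_simps)
qed

section \<open>The Laguerre weight in the variable \<open>z\<close>\<close>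

locale mapped_weight =
  fixes \<beta> \<gamma> :: real
  assumes \<beta>: "- 1 < \<beta>" and \<gamma>: "0 < \<gamma>"
begin

definition z :: "real \<Rightarrow> real" where "z x = (\<beta> + 1) * x powr \<gamma>"

definition dz :: "real \<Rightarrow> real" where "dz x = (\<beta> + 1) * \<gamma> * x powr (\<gamma> - 1)"

text \<open>The density with respect to \<open>z\<close>, whereas \<open>W\<close> is the density
  with respect to \<open>x\<close> and carries the Jacobian \<open>dz\<close> (\<open>W_eq\<close>).
  Boundary terms are products with \<open>E\<close>, integrands are products with
  \<open>W\<close>.\<close>

definition E :: "real \<Rightarrow> real \<Rightarrow> real" where "E \<theta> x = z x powr \<theta> * exp (- z x)"

abbreviation W :: "real \<Rightarrow> real \<Rightarrow> real" where "W \<theta> \<equiv> weight \<theta> \<beta> \<gamma>"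

lemma z_pos: "0 < x \<Longrightarrow> 0 < z x" and dz_pos: "0 < x \<Longrightarrow> 0 < dz x"
  and E_pos: "0 < x \<Longrightarrow> 0 < E \<theta> x"
  using \<beta> \<gamma> by (auto simp: z_def dz_def E_def)

lemma z_deriv: "0 < x \<Longrightarrow> (z has_real_derivative dz x) (at x)"
  unfolding z_def dz_def by (auto intro!: derivative_eq_intros simp: powr_diff field_simps)

lemma W_eq: "0 < x \<Longrightarrow> W \<theta> x = E \<theta> x * dz x"
proof -
  assume "0 < x"
  have "x powr (\<gamma> * (\<theta> + 1) - 1) = (x powr \<gamma>) powr \<theta> * x powr (\<gamma> - 1)"
    by (simp add: powr_powr algebra_simps flip: powr_add)
  moreover have "(\<beta> + 1) powr (\<theta> + 1) = (\<beta> + 1) powr \<theta> * (\<beta> + 1)"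
    using \<beta> by (simp add: powr_add)
  ultimately show ?thesis
    using \<beta> by (simp add: weight_def E_def z_def dz_def powr_mult minus_mult_left)
qed

lemma E_Suc: "0 < x \<Longrightarrow> E (\<theta> + 1) x = z x * E \<theta> x"
  using z_pos[of x] by (simp add: E_def powr_add)

lemma E_add: "0 < x \<Longrightarrow> E (\<theta> + real k) x = z x ^ k * E \<theta> x"
  using z_pos[of x] by (simp add: E_def powr_add powr_realpow)

lemma W_Suc: "0 < x \<Longrightarrow> W (\<theta> + 1) x = z x * W \<theta> x"
  by (simp add: W_eq E_Suc)

lemma W_add: "0 < x \<Longrightarrow> W (\<theta> + real k) x = z x ^ k * W \<theta> x"
  by (simp add: W_eq E_add)

lemma W_pos: "0 < x \<Longrightarrow> 0 < W \<theta> x"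
  by (simp add: W_eq E_pos dz_pos)

lemma E_deriv: "0 < x \<Longrightarrow> (E \<theta> has_real_derivative (\<theta> / z x - 1) * E \<theta> x * dz x) (at x)"
  unfolding E_def
  by (auto intro!: derivative_eq_intros z_deriv simp: z_pos powr_diff field_simps dest: z_pos)

text \<open>The Pearson equation of the Laguerre weight. The factor
  \<open>\<theta> + 1 - z x\<close> is the zeroth-order coefficient in the adjoint of the
  derivative.\<close>

lemma E_Suc_deriv: "0 < x \<Longrightarrow> (E (\<theta> + 1) has_real_derivative (\<theta> + 1 - z x) * W \<theta> x) (at x)"
  by (rule DERIV_cong[OF E_deriv[of x "\<theta> + 1"]], simp, subst E_Suc)
    (use z_pos[of x] in \<open>auto simp: W_eq field_simps\<close>)

lemma z_continuous: "continuous_on half_line z" and dz_continuous: "continuous_on half_line dz"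
  unfolding z_def dz_def by (auto intro!: continuous_intros)

lemma E_continuous: "continuous_on half_line (E \<theta>)"
  unfolding E_def by (intro continuous_intros z_continuous) (auto dest: z_pos)

lemma W_continuous: "continuous_on half_line (W \<theta>)"
  by (subst continuous_on_cong[OF refl W_eq]) (auto intro!: continuous_intros E_continuous dz_continuous)

lemmas z_measurable [measurable] = continuous_half_measurable[OF z_continuous]
lemmas dz_measurable [measurable] = continuous_half_measurable[OF dz_continuous]
lemmas E_measurable [measurable] = continuous_half_measurable[OF E_continuous]

sublocale w: L2_weight "W \<theta>" for \<theta>
  by unfold_locales (auto intro: continuous_half_measurable W_continuous less_imp_le W_pos)

lemma z_at_right_0: "filterlim z (at_right 0) (at_right 0)"
proof -
  have "(z \<longlongrightarrow> 0) (at_right 0)"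
  proof -
    have "((\<lambda>x. x powr \<gamma>) \<longlongrightarrow> 0) (at_right 0)" using \<gamma> by real_asymp
    from tendsto_mult_right_zero[OF this] show ?thesis by (simp add: z_def[abs_def])
  qed
  then show ?thesis
    by (rule tendsto_imp_filterlim_at_right)
      (auto simp: eventually_at_right_field intro!: exI[of _ 1] z_pos)
qed

lemma z_at_top: "filterlim z at_top at_top"
proof -
  have "filterlim (\<lambda>x. x powr \<gamma>) at_top at_top" using \<gamma> by real_asymp
  then show ?thesis unfolding z_def
    using \<beta> by (intro filterlim_tendsto_pos_mult_at_top[OF tendsto_const]) auto
qed

lemma E_at_top: "(E \<theta> \<longlongrightarrow> 0) at_top"
proof -
  have "((\<lambda>t. t powr \<theta> * exp (- t)) \<longlongrightarrow> 0) at_top" by real_asymp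
  from filterlim_compose[OF this z_at_top] show ?thesis by (simp add: E_def[abs_def])
qed

text \<open>The logarithmic scale is \<open>L = ln z\<close>. Since
  \<open>E (\<theta> + 1) * dz / z\<close> is \<open>W \<theta>\<close>, for a boundary term with
  factor \<open>E (\<theta> + 1)\<close> the last assumption says that the other factor is
  integrable against \<open>W \<theta>\<close>.\<close>

lemma half_integral_eq_0:
  assumes F: "ac_deriv F G" and G: "integrable half_lebesgue G"
    and Fz: "integrable half_lebesgue (\<lambda>x. F x * (dz x / z x))"
  shows "(LINT x|half_lebesgue. G x) = 0"
proof (rule ac_deriv_half_integral_eq_0[OF F G _ _ _ _ Fz])
  show "ac_deriv (\<lambda>x. ln (z x)) (\<lambda>x. dz x / z x)"
  proof (rule ac_deriv_C1)
    show "((\<lambda>x. ln (z x)) has_real_derivative dz x / z x) (at x)" if "0 < x" for x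
      using that by (auto intro!: derivative_eq_intros z_deriv z_pos simp: field_simps)
    show "continuous_on half_line (\<lambda>x. dz x / z x)"
      by (intro continuous_intros z_continuous dz_continuous) (auto dest: z_pos)
  qed
  show "filterlim (\<lambda>x. ln (z x)) at_bot (at_right 0)"
    by (rule filterlim_compose[OF ln_at_0 z_at_right_0])
  show "filterlim (\<lambda>x. ln (z x)) at_top at_top"
    by (rule filterlim_compose[OF ln_at_top z_at_top])
qed (simp add: less_imp_le z_pos dz_pos)

text \<open>Comparison with \<open>G\<close>, the derivative of the power
  \<open>\<theta> + 1\<close> of \<open>z / (1 + z)\<close>. Because
  \<open>\<theta> + 1 > 0\<close>, that power has the limits 0 and 1 at the two ends, so
  \<open>G\<close> is integrable; the ratio of \<open>W \<theta>\<close> to \<open>G\<close> is a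
  multiple of \<open>(1 + z) powr (\<theta> + 2) * exp (- z)\<close>.\<close>

lemma W_integrable:
  assumes "- 1 < \<theta>"
  shows "integrable half_lebesgue (W \<theta>)"
proof -
  define F where "F x = (z x / (1 + z x)) powr (\<theta> + 1)" for x
  define G where "G x = (\<theta> + 1) * (z x / (1 + z x)) powr \<theta> * (dz x / (1 + z x)\<^sup>2)" for x
  have nz: "1 + z x \<noteq> 0" "0 < z x / (1 + z x)" if "0 < x" for x
    using z_pos[OF that] by auto
  have contG: "continuous_on half_line G"
    unfolding G_def by (intro continuous_intros z_continuous dz_continuous) (use nz z_pos in force)+
  have "ac_deriv F G"
  proof (rule ac_deriv_C1[OF _ contG])
    fix x :: real assume "0 < x"
    have "((\<lambda>x. z x / (1 + z x)) has_real_derivative dz x / (1 + z x)\<^sup>2) (at x)"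
      using nz[OF \<open>0 < x\<close>] by (auto intro!: derivative_eq_intros z_deriv \<open>0 < x\<close> simp: field_simps power2_eq_square)
    from has_real_derivative_powr[THEN DERIV_chain2, OF nz(2)[OF \<open>0 < x\<close>] this, of "\<theta> + 1"]
    show "(F has_real_derivative G x) (at x)"
      by (simp add: F_def[abs_def] G_def)
  qed
  moreover have "0 \<le> G x" if "0 < x" for x
    using assms dz_pos[OF that] by (simp add: G_def)
  moreover have "(F \<longlongrightarrow> 0) (at_right 0)"
  proof -
    have "((\<lambda>t. (t / (1 + t)) powr (\<theta> + 1)) \<longlongrightarrow> 0) (at_right 0)" using assms by real_asymp
    from filterlim_compose[OF this z_at_right_0] show ?thesis by (simp add: F_def[abs_def])
  qed
  moreover have "(F \<longlongrightarrow> 1) at_top"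
  proof -
    have "((\<lambda>t. (t / (1 + t)) powr (\<theta> + 1)) \<longlongrightarrow> 1) at_top" using assms by real_asymp
    from filterlim_compose[OF this z_at_top] show ?thesis by (simp add: F_def[abs_def])
  qed
  ultimately have intG: "integrable half_lebesgue G"
    by (intro ac_deriv_nonneg_integrable continuous_half_measurable contG) auto
  \<comment> \<open>The bound from \<open>powr_plus1_exp_bound\<close> for the exponent
    \<open>\<theta> + 2\<close>, divided by the factor \<open>\<theta> + 1\<close> that
    \<open>G\<close> contains.\<close>
  define C where "C = exp (1 - (\<theta> + 2) + (\<theta> + 2) * ln (\<theta> + 2)) / (\<theta> + 1)"
  show ?thesis
  proof (rule Bochner_Integration.integrable_bound)
    show "integrable half_lebesgue (\<lambda>x. C * G x)" using intG by simp
    show "AE x in half_lebesgue. norm (W \<theta> x) \<le> norm (C * G x)"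
    proof (rule AE_I2)
      fix x assume "x \<in> space half_lebesgue"
      then have x: "0 < x" by simp
      have p: "0 < z x" "0 < 1 + z x" "0 < dz x" using z_pos[OF x] dz_pos[OF x] by auto
      have "W \<theta> x = (1 + z x) powr (\<theta> + 2) * exp (- z x) * ((z x / (1 + z x)) powr \<theta> * (dz x / (1 + z x)\<^sup>2))"
        using p by (simp add: W_eq[OF x] E_def powr_divide powr_add)
      also have "\<dots> \<le> (C * (\<theta> + 1)) * ((z x / (1 + z x)) powr \<theta> * (dz x / (1 + z x)\<^sup>2))"
        using powr_plus1_exp_bound[of "\<theta> + 2" "z x"] p assms
        by (intro mult_right_mono) (auto simp: C_def)
      also have "\<dots> = C * G x" by (simp add: G_def)
      finally show "norm (W \<theta> x) \<le> norm (C * G x)" using W_pos[OF x, of \<theta>] by simp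
    qed
  qed simp
qed

text \<open>Squaring \<open>z ^ k\<close> only raises the parameter of the weight by
  \<open>2 * k\<close>. The case \<open>k = 0\<close> says that constants are members, so that every
  member is integrable against the weight.\<close>

lemma z_power_L2: "- 1 < \<theta> \<Longrightarrow> (\<lambda>x. z x ^ k) \<in> L2_space (W \<theta>)"
proof -
  assume "- 1 < \<theta>"
  then have "integrable half_lebesgue (W (\<theta> + real (2 * k)))" by (intro W_integrable) simp
  then have "integrable half_lebesgue (\<lambda>x. (z x ^ k)\<^sup>2 * W \<theta> x)"
    by (subst Bochner_Integration.integrable_cong[OF refl, where g = "W (\<theta> + real (2 * k))"])
      (simp_all only: space_lebesgue_on greaterThan_iff W_add power_mult power_even_eq mult.commute)
  then show ?thesis by (auto simp: L2_space_def)
qed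

end

section \<open>Incomplete integrals of the weight and integration by parts\<close>

lemma half_integral_tail:
  fixes G :: "real \<Rightarrow> real"
  assumes "integrable half_lebesgue G"
  shows "(LINT y|half_lebesgue. indicator {x<..} y * G y) =
      (LINT y|half_lebesgue. G y) - (LINT y|half_lebesgue. indicator {..x} y * G y)"
proof -
  have "(LINT y|half_lebesgue. indicator {x<..} y * G y) = (LINT y|half_lebesgue. G y - indicator {..x} y * G y)"
    by (intro Bochner_Integration.integral_cong) (auto simp: indicator_def)
  then show ?thesis
    using integrable_indicator_half[OF assms, of "{..x}"] assms by simp
qed

lemma indefinite_at_right_0:
  fixes G :: "real \<Rightarrow> real"
  assumes "integrable half_lebesgue G"
  shows "((\<lambda>x. LINT y|half_lebesgue. indicator {..x} y * G y) \<longlongrightarrow> 0) (at_right 0)"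
  using ac_deriv_limit_at_right_0[OF ac_deriv_indefinite[OF assms] assms] by simp

lemma indefinite_at_top:
  fixes G :: "real \<Rightarrow> real"
  assumes "integrable half_lebesgue G"
  shows "((\<lambda>x. LINT y|half_lebesgue. indicator {..x} y * G y) \<longlongrightarrow> (LINT y|half_lebesgue. G y)) at_top"
proof -
  let ?K = "\<lambda>x. LINT y|half_lebesgue. indicator {..x} y * G y"
  have "(LINT y|half_lebesgue. G y) = (?K 1 + (LINT y|half_lebesgue. indicator {1..} y * G y)) - 0"
    by (rule ac_deriv_half_integral[OF ac_deriv_indefinite[OF assms] assms
          indefinite_at_right_0[OF assms] ac_deriv_limit_at_top[OF ac_deriv_indefinite[OF assms] assms]])
  with ac_deriv_limit_at_top[OF ac_deriv_indefinite[OF assms] assms] show ?thesis by simp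
qed

lemma ac_deriv_nonneg_of_limit_0:
  assumes P: "ac_deriv P p" and "\<And>y. 0 < y \<Longrightarrow> y \<le> x \<Longrightarrow> 0 \<le> p y"
    and lim: "(P \<longlongrightarrow> 0) (at_right 0)" and "0 < x"
  shows "0 \<le> P x"
proof (rule tendsto_upperbound[OF lim])
  show "eventually (\<lambda>a. P a \<le> P x) (at_right 0)"
    using \<open>0 < x\<close> assms(2)
    by (auto simp: eventually_at_right_field intro!: exI[of _ x] ac_deriv_mono[OF P])
qed simp

lemma ac_deriv_nonneg_of_limit_top:
  assumes P: "ac_deriv P p" and "\<And>y. x \<le> y \<Longrightarrow> p y \<le> 0"
    and lim: "(P \<longlongrightarrow> 0) at_top" and "0 < x"
  shows "0 \<le> P x"
proof (rule tendsto_upperbound[OF lim])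
  show "eventually (\<lambda>b. P b \<le> P x) at_top"
    using eventually_ge_at_top[of x]
  proof eventually_elim
    case (elim b)
    have "ac_deriv (\<lambda>y. (- 1) * P y) (\<lambda>y. 0 * P y + (- 1) * p y)"
      by (rule ac_deriv_mult[OF ac_deriv_const P])
    from ac_deriv_mono[OF this \<open>0 < x\<close> elim] assms(2) show ?case by simp
  qed
qed simp

context mapped_weight
begin

text \<open>Replacing \<open>exp (- z)\<close> by 1 leaves the integrand
  \<open>z powr \<theta>\<close>. The difference of the two sides is nondecreasing and tends to 0 at
  0.\<close>

lemma W_indefinite_le:
  assumes "- 1 < \<theta>" "0 < x"
  shows "(LINT y|half_lebesgue. indicator {..x} y * W \<theta> y) \<le> z x powr (\<theta> + 1) / (\<theta> + 1)"
proof -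
  let ?\<omega> = "\<lambda>x. LINT y|half_lebesgue. indicator {..x} y * W \<theta> y"
  have i: "integrable half_lebesgue (W \<theta>)" using assms by (intro W_integrable)
  have "ac_deriv (\<lambda>x. z x powr (\<theta> + 1) / (\<theta> + 1)) (\<lambda>x. z x powr \<theta> * dz x)"
  proof (rule ac_deriv_C1)
    show "((\<lambda>x. z x powr (\<theta> + 1) / (\<theta> + 1)) has_real_derivative z x powr \<theta> * dz x) (at x)" if "0 < x" for x
      using that assms by (auto intro!: derivative_eq_intros z_deriv z_pos)
    show "continuous_on half_line (\<lambda>x. z x powr \<theta> * dz x)"
      by (intro continuous_intros z_continuous dz_continuous) (auto dest: z_pos)
  qed
  from ac_deriv_add[OF this ac_deriv_mult[OF ac_deriv_const[of "-1"] ac_deriv_indefinite[OF i]]]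
  have "ac_deriv (\<lambda>x. z x powr (\<theta> + 1) / (\<theta> + 1) - ?\<omega> x) (\<lambda>x. z x powr \<theta> * dz x - W \<theta> x)"
    by simp
  moreover have "0 \<le> z y powr \<theta> * dz y - W \<theta> y" if "0 < y" for y
    using z_pos[OF that] dz_pos[OF that]
    by (simp add: W_eq[OF that] E_def mult_right_le_one_le)
  moreover have "((\<lambda>x. z x powr (\<theta> + 1) / (\<theta> + 1) - ?\<omega> x) \<longlongrightarrow> 0 - 0) (at_right 0)"
  proof (intro tendsto_diff indefinite_at_right_0[OF i])
    have "((\<lambda>t. t powr (\<theta> + 1) / (\<theta> + 1)) \<longlongrightarrow> 0) (at_right 0)" using assms by real_asymp
    from filterlim_compose[OF this z_at_right_0]
    show "((\<lambda>x. z x powr (\<theta> + 1) / (\<theta> + 1)) \<longlongrightarrow> 0) (at_right 0)" .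
  qed
  ultimately have "0 \<le> z x powr (\<theta> + 1) / (\<theta> + 1) - ?\<omega> x"
    using assms by (intro ac_deriv_nonneg_of_limit_0) auto
  then show ?thesis by simp
qed

lemma z_mono: "0 < x \<Longrightarrow> x \<le> y \<Longrightarrow> z x \<le> z y"
  using \<beta> \<gamma> by (auto simp: z_def intro!: powr_mono2)

text \<open>For \<open>z \<ge> 2 * \<theta>\<close> the logarithmic derivative
  \<open>\<theta> / z - 1\<close> of \<open>E \<theta>\<close> is at most -1/2; this is the origin
  of the factor 2. Thus \<open>2 * E \<theta>\<close> minus the tail is nonincreasing, with limit 0
  at infinity.\<close>

lemma W_tail_le:
  assumes "- 1 < \<theta>" "0 < x" "2 * \<theta> \<le> z x"
  shows "(LINT y|half_lebesgue. indicator {x<..} y * W \<theta> y) \<le> 2 * E \<theta> x"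
proof -
  let ?\<omega> = "\<lambda>x. LINT y|half_lebesgue. indicator {..x} y * W \<theta> y"
  let ?I = "LINT y|half_lebesgue. W \<theta> y"
  have i: "integrable half_lebesgue (W \<theta>)" using assms by (intro W_integrable)
  have "ac_deriv (E \<theta>) (\<lambda>x. (\<theta> / z x - 1) * E \<theta> x * dz x)"
    by (intro ac_deriv_C1 E_deriv continuous_intros E_continuous z_continuous dz_continuous) (auto dest: z_pos)
  from ac_deriv_add[OF ac_deriv_mult[OF ac_deriv_const[of 2] this]
      ac_deriv_add[OF ac_deriv_const[of "- ?I"] ac_deriv_indefinite[OF i]]]
  have "ac_deriv (\<lambda>x. 2 * E \<theta> x - ?I + ?\<omega> x) (\<lambda>x. 2 * ((\<theta> / z x - 1) * E \<theta> x * dz x) + W \<theta> x)"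
    by (simp add: add_diff_eq algebra_simps)
  moreover have "2 * ((\<theta> / z y - 1) * E \<theta> y * dz y) + W \<theta> y \<le> 0" if "x \<le> y" for y
  proof -
    have "0 < y" using assms that by simp
    have "2 * \<theta> \<le> z y" using z_mono[of x y] assms that by simp
    then have "2 * (\<theta> / z y - 1) + 1 \<le> 0" using z_pos[OF \<open>0 < y\<close>] by (simp add: field_simps)
    then have "(2 * (\<theta> / z y - 1) + 1) * W \<theta> y \<le> 0"
      using W_pos[OF \<open>0 < y\<close>, of \<theta>] by (simp add: mult_le_0_iff)
    then show ?thesis by (simp add: W_eq[OF \<open>0 < y\<close>] algebra_simps)
  qed
  moreover have "((\<lambda>x. 2 * E \<theta> x - ?I + ?\<omega> x) \<longlongrightarrow> 2 * 0 - ?I + ?I) at_top"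
    by (intro tendsto_intros E_at_top indefinite_at_top[OF i])
  ultimately have "0 \<le> 2 * E \<theta> x - ?I + ?\<omega> x"
    using assms by (intro ac_deriv_nonneg_of_limit_top) auto
  then show ?thesis by (simp add: half_integral_tail[OF i])
qed

text \<open>The indicator is kept in both factors. For a neighbourhood of an end the first factor is
  then the tail of a convergent integral, which makes the boundary terms tend to 0 instead of merely
  staying bounded.\<close>

lemma indicator_Cauchy_Schwarz:
  assumes "- 1 < \<theta>" "f \<in> L2_space (W \<theta>)" "S \<in> sets lebesgue"
  shows "(LINT y|half_lebesgue. indicator S y * (f y * W \<theta> y))\<^sup>2 \<le>
     (LINT y|half_lebesgue. indicator S y * ((f y)\<^sup>2 * W \<theta> y)) * (LINT y|half_lebesgue. indicator S y * W \<theta> y)"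
proof -
  let ?a = "\<lambda>y. indicat_real S y * f y * sqrt (W \<theta> y)" and ?b = "\<lambda>y. indicat_real S y * sqrt (W \<theta> y)"
  have eq: "(?a y)\<^sup>2 = indicator S y * ((f y)\<^sup>2 * W \<theta> y)" "(?b y)\<^sup>2 = indicator S y * W \<theta> y"
    "?a y * ?b y = indicator S y * (f y * W \<theta> y)" if "y \<in> space half_lebesgue" for y
    using that W_pos[of y \<theta>] by (auto simp: power_mult_distrib indicator_def)
  have one: "(\<lambda>x. 1) \<in> L2_space (W \<theta>)" using z_power_L2[of \<theta> 0] assms by simp
  have i1: "integrable half_lebesgue (\<lambda>y. (?a y)\<^sup>2)"
    using w.L2_square_integrable[OF assms(2)] assms(3)
    by (subst Bochner_Integration.integrable_cong[OF refl eq(1)]) (auto intro: integrable_indicator_half)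
  have i2: "integrable half_lebesgue (\<lambda>y. (?b y)\<^sup>2)"
    using W_integrable[OF assms(1)] assms(3)
    by (subst Bochner_Integration.integrable_cong[OF refl eq(2)]) (auto intro: integrable_indicator_half)
  have i3: "integrable half_lebesgue (\<lambda>y. ?a y * ?b y)"
    using w.L2_integrable_mult[OF assms(2) one] assms(3)
    by (subst Bochner_Integration.integrable_cong[OF refl eq(3)]) (auto intro: integrable_indicator_half)
  from Cauchy_Schwarz_integral[OF i1 i2 i3] show ?thesis
    by (simp only: eq cong: Bochner_Integration.integral_cong)
qed

lemma ac_deriv_E:
  "ac_deriv (E (\<theta> + 1)) (\<lambda>x. (\<theta> + 1 - z x) * W \<theta> x)"
  by (intro ac_deriv_C1 E_Suc_deriv continuous_intros z_continuous W_continuous)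

text \<open>Moving the derivative onto \<open>E (\<theta> + k + 1)\<close> reproduces only
  \<open>z ^ k\<close> and \<open>z ^ (k + 1)\<close>. Hence orthogonality of \<open>f\<close> to
  the first n powers gives orthogonality of \<open>h\<close> to the first n - 1, for the raised
  weight.\<close>

lemma integration_by_parts_step:
  assumes \<theta>: "- 1 < \<theta>" and f: "ac_deriv f (\<lambda>x. dz x * h x)" "f \<in> L2_space (W \<theta>)" "h \<in> L2_space (W (\<theta> + 1))"
  shows "L2_inner (W (\<theta> + 1)) h (\<lambda>x. z x ^ k) =
    L2_inner (W \<theta>) f (\<lambda>x. z x ^ (k + 1)) - (real k + \<theta> + 1) * L2_inner (W \<theta>) f (\<lambda>x. z x ^ k)"
proof -
  define G where "G x = h x * z x ^ k * W (\<theta> + 1) x +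
     ((real k + \<theta> + 1) * (f x * z x ^ k * W \<theta> x) - f x * z x ^ (k + 1) * W \<theta> x)" for x
  have i: "integrable half_lebesgue (\<lambda>x. h x * z x ^ k * W (\<theta> + 1) x)"
     "integrable half_lebesgue (\<lambda>x. f x * z x ^ j * W \<theta> x)" for j
    using \<theta> by (auto intro!: w.L2_integrable_mult f z_power_L2)
  have "ac_deriv (\<lambda>x. f x * E (\<theta> + real k + 1) x) G"
    by (rule ac_deriv_cong[THEN iffD1, OF _ _ ac_deriv_mult[OF f(1) ac_deriv_E[of "\<theta> + real k"]]])
      (simp_all only: G_def W_Suc W_add W_eq E_Suc E_add, simp_all add: algebra_simps)
  moreover have "integrable half_lebesgue G"
    unfolding G_def[abs_def] by (intro Bochner_Integration.integrable_add Bochner_Integration.integrable_diff integrable_mult_right i)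
  moreover have "integrable half_lebesgue (\<lambda>x. f x * E (\<theta> + real k + 1) x * (dz x / z x))"
    by (rule Bochner_Integration.integrable_cong[THEN iffD1, OF refl _ i(2)[of k]])
      (use z_pos in \<open>force simp: E_Suc E_add W_eq\<close>)+
  ultimately have "(LINT x|half_lebesgue. G x) = 0"
    by (rule half_integral_eq_0)
  then show ?thesis
    using i(1) i(2)[of k] i(2)[of "k + 1"] by (simp add: G_def L2_inner_def)
qed

end

section \<open>The weighted Poincare inequality\<close>

context mapped_weight
begin

text \<open>For \<open>g = - K / E (\<theta> + 1)\<close> these are the boundary terms
  \<open>(\<theta> + 1 - z) * E (\<theta> + 1) * g\<^sup>2\<close> of the norm identity.
  Cauchy-Schwarz bounds \<open>K\<^sup>2\<close> by the mass of \<open>f\<^sup>2\<close> near the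
  end, which tends to 0, times the mass of the weight there. Near 0 the latter is at most a multiple
  of \<open>E (\<theta> + 1)\<close>; near infinity it is at most a multiple of
  \<open>E (\<theta> + 1) / z\<close>, which pays for the growing factor
  \<open>\<theta> + 1 - z\<close>.\<close>

lemma primitive_boundary_limits:
  assumes \<theta>: "- 1 < \<theta>" and f: "f \<in> L2_space (W \<theta>)" and f0: "(LINT x|half_lebesgue. f x * W \<theta> x) = 0"
  defines "K \<equiv> \<lambda>x. LINT y|half_lebesgue. indicator {..x} y * (f y * W \<theta> y)"
  shows "((\<lambda>x. (\<theta> + 1 - z x) * ((K x)\<^sup>2 / E (\<theta> + 1) x)) \<longlongrightarrow> 0) (at_right 0)"
    and "((\<lambda>x. (\<theta> + 1 - z x) * ((K x)\<^sup>2 / E (\<theta> + 1) x)) \<longlongrightarrow> 0) at_top"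
proof -
  have one: "(\<lambda>x. 1) \<in> L2_space (W \<theta>)" using z_power_L2[of \<theta> 0] \<theta> by simp
  have ifW: "integrable half_lebesgue (\<lambda>x. f x * W \<theta> x)"
    using w.L2_integrable_mult[OF f one] by simp
  note i2 = w.L2_square_integrable[OF f] and iW = W_integrable[OF \<theta>]
  define a where "a x = (LINT y|half_lebesgue. indicator {..x} y * ((f y)\<^sup>2 * W \<theta> y))" for x
  define a' where "a' x = (LINT y|half_lebesgue. indicator {x<..} y * ((f y)\<^sup>2 * W \<theta> y))" for x
  have [simp]: "{..x} \<in> sets lebesgue" "{x<..} \<in> sets lebesgue" for x :: real by auto
  have nonneg: "0 \<le> a x" "0 \<le> a' x" for x
    unfolding a_def a'_def
    by (intro integral_nonneg_AE AE_I2; simp add: less_imp_le[OF W_pos])+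
  have a0: "(a \<longlongrightarrow> 0) (at_right 0)"
    unfolding a_def[abs_def] by (rule indefinite_at_right_0[OF i2])
  have a'0: "(a' \<longlongrightarrow> 0) at_top"
    using tendsto_diff[OF tendsto_const indefinite_at_top[OF i2], of "LINT x|half_lebesgue. (f x)\<^sup>2 * W \<theta> x"]
    by (simp add: a'_def[abs_def] half_integral_tail[OF i2])
  let ?B = "\<lambda>x. (\<theta> + 1 - z x) * ((K x)\<^sup>2 / E (\<theta> + 1) x)"
  show "(?B \<longlongrightarrow> 0) (at_right 0)"
  proof (rule Lim_null_comparison)
    have "(K x)\<^sup>2 / E (\<theta> + 1) x \<le> a x * exp (z x) / (\<theta> + 1)" if x: "0 < x" for x
    proof -
      have "(K x)\<^sup>2 \<le> a x * (LINT y|half_lebesgue. indicator {..x} y * W \<theta> y)"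
        unfolding K_def a_def by (rule indicator_Cauchy_Schwarz[OF \<theta> f]) simp
      also have "\<dots> \<le> a x * (z x powr (\<theta> + 1) / (\<theta> + 1))"
        by (intro mult_left_mono W_indefinite_le nonneg \<theta> x)
      finally have "(K x)\<^sup>2 / E (\<theta> + 1) x \<le> a x * (z x powr (\<theta> + 1) / (\<theta> + 1)) / E (\<theta> + 1) x"
        using E_pos[OF x, of "\<theta> + 1"] by (intro divide_right_mono) auto
      also have "\<dots> = a x * exp (z x) / (\<theta> + 1)"
        using z_pos[OF x] by (simp add: E_def exp_minus divide_inverse)
      finally show ?thesis .
    qed
    moreover have "norm (?B x) = \<bar>\<theta> + 1 - z x\<bar> * ((K x)\<^sup>2 / E (\<theta> + 1) x)" if "0 < x" for x
      using E_pos[OF that, of "\<theta> + 1"] by (simp add: abs_mult)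
    ultimately have "norm (?B x) \<le> \<bar>\<theta> + 1 - z x\<bar> * (a x * exp (z x) / (\<theta> + 1))" if "0 < x" for x
      using that by (metis mult_left_mono abs_ge_zero)
    then show "eventually (\<lambda>x. norm (?B x) \<le> \<bar>\<theta> + 1 - z x\<bar> * (a x * exp (z x) / (\<theta> + 1))) (at_right 0)"
      by (auto simp: eventually_at_right_field intro!: exI[of _ 1])
    have z0: "(z \<longlongrightarrow> 0) (at_right 0)"
      using z_at_right_0 by (simp add: filterlim_at)
    have "((\<lambda>x. \<bar>\<theta> + 1 - z x\<bar> * (a x * exp (z x) / (\<theta> + 1))) \<longlongrightarrow> \<bar>\<theta> + 1 - 0\<bar> * (0 * exp 0 / (\<theta> + 1))) (at_right 0)"
      using \<theta> by (intro tendsto_intros z0 a0) auto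
    then show "((\<lambda>x. \<bar>\<theta> + 1 - z x\<bar> * (a x * exp (z x) / (\<theta> + 1))) \<longlongrightarrow> 0) (at_right 0)" by simp
  qed
  show "(?B \<longlongrightarrow> 0) at_top"
  proof (rule Lim_null_comparison)
    have "norm (?B x) \<le> 2 * a' x" if x: "0 < x" "2 * \<theta> \<le> z x" "\<theta> + 1 \<le> z x" for x
    proof -
      \<comment> \<open>The vanishing total integral turns \<open>K\<close> into a tail; otherwise
        \<open>K\<close> would have a nonzero limit at infinity.\<close>
      have "K x = - (LINT y|half_lebesgue. indicator {x<..} y * (f y * W \<theta> y))"
        unfolding K_def half_integral_tail[OF ifW] f0 by simp
      then have "(K x)\<^sup>2 = (LINT y|half_lebesgue. indicator {x<..} y * (f y * W \<theta> y))\<^sup>2" by simp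
      also have "\<dots> \<le> a' x * (LINT y|half_lebesgue. indicator {x<..} y * W \<theta> y)"
        unfolding a'_def by (rule indicator_Cauchy_Schwarz[OF \<theta> f]) simp
      also have "\<dots> \<le> a' x * (2 * E \<theta> x)"
        by (intro mult_left_mono W_tail_le nonneg \<theta> x)
      finally have "(K x)\<^sup>2 / E (\<theta> + 1) x \<le> a' x * (2 * E \<theta> x) / E (\<theta> + 1) x"
        using E_pos[OF x(1), of "\<theta> + 1"] by (intro divide_right_mono) auto
      also have "\<dots> = 2 * a' x / z x"
        using E_pos[OF x(1), of \<theta>] by (simp add: E_Suc[OF x(1)])
      finally have "\<bar>\<theta> + 1 - z x\<bar> * ((K x)\<^sup>2 / E (\<theta> + 1) x) \<le> \<bar>\<theta> + 1 - z x\<bar> * (2 * a' x / z x)"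
        by (rule mult_left_mono) simp
      then have "norm (?B x) \<le> (z x - (\<theta> + 1)) * (2 * a' x / z x)"
        using x E_pos[OF x(1), of "\<theta> + 1"] by (simp add: abs_mult)
      also have "\<dots> \<le> z x * (2 * a' x / z x)"
        using \<theta> z_pos[OF x(1)] nonneg(2)[of x] by (intro mult_right_mono) auto
      finally show ?thesis using z_pos[OF x(1)] by simp
    qed
    moreover have "eventually (\<lambda>x. 0 < x \<and> 2 * \<theta> \<le> z x \<and> \<theta> + 1 \<le> z x) at_top"
      using eventually_gt_at_top[of 0] z_at_top
      by (auto simp: filterlim_at_top intro!: eventually_conj)
    ultimately show "eventually (\<lambda>x. norm (?B x) \<le> 2 * a' x) at_top"
      by (auto elim: eventually_mono)
    show "((\<lambda>x. 2 * a' x) \<longlongrightarrow> 0) at_top"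
      using tendsto_mult_right_zero[OF a'0] by simp
  qed
qed

text \<open>Here \<open>f = - (z * k + (\<theta> + 1 - z) * g)\<close> says that \<open>f\<close> is the adjoint of \<open>g \<mapsto> dg/dz\<close> applied to \<open>g\<close>,
  and the norm identity is the commutation relation between the derivative and its adjoint.\<close>

lemma adjoint_preimage:
  assumes \<theta>: "- 1 < \<theta>" and f: "f \<in> L2_space (W \<theta>)" and f0: "(LINT x|half_lebesgue. f x * W \<theta> x) = 0"
  obtains g k where "ac_deriv g (\<lambda>x. dz x * k x)"
    and "g \<in> L2_space (W \<theta>)" "g \<in> L2_space (W (\<theta> + 1))" "k \<in> L2_space (W (\<theta> + 2))"
    and "\<And>x. 0 < x \<Longrightarrow> f x = - (z x * k x + (\<theta> + 1 - z x) * g x)"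
    and "L2_inner (W \<theta>) f f = L2_inner (W (\<theta> + 1)) g g + L2_inner (W (\<theta> + 2)) k k"
proof -
  have one: "(\<lambda>x. 1) \<in> L2_space (W \<theta>)" using z_power_L2[of \<theta> 0] \<theta> by simp
  have ifW: "integrable half_lebesgue (\<lambda>x. f x * W \<theta> x)"
    using w.L2_integrable_mult[OF f one] by simp
  note i2 = w.L2_square_integrable[OF f]
  define K where "K x = (LINT y|half_lebesgue. indicator {..x} y * (f y * W \<theta> y))" for x
  \<comment> \<open>The product \<open>E (\<theta> + 1) * g\<close> is \<open>- K\<close>, a
    primitive of \<open>- f * W \<theta>\<close> starting from 0; dividing its derivative by
    \<open>- W \<theta>\<close> returns \<open>f\<close>. The function \<open>k\<close> is read off
    from the required equation and turns out to be dg/dz.\<close>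
  define g where "g x = - K x / E (\<theta> + 1) x" for x
  define k where "k x = - (f x + (\<theta> + 1 - z x) * g x) / z x" for x
  have f_eq: "f x = - (z x * k x + (\<theta> + 1 - z x) * g x)" if "0 < x" for x
    using z_pos[OF that] by (simp add: k_def)
  have K: "ac_deriv K (\<lambda>x. f x * W \<theta> x)"
    unfolding K_def[abs_def] by (rule ac_deriv_indefinite[OF ifW])
  have recE: "ac_deriv (\<lambda>x. - 1 / E (\<theta> + 1) x) (\<lambda>x. (\<theta> + 1 - z x) * W \<theta> x / (E (\<theta> + 1) x)\<^sup>2)"
  proof (rule ac_deriv_C1)
    fix x :: real assume "0 < x"
    then show "((\<lambda>x. - 1 / E (\<theta> + 1) x) has_real_derivative (\<theta> + 1 - z x) * W \<theta> x / (E (\<theta> + 1) x)\<^sup>2) (at x)"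
      using E_pos[of x "\<theta> + 1"] by (auto intro!: derivative_eq_intros E_Suc_deriv simp: power2_eq_square)
  next
    show "continuous_on half_line (\<lambda>x. (\<theta> + 1 - z x) * W \<theta> x / (E (\<theta> + 1) x)\<^sup>2)"
      by (intro continuous_intros z_continuous W_continuous E_continuous) (auto dest: E_pos[of _ "\<theta> + 1"])
  qed
  have g: "ac_deriv g (\<lambda>x. dz x * k x)"
  proof (rule ac_deriv_cong[THEN iffD1, OF _ _ ac_deriv_mult[OF K recE]])
    fix x :: real assume x: "0 < x"
    show "K x * (- 1 / E (\<theta> + 1) x) = g x" by (simp add: g_def)
    have p: "z x > 0" "E \<theta> x > 0" using z_pos[OF x] E_pos[OF x] by auto
    show "f x * W \<theta> x * (- 1 / E (\<theta> + 1) x) + K x * ((\<theta> + 1 - z x) * W \<theta> x / (E (\<theta> + 1) x)\<^sup>2) = dz x * k x"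
      using p by (simp only: W_eq[OF x] E_Suc[OF x] g_def k_def) (simp add: field_simps power2_eq_square)
  qed
  have meas [measurable]: "f \<in> borel_measurable half_lebesgue" "g \<in> borel_measurable half_lebesgue"
    using w.L2_measurable[OF f] continuous_half_measurable[OF ac_deriv_continuous[OF g]] by auto
  have meas_k [measurable]: "k \<in> borel_measurable half_lebesgue"
    unfolding k_def[abs_def] by measurable
  let ?S = "\<lambda>x. (g x)\<^sup>2 * W (\<theta> + 1) x + (k x)\<^sup>2 * W (\<theta> + 2) x"
  let ?B = "\<lambda>x. (\<theta> + 1 - z x) * E (\<theta> + 1) x * (g x * g x)"
  let ?A = "\<lambda>x. LINT y|half_lebesgue. indicator {..x} y * ((f y)\<^sup>2 * W \<theta> y)"
  have cE: "ac_deriv (\<lambda>x. - ((\<theta> + 1 - z x) * E (\<theta> + 1) x))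
      (\<lambda>x. dz x * E (\<theta> + 1) x - (\<theta> + 1 - z x) * ((\<theta> + 1 - z x) * W \<theta> x))"
    by (intro ac_deriv_C1 DERIV_cong[OF DERIV_minus[OF DERIV_mult[OF DERIV_diff[OF DERIV_const z_deriv] E_Suc_deriv]]]
        continuous_intros z_continuous dz_continuous E_continuous W_continuous) auto
  \<comment> \<open>The commutation relation in pointwise form:
    \<open>f\<^sup>2 * W \<theta>\<close> exceeds \<open>?S\<close> by the derivative of
    \<open>?B\<close>. As \<open>?S\<close> is nonnegative, the limits of \<open>?A - ?B\<close>
    yield its integrability, hence the memberships of \<open>g\<close> and \<open>k\<close> for the
    raised weights, together with the norm identity.\<close>
  have P: "ac_deriv (\<lambda>x. ?A x - ?B x) ?S"
  proof (rule ac_deriv_cong[THEN iffD1, OF _ _ ac_deriv_add[OF ac_deriv_indefinite[OF i2]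
        ac_deriv_mult[OF cE ac_deriv_mult[OF g g]]]])
    fix x :: real assume x: "0 < x"
    show "(f x)\<^sup>2 * W \<theta> x +
        ((dz x * E (\<theta> + 1) x - (\<theta> + 1 - z x) * ((\<theta> + 1 - z x) * W \<theta> x)) * (g x * g x) +
         - ((\<theta> + 1 - z x) * E (\<theta> + 1) x) * (dz x * k x * g x + g x * (dz x * k x))) = ?S x"
      using W_add[OF x, of \<theta> 2] unfolding f_eq[OF x]
      by (simp add: W_Suc[OF x] W_eq[OF x] E_Suc[OF x] power2_eq_square) algebra
  qed simp
  have B: "?B x = (\<theta> + 1 - z x) * ((K x)\<^sup>2 / E (\<theta> + 1) x)" if "0 < x" for x
    using E_pos[OF that, of "\<theta> + 1"] by (simp add: g_def power2_eq_square)
  have B0: "(?B \<longlongrightarrow> 0) (at_right 0)"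
    by (rule Lim_transform_eventually[OF primitive_boundary_limits(1)[OF \<theta> f f0]])
      (auto simp: eventually_at_right_field B K_def[symmetric] intro!: exI[of _ 1])
  have B1: "(?B \<longlongrightarrow> 0) at_top"
    by (rule Lim_transform_eventually[OF primitive_boundary_limits(2)[OF \<theta> f f0]])
      (use eventually_gt_at_top[of "0::real"] in eventually_elim, simp add: B K_def[symmetric])
  have P0: "((\<lambda>x. ?A x - ?B x) \<longlongrightarrow> 0 - 0) (at_right 0)"
    by (intro tendsto_diff B0 indefinite_at_right_0[OF i2])
  have P1: "((\<lambda>x. ?A x - ?B x) \<longlongrightarrow> (LINT x|half_lebesgue. (f x)\<^sup>2 * W \<theta> x) - 0) at_top"
    by (intro tendsto_diff B1 indefinite_at_top[OF i2])
  have S_nonneg: "0 \<le> ?S x" if "0 < x" for x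
    using W_pos[OF that, of "\<theta> + 1"] W_pos[OF that, of "\<theta> + 2"] by simp
  have S: "integrable half_lebesgue ?S"
    by (rule ac_deriv_nonneg_integrable[OF P S_nonneg _ P0 P1]) measurable
  have iS: "(LINT x|half_lebesgue. ?S x) = (LINT x|half_lebesgue. (f x)\<^sup>2 * W \<theta> x)"
    using ac_deriv_half_integral[OF P S P0 P1] by simp
  have g1: "g \<in> L2_space (W (\<theta> + 1))"
    unfolding L2_space_def
    by (auto intro!: Bochner_Integration.integrable_bound[OF S] AE_I2 simp: less_imp_le[OF W_pos])
  have k2: "k \<in> L2_space (W (\<theta> + 2))"
    unfolding L2_space_def
    by (auto intro!: Bochner_Integration.integrable_bound[OF S] AE_I2 simp: less_imp_le[OF W_pos])
  \<comment> \<open>Since \<open>z\<^sup>2 * W \<theta>\<close> is \<open>W (\<theta> + 2)\<close>.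
    The equation for \<open>f\<close> then controls \<open>(\<theta> + 1 - z) * g\<close> for the
    unraised weight.\<close>
  have "(\<lambda>x. z x * k x) \<in> L2_space (W \<theta>)"
  proof -
    have "integrable half_lebesgue (\<lambda>x. (z x * k x)\<^sup>2 * W \<theta> x)"
    proof (rule Bochner_Integration.integrable_cong[THEN iffD1, OF refl _ w.L2_square_integrable[OF k2]])
      fix x assume "x \<in> space half_lebesgue"
      then show "(k x)\<^sup>2 * W (\<theta> + 2) x = (z x * k x)\<^sup>2 * W \<theta> x"
        using W_add[of x \<theta> 2] by (simp add: power_mult_distrib)
    qed
    then show ?thesis by (simp add: L2_space_def)
  qed
  then have "(\<lambda>x. - 1 * (f x + z x * k x)) \<in> L2_space (W \<theta>)"
    by (intro w.L2_cmult w.L2_add f)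
  then have "integrable half_lebesgue (\<lambda>x. (- 1 * (f x + z x * k x))\<^sup>2 * W \<theta> x)"
    by (rule w.L2_square_integrable)
  then have p: "integrable half_lebesgue (\<lambda>x. ((\<theta> + 1 - z x) * g x)\<^sup>2 * W \<theta> x)"
    by (rule Bochner_Integration.integrable_cong[THEN iffD1, OF refl, rotated]) (simp add: f_eq)
  \<comment> \<open>The factor \<open>\<theta> + 1 - z\<close> degenerates near
    \<open>z = \<theta> + 1\<close>, where \<open>z\<close>, and with it
    \<open>W (\<theta> + 1)\<close>, takes over. Splitting at \<open>z = t\<close> shows that
    \<open>(\<theta> + 1 - z)\<^sup>2 + z\<close> is at least
    \<open>c = min t (t\<^sup>2)\<close>.\<close>
  define t where "t = (\<theta> + 1) / 2"
  have "0 < t" using \<theta> by (simp add: t_def)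
  define c where "c = min t (t\<^sup>2)"
  have "0 < c" using \<open>0 < t\<close> by (simp add: c_def)
  have "integrable half_lebesgue (\<lambda>x. (g x)\<^sup>2 * W \<theta> x)"
  proof (rule Bochner_Integration.integrable_bound)
    show "integrable half_lebesgue (\<lambda>x. inverse c * (((\<theta> + 1 - z x) * g x)\<^sup>2 * W \<theta> x + (g x)\<^sup>2 * W (\<theta> + 1) x))"
      by (intro integrable_mult_right Bochner_Integration.integrable_add p w.L2_square_integrable[OF g1])
    show "AE x in half_lebesgue. norm ((g x)\<^sup>2 * W \<theta> x) \<le>
        norm (inverse c * (((\<theta> + 1 - z x) * g x)\<^sup>2 * W \<theta> x + (g x)\<^sup>2 * W (\<theta> + 1) x))"
    proof (rule AE_I2)
      fix x assume "x \<in> space half_lebesgue"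
      then have x: "0 < x" by simp
      have "c \<le> (\<theta> + 1 - z x)\<^sup>2 + z x"
      proof (cases "t \<le> z x")
        case True
        then show ?thesis by (simp add: c_def add_increasing)
      next
        case False
        then have "t\<^sup>2 \<le> (\<theta> + 1 - z x)\<^sup>2" using \<open>0 < t\<close> by (intro power_mono) (auto simp: t_def)
        then show ?thesis using z_pos[OF x] by (simp add: c_def add_increasing2 min.coboundedI2)
      qed
      then have "c * ((g x)\<^sup>2 * W \<theta> x) \<le> ((\<theta> + 1 - z x)\<^sup>2 + z x) * ((g x)\<^sup>2 * W \<theta> x)"
        by (rule mult_right_mono) (simp add: less_imp_le[OF W_pos[OF x]])
      also have "\<dots> = ((\<theta> + 1 - z x) * g x)\<^sup>2 * W \<theta> x + (g x)\<^sup>2 * W (\<theta> + 1) x"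
        by (simp only: W_Suc[OF x] power_mult_distrib) (simp add: algebra_simps)
      finally have "c * ((g x)\<^sup>2 * W \<theta> x) \<le> ((\<theta> + 1 - z x) * g x)\<^sup>2 * W \<theta> x + (g x)\<^sup>2 * W (\<theta> + 1) x" .
      with mult_left_mono[OF this, of "inverse c"] \<open>0 < c\<close>
      have "(g x)\<^sup>2 * W \<theta> x \<le> inverse c * (((\<theta> + 1 - z x) * g x)\<^sup>2 * W \<theta> x + (g x)\<^sup>2 * W (\<theta> + 1) x)"
        by (simp add: mult.assoc[symmetric])
      moreover have "0 \<le> (g x)\<^sup>2 * W \<theta> x" using W_pos[OF x, of \<theta>] by simp
      ultimately show "norm ((g x)\<^sup>2 * W \<theta> x) \<le>
          norm (inverse c * (((\<theta> + 1 - z x) * g x)\<^sup>2 * W \<theta> x + (g x)\<^sup>2 * W (\<theta> + 1) x))"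
        by simp
    qed
  qed simp
  then have g0: "g \<in> L2_space (W \<theta>)" by (simp add: L2_space_def)
  have "L2_inner (W \<theta>) f f = L2_inner (W (\<theta> + 1)) g g + L2_inner (W (\<theta> + 2)) k k"
    using iS w.L2_square_integrable[OF g1] w.L2_square_integrable[OF k2]
    by (simp add: L2_inner_def power2_eq_square)
  with that g g0 g1 k2 f_eq show ?thesis by blast
qed

text \<open>The induction hypothesis is used for \<open>g\<close> and \<open>k\<close> at
  \<open>\<theta> + 1\<close> with one power fewer, hence the generalisation over
  \<open>\<theta>\<close>, \<open>f\<close> and \<open>h\<close>. The factor \<open>n\<close> is
  sharp: up to sign, the derivative of the n-th Laguerre polynomial is the one of degree n - 1 for
  \<open>\<theta> + 1\<close>, and its squared norm is n times as large.\<close>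

theorem Poincare_orthogonal:
  assumes "- 1 < \<theta>" "ac_deriv f (\<lambda>x. dz x * h x)" "f \<in> L2_space (W \<theta>)" "h \<in> L2_space (W (\<theta> + 1))"
    and "\<And>j. j < n \<Longrightarrow> L2_inner (W \<theta>) f (\<lambda>x. z x ^ j) = 0"
  shows "real n * L2_inner (W \<theta>) f f \<le> L2_inner (W (\<theta> + 1)) h h"
  using assms
proof (induction n arbitrary: \<theta> f h)
  case 0
  then show ?case by (simp add: w.L2_inner_self_nonneg)
next
  case (Suc n)
  note \<theta> = Suc.prems(1) and f = Suc.prems(2,3) and h = Suc.prems(4) and orth = Suc.prems(5)
  have "(LINT x|half_lebesgue. f x * W \<theta> x) = 0"
    using orth[of 0] by (simp add: L2_inner_def)
  from adjoint_preimage[OF \<theta> f(2) this] obtain g k where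
    g: "ac_deriv g (\<lambda>x. dz x * k x)" "g \<in> L2_space (W \<theta>)" "g \<in> L2_space (W (\<theta> + 1))"
    and k: "k \<in> L2_space (W (\<theta> + 2))"
    and f_eq: "\<And>x. 0 < x \<Longrightarrow> f x = - (z x * k x + (\<theta> + 1 - z x) * g x)"
    and norm: "L2_inner (W \<theta>) f f = L2_inner (W (\<theta> + 1)) g g + L2_inner (W (\<theta> + 2)) k k"
    by blast
  have "L2_inner (W (\<theta> + 1)) g (\<lambda>x. z x ^ j) = 0" if "j < n" for j
  proof -
    \<comment> \<open>The adjoint relation tested with the power \<open>Suc j\<close>, whose
      derivative is \<open>Suc j\<close> times the power \<open>j\<close>. The boundary term times
      \<open>dz / z\<close> is the third product in \<open>i\<close>; for it \<open>g\<close> must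
      be a member for the unraised weight \<open>W \<theta>\<close>.\<close>
    define G where "G x = real (Suc j) * (g x * z x ^ j * W (\<theta> + 1) x) - f x * z x ^ Suc j * W \<theta> x" for x
    have i: "integrable half_lebesgue (\<lambda>x. g x * z x ^ j * W (\<theta> + 1) x)"
      "integrable half_lebesgue (\<lambda>x. f x * z x ^ Suc j * W \<theta> x)"
      "integrable half_lebesgue (\<lambda>x. g x * z x ^ Suc j * W \<theta> x)"
      using \<theta> by (intro w.L2_integrable_mult f g z_power_L2; simp)+
    have "ac_deriv (\<lambda>x. g x * E (\<theta> + real (Suc j) + 1) x) G"
    proof (rule ac_deriv_cong[THEN iffD1, OF _ _ ac_deriv_mult[OF g(1) ac_deriv_E[of "\<theta> + real (Suc j)"]]])
      fix x :: real assume x: "0 < x"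
      show "dz x * k x * E (\<theta> + real (Suc j) + 1) x + g x * ((\<theta> + real (Suc j) + 1 - z x) * W (\<theta> + real (Suc j)) x) = G x"
        unfolding G_def f_eq[OF x]
        by (simp only: W_Suc[OF x] W_add[OF x] W_eq[OF x] E_Suc[OF x] E_add[OF x]) (simp add: algebra_simps)
    qed simp
    moreover have "integrable half_lebesgue G"
      unfolding G_def[abs_def] by (intro Bochner_Integration.integrable_diff integrable_mult_right i)
    moreover have "integrable half_lebesgue (\<lambda>x. g x * E (\<theta> + real (Suc j) + 1) x * (dz x / z x))"
    proof (rule Bochner_Integration.integrable_cong[THEN iffD1, OF refl _ i(3)])
      fix x assume "x \<in> space half_lebesgue"
      then have x: "0 < x" by simp
      show "g x * z x ^ Suc j * W \<theta> x = g x * E (\<theta> + real (Suc j) + 1) x * (dz x / z x)"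
        using z_pos[OF x] by (simp only: W_eq[OF x] E_Suc[OF x] E_add[OF x]) simp
    qed
    ultimately have "(LINT x|half_lebesgue. G x) = 0"
      by (rule half_integral_eq_0)
    then have "real (Suc j) * L2_inner (W (\<theta> + 1)) g (\<lambda>x. z x ^ j) = L2_inner (W \<theta>) f (\<lambda>x. z x ^ Suc j)"
      unfolding G_def L2_inner_def
      by (subst (asm) Bochner_Integration.integral_diff[OF integrable_mult_right[OF i(1)] i(2)]) simp
    also have "\<dots> = 0" using that by (intro orth) simp
    finally show ?thesis by simp
  qed
  with Suc.IH[of "\<theta> + 1" g k] \<theta> g k
  have IH: "real n * L2_inner (W (\<theta> + 1)) g g \<le> L2_inner (W (\<theta> + 2)) k k"
    by (simp add: add.assoc)
  have fh: "L2_inner (W \<theta>) f f = L2_inner (W (\<theta> + 1)) g h"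
  proof -
    \<comment> \<open>The derivative of \<open>g * E (\<theta> + 1) * f\<close>: its vanishing
      integral is the adjoint relation with \<open>f\<close> itself as test function.\<close>
    define G where "G x = - (f x * f x * W \<theta> x) + g x * h x * W (\<theta> + 1) x" for x
    have i: "integrable half_lebesgue (\<lambda>x. f x * f x * W \<theta> x)"
      "integrable half_lebesgue (\<lambda>x. g x * h x * W (\<theta> + 1) x)"
      "integrable half_lebesgue (\<lambda>x. g x * f x * W \<theta> x)"
      by (auto intro!: w.L2_integrable_mult f g h)
    have "ac_deriv (\<lambda>x. g x * E (\<theta> + 1) x * f x) G"
    proof (rule ac_deriv_cong[THEN iffD1, OF _ _ ac_deriv_mult[OF ac_deriv_mult[OF g(1) ac_deriv_E] f(1)]])
      fix x :: real assume x: "0 < x"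
      show "(dz x * k x * E (\<theta> + 1) x + g x * ((\<theta> + 1 - z x) * W \<theta> x)) * f x + g x * E (\<theta> + 1) x * (dz x * h x) = G x"
        unfolding G_def f_eq[OF x]
        by (simp only: W_Suc[OF x] W_eq[OF x] E_Suc[OF x]) (simp add: algebra_simps)
    qed simp
    moreover have "integrable half_lebesgue G"
      unfolding G_def[abs_def] by (intro Bochner_Integration.integrable_add Bochner_Integration.integrable_minus i)
    moreover have "integrable half_lebesgue (\<lambda>x. g x * E (\<theta> + 1) x * f x * (dz x / z x))"
    proof (rule Bochner_Integration.integrable_cong[THEN iffD1, OF refl _ i(3)])
      fix x assume "x \<in> space half_lebesgue"
      then have x: "0 < x" by simp
      show "g x * f x * W \<theta> x = g x * E (\<theta> + 1) x * f x * (dz x / z x)"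
        using z_pos[OF x] by (simp only: W_eq[OF x] E_Suc[OF x]) simp
    qed
    ultimately have "(LINT x|half_lebesgue. G x) = 0"
      by (rule half_integral_eq_0)
    then show ?thesis
      by (simp add: G_def i L2_inner_def)
  qed
  define m where "m = real (Suc n)"
  have "0 < m" by (simp add: m_def)
  \<comment> \<open>Expanding this square replaces Cauchy-Schwarz: the cross term is the squared
    norm of \<open>f\<close> by \<open>fh\<close>, and no division by a norm occurs.\<close>
  have "0 \<le> L2_inner (W (\<theta> + 1)) (\<lambda>x. h x - m * g x) (\<lambda>x. h x - m * g x)"
    by (rule w.L2_inner_self_nonneg)
  also have "\<dots> = L2_inner (W (\<theta> + 1)) h h - 2 * m * L2_inner (W (\<theta> + 1)) g h + m\<^sup>2 * L2_inner (W (\<theta> + 1)) g g"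
  proof -
    have "L2_inner (W (\<theta> + 1)) (\<lambda>x. h x - m * g x) (\<lambda>x. h x - m * g x) =
       (LINT x|half_lebesgue. h x * h x * W (\<theta> + 1) x - (2 * m) * (g x * h x * W (\<theta> + 1) x) + m\<^sup>2 * (g x * g x * W (\<theta> + 1) x))"
      unfolding L2_inner_def
      by (intro Bochner_Integration.integral_cong) (auto simp: power2_eq_square algebra_simps)
    also have "\<dots> = L2_inner (W (\<theta> + 1)) h h - 2 * m * L2_inner (W (\<theta> + 1)) g h + m\<^sup>2 * L2_inner (W (\<theta> + 1)) g g"
      using w.L2_integrable_mult[OF h h] w.L2_integrable_mult[OF g(3) h] w.L2_integrable_mult[OF g(3) g(3)]
      by (simp add: L2_inner_def)
    finally show ?thesis .
  qed
  also have "m\<^sup>2 * L2_inner (W (\<theta> + 1)) g g = m * (m * L2_inner (W (\<theta> + 1)) g g)"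
    by (simp add: power2_eq_square)
  \<comment> \<open>In the norm identity the squared norm of \<open>k\<close> is at least n times
    that of \<open>g\<close>; adding the squared norm of \<open>g\<close> gives the factor
    \<open>m = n + 1\<close>.\<close>
  also have "\<dots> \<le> m * L2_inner (W \<theta>) f f"
    using IH norm \<open>0 < m\<close> by (intro mult_left_mono) (auto simp: m_def algebra_simps)
  finally have "m * L2_inner (W \<theta>) f f \<le> L2_inner (W (\<theta> + 1)) h h"
    by (simp add: fh[symmetric])
  then show ?case by (simp only: m_def)
qed

end

section \<open>Weak derivatives\<close>

definition flat_exp :: "nat \<Rightarrow> real \<Rightarrow> real" where
  "flat_exp j x = (if 0 < x then inverse x ^ j * exp (- inverse x) else 0)"

lemma flat_exp_at_0: "(flat_exp j \<longlongrightarrow> 0) (at 0)"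
proof -
  have "((\<lambda>x. inverse x ^ j * exp (- inverse x)) \<longlongrightarrow> 0) (at_right (0::real))"
    using tendsto_power_div_exp_0[of j]
    by (simp add: filterlim_at_right_to_top exp_minus divide_inverse)
  then have "(flat_exp j \<longlongrightarrow> 0) (at_right 0)"
    by (rule Lim_transform_eventually)
      (auto simp: flat_exp_def eventually_at_right_field intro!: exI[of _ 1])
  moreover have "(flat_exp j \<longlongrightarrow> 0) (at_left 0)"
    by (rule tendsto_eventually) (auto simp: flat_exp_def eventually_at_left_field intro!: exI[of _ "-1"])
  ultimately show ?thesis by (simp add: filterlim_at_split)
qed

text \<open>The negative powers in \<open>flat_exp\<close> are there for this formula: the
  derivative of a member of the family is a combination of members, also at the gluing point
  0.\<close>

lemma flat_exp_deriv:
  "(flat_exp j has_real_derivative flat_exp (j + 2) x - real j * flat_exp (j + 1) x) (at x)"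
proof -
  consider "x < 0" | "x = 0" | "0 < x" by linarith
  then show ?thesis
  proof cases
    case 1
    have "((\<lambda>x. 0) has_real_derivative 0) (at x)" by simp
    then have "(flat_exp j has_real_derivative 0) (at x)"
      using 1 by (rule_tac has_field_derivative_transform_within_open[where S = "{..<0}"]) (auto simp: flat_exp_def)
    then show ?thesis using 1 by (simp add: flat_exp_def)
  next
    case 2
    \<comment> \<open>The difference quotient at 0 is \<open>flat_exp (j + 1)\<close>.\<close>
    have "((\<lambda>h. (flat_exp j (0 + h) - flat_exp j 0) / h) \<longlongrightarrow> 0) (at 0)"
      by (rule Lim_transform_eventually[OF flat_exp_at_0[of "j + 1"]])
        (auto simp: flat_exp_def divide_inverse eventually_at_filter)
    then show ?thesis using 2 by (simp add: DERIV_def flat_exp_def)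
  next
    case 3
    have "((\<lambda>x. inverse x ^ j) has_real_derivative - real j * inverse x ^ (j + 1)) (at x)"
    proof (rule DERIV_cong)
      show "((\<lambda>x. inverse x ^ j) has_real_derivative real j * (- (inverse x ^ Suc (Suc 0)) * inverse x ^ (j - Suc 0))) (at x)"
        using DERIV_power[OF DERIV_inverse[of x UNIV], of j] 3 by simp
    qed (cases j; simp add: algebra_simps)
    moreover have "((\<lambda>x. exp (- inverse x)) has_real_derivative exp (- inverse x) * inverse x ^ 2) (at x)"
      by (rule DERIV_cong[OF DERIV_chain2[OF DERIV_exp DERIV_minus[OF DERIV_inverse]]])
        (use 3 in \<open>simp_all add: numeral_2_eq_2\<close>)
    ultimately have "((\<lambda>x. inverse x ^ j * exp (- inverse x)) has_real_derivative
        flat_exp (j + 2) x - real j * flat_exp (j + 1) x) (at x)"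
      by (rule DERIV_cong[OF DERIV_mult])
        (use 3 in \<open>simp add: flat_exp_def power_add algebra_simps power2_eq_square\<close>)
    then show ?thesis
      using 3 by (rule_tac has_field_derivative_transform_within_open[where S = "{0<..}"]) (auto simp: flat_exp_def)
  qed
qed

text \<open>An algebra of functions that is closed under differentiation, so that smoothness of its members
  needs no Leibniz formula for higher derivatives.\<close>

inductive flat_algebra :: "(real \<Rightarrow> real) \<Rightarrow> bool" where
  flat_exp: "flat_algebra (\<lambda>x. flat_exp j (c * x + d))"
| const: "flat_algebra (\<lambda>x. c)"
| add: "flat_algebra f \<Longrightarrow> flat_algebra g \<Longrightarrow> flat_algebra (\<lambda>x. f x + g x)"
| mult: "flat_algebra f \<Longrightarrow> flat_algebra g \<Longrightarrow> flat_algebra (\<lambda>x. f x * g x)"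

lemma flat_algebra_deriv:
  assumes "flat_algebra f"
  shows "\<exists>f'. flat_algebra f' \<and> (\<forall>x. (f has_real_derivative f' x) (at x))"
  using assms
proof induction
  case (flat_exp j c d)
  let ?f' = "\<lambda>x. (flat_exp (j + 2) (c * x + d) + (- real j) * flat_exp (j + 1) (c * x + d)) * c"
  have "flat_algebra ?f'" by (intro flat_algebra.intros)
  moreover have "((\<lambda>x. flat_exp j (c * x + d)) has_real_derivative ?f' x) (at x)" for x
    by (rule DERIV_cong[OF DERIV_chain2[OF flat_exp_deriv]]) (auto intro!: derivative_eq_intros)
  ultimately show ?case by blast
next
  case (const c)
  show ?case by (intro exI[of _ "\<lambda>x. 0"]) (auto intro: flat_algebra.const)
next
  case (add f g)
  then obtain f' g' where "flat_algebra f'" "flat_algebra g'"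
    "\<And>x. (f has_real_derivative f' x) (at x)" "\<And>x. (g has_real_derivative g' x) (at x)" by blast
  then show ?case
    by (intro exI[of _ "\<lambda>x. f' x + g' x"]) (auto intro: flat_algebra.intros DERIV_add)
next
  case (mult f g)
  then obtain f' g' where "flat_algebra f'" "flat_algebra g'"
    "\<And>x. (f has_real_derivative f' x) (at x)" "\<And>x. (g has_real_derivative g' x) (at x)" by blast
  with mult show ?case
    by (intro exI[of _ "\<lambda>x. f' x * g x + f x * g' x"])
      (auto intro!: flat_algebra.intros derivative_eq_intros)
qed

lemma flat_algebra_iterated_deriv:
  assumes "flat_algebra f" shows "flat_algebra ((deriv ^^ k) f)"
proof (induction k)
  case (Suc k)
  from flat_algebra_deriv[OF Suc] obtain g where
    "flat_algebra g" "\<And>x. ((deriv ^^ k) f has_real_derivative g x) (at x)" by blast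
  moreover from this have "deriv ((deriv ^^ k) f) = g" by (auto intro: DERIV_imp_deriv)
  ultimately show ?case by simp
qed (use assms in simp)

lemma flat_algebra_differentiable: "flat_algebra f \<Longrightarrow> f differentiable_on UNIV"
  by (meson flat_algebra_deriv differentiable_at_imp_differentiable_on real_differentiable_def)

lemma flat_algebra_continuous: "flat_algebra f \<Longrightarrow> continuous_on S f"
  by (meson flat_algebra_differentiable differentiable_imp_continuous_on continuous_on_subset subset_UNIV)

lemma test_functionI:
  assumes "\<And>k. (deriv ^^ k) \<phi> differentiable_on UNIV" "0 < a" "\<And>x. x \<notin> {a..b} \<Longrightarrow> \<phi> x = 0"
  shows "test_function \<phi>"
proof -
  have "closure {x. \<phi> x \<noteq> 0} \<subseteq> {a..b}"
    by (intro closure_minimal) (use assms(3) in blast, simp)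
  then have "compact (closure {x. \<phi> x \<noteq> 0})" "closure {x. \<phi> x \<noteq> 0} \<subseteq> half_line"
    using \<open>0 < a\<close> compact_Int_closed[OF compact_Icc[of a b] closed_closure[of "{x. \<phi> x \<noteq> 0}"]]
    by (auto simp: Int_absorb1)
  then show ?thesis using assms(1) by (simp add: test_function_def)
qed

lemma test_function_flat_algebra:
  assumes "flat_algebra \<psi>" "0 < a" "\<And>x. x \<notin> {a..b} \<Longrightarrow> \<psi> x = 0"
  shows "test_function \<psi>"
  by (rule test_functionI[OF _ assms(2,3)])
    (auto intro: flat_algebra_differentiable flat_algebra_iterated_deriv assms)

text \<open>The integral from 0 vanishes to the left of the support for every \<open>\<eta>\<close>,
  and to the right of it because the total integral is 0.\<close>

lemma test_function_primitive:
  assumes \<eta>: "flat_algebra \<eta>" and "0 < a" "a \<le> b" and supp: "\<And>x. x \<notin> {a..b} \<Longrightarrow> \<eta> x = 0"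
    and "integral {a..b} \<eta> = 0"
  obtains \<phi> where "test_function \<phi>" "deriv \<phi> = \<eta>"
proof
  define \<phi> where "\<phi> x = integral {0..x} \<eta>" for x
  note cont = flat_algebra_continuous[OF \<eta>]
  have low: "\<phi> x = 0" if "x < a" for x
  proof -
    have "\<phi> x = integral {0..x} (\<lambda>_. 0)"
      unfolding \<phi>_def using that by (intro Henstock_Kurzweil_Integration.integral_cong supp) auto
    then show ?thesis by simp
  qed
  have d: "(\<phi> has_real_derivative \<eta> x) (at x)" for x
  proof (cases "x < a")
    case True
    have "((\<lambda>x. 0) has_real_derivative 0) (at x)" by simp
    then have "(\<phi> has_real_derivative 0) (at x)"
      using True by (rule_tac has_field_derivative_transform_within_open[where S = "{..<a}"]) (auto simp: low)
    then show ?thesis using True supp[of x] by simp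
  next
    case False
    then have "(\<phi> has_real_derivative \<eta> x) (at x within {0..x + 1})"
      unfolding \<phi>_def[abs_def] using \<open>0 < a\<close> by (intro integral_has_real_derivative cont) auto
    moreover have "at x within {0..x + 1} = at x"
      using False \<open>0 < a\<close> by (intro at_within_interior) auto
    ultimately show ?thesis by simp
  qed
  show dchi: "deriv \<phi> = \<eta>" using d by (auto intro: DERIV_imp_deriv)
  have high: "\<phi> x = 0" if "b < x" for x
  proof -
    have i: "\<eta> integrable_on {c..d}" for c d by (intro integrable_continuous_interval cont)
    have "\<phi> x = integral {0..a} \<eta> + integral {a..x} \<eta>"
      unfolding \<phi>_def using assms that by (intro Henstock_Kurzweil_Integration.integral_combine[symmetric] i) auto
    also have "integral {a..x} \<eta> = integral {a..b} \<eta> + integral {b..x} \<eta>"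
      using assms that by (intro Henstock_Kurzweil_Integration.integral_combine[symmetric] i) auto
    also have "integral {b..x} \<eta> = integral {b..x} (\<lambda>_. 0)"
      by (rule integral_spike[of "{b}"]) (auto intro: supp)
    also have "integral {0..a} \<eta> = integral {0..a} (\<lambda>_. 0)"
      by (rule integral_spike[of "{a}"]) (auto intro: supp)
    finally show ?thesis using assms by simp
  qed
  show "test_function \<phi>"
  proof (rule test_functionI[OF _ \<open>0 < a\<close>])
    show "(deriv ^^ k) \<phi> differentiable_on UNIV" for k
    proof (cases k)
      case 0
      then show ?thesis
        using d by (simp, meson differentiable_at_imp_differentiable_on real_differentiable_def)
    next
      case (Suc j)
      then have "(deriv ^^ k) \<phi> = (deriv ^^ j) \<eta>" by (simp only: funpow_Suc_right o_apply dchi)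
      then show ?thesis by (simp add: flat_algebra_differentiable flat_algebra_iterated_deriv \<eta>)
    qed
    show "\<phi> x = 0" if "x \<notin> {a..b}" for x using that low high by force
  qed
qed

text \<open>Two flat exponentials glued at the ends of the interval. The scaling by
  \<open>Suc n\<close> drives both factors to 1 inside while keeping them below 1, so that dominated
  convergence reaches the indicator of the open interval.\<close>

definition bump :: "real \<Rightarrow> real \<Rightarrow> nat \<Rightarrow> real \<Rightarrow> real" where
  "bump a b n x = flat_exp 0 (real (Suc n) * x + (- real (Suc n) * a)) * flat_exp 0 (- real (Suc n) * x + real (Suc n) * b)"

lemma flat_algebra_bump: "flat_algebra (bump a b n)"
  unfolding bump_def by (intro flat_algebra.intros)

lemma bump_eq:
  "bump a b n x = (if a < x \<and> x < b then exp (- inverse (real (Suc n) * (x - a))) * exp (- inverse (real (Suc n) * (b - x))) else 0)"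
proof -
  have "real (Suc n) * x + (- real (Suc n) * a) = real (Suc n) * (x - a)"
    "- real (Suc n) * x + real (Suc n) * b = real (Suc n) * (b - x)"
    by (auto simp: algebra_simps)
  then show ?thesis
    unfolding bump_def flat_exp_def by (simp only:) (simp add: zero_less_mult_iff)
qed

lemma bump_bounds: "0 \<le> bump a b n x" "bump a b n x \<le> 1"
  by (auto simp: bump_eq intro!: mult_le_one)

lemma bump_outside: "x \<notin> {a..b} \<Longrightarrow> bump a b n x = 0"
  by (auto simp: bump_eq)

lemma bump_tendsto: "(\<lambda>n. bump a b n x) \<longlonglongrightarrow> indicator {a<..<b} x"
proof (cases "a < x \<and> x < b")
  case True
  have "(\<lambda>n. exp (- inverse (real (Suc n) * c))) \<longlonglongrightarrow> 1" if "0 < c" for c :: real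
    using that by real_asymp
  from tendsto_mult[OF this this, of "x - a" "b - x"] True show ?thesis
    by (simp add: bump_eq)
qed (auto simp: bump_eq)

section \<open>Weak derivatives and their absolutely continuous representatives\<close>

lemma integrable_half_supported:
  fixes G :: "real \<Rightarrow> real"
  assumes G: "G absolutely_integrable_on {a..b}" and "0 < a" and supp: "\<And>x. 0 < x \<Longrightarrow> x \<notin> {a..b} \<Longrightarrow> G x = 0"
  shows "integrable half_lebesgue G" "(LINT x|half_lebesgue. G x) = integral {a..b} G"
proof -
  have *: "indicator half_line x *\<^sub>R G x = indicator {a..b} x *\<^sub>R G x" for x
    using assms by (auto simp: indicator_def)
  show "integrable half_lebesgue G"
    using G unfolding integrable_restrict_space[OF half_line_Int] set_integrable_def * .
  show "(LINT x|half_lebesgue. G x) = integral {a..b} G"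
    using set_lebesgue_integral_eq_integral(2)[OF G]
    unfolding integral_restrict_space[OF half_line_Int] set_lebesgue_integral_def * .
qed

lemma compact_half_line_subset_Icc:
  assumes "compact K" "K \<subseteq> half_line"
  obtains a b :: real where "0 < a" "a \<le> b" "K \<subseteq> {a..b}"
proof (cases "K = {}")
  case True
  with that[of 1 1] show ?thesis by simp
next
  case False
  from compact_attains_inf[OF assms(1) False] obtain a where a: "a \<in> K" "\<forall>t\<in>K. a \<le> t" by blast
  from compact_attains_sup[OF assms(1) False] obtain b where b: "b \<in> K" "\<forall>t\<in>K. t \<le> b" by blast
  from a b assms show ?thesis by (intro that[of a b]) auto
qed

lemma locally_integrable_iff:
  "locally_integrable f \<longleftrightarrow> (\<forall>a b. 0 < a \<longrightarrow> f absolutely_integrable_on {a..b})"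
proof
  assume f: "locally_integrable f"
  show "\<forall>a b. 0 < a \<longrightarrow> f absolutely_integrable_on {a..b}"
  proof (intro allI impI)
    fix a b :: real assume "0 < a"
    then have "compact {a..b} \<and> {a..b} \<subseteq> half_line" by auto
    with f have "integrable (lebesgue_on {a..b}) f"
      unfolding locally_integrable_def by blast
    then show "f absolutely_integrable_on {a..b}"
      by (simp add: integrable_restrict_space set_integrable_def)
  qed
next
  assume f: "\<forall>a b. 0 < a \<longrightarrow> f absolutely_integrable_on {a..b}"
  show "locally_integrable f"
    unfolding locally_integrable_def
  proof (intro allI impI, elim conjE)
    fix K :: "real set" assume K: "compact K" "K \<subseteq> half_line"
    then obtain a b where "0 < a" "K \<subseteq> {a..b}" by (rule compact_half_line_subset_Icc)
    moreover have Ks: "K \<in> sets lebesgue" using K(1) by (simp add: borel_compact)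
    ultimately have "f absolutely_integrable_on K" using f set_integrable_subset by blast
    then show "integrable (lebesgue_on K) f"
      using Ks by (rule absolutely_integrable_imp_integrable)
  qed
qed

lemma locally_integrable_measurable:
  assumes "locally_integrable f" shows "f \<in> borel_measurable half_lebesgue"
proof (rule measurable_piecewise_restrict[of "range (\<lambda>n. {inverse (real (Suc n))..real (Suc n)})"])
  show "countable (range (\<lambda>n. {inverse (real (Suc n))..real (Suc n)}))" by simp
  fix \<Omega> :: "real set" assume "\<Omega> \<in> range (\<lambda>n. {inverse (real (Suc n))..real (Suc n)})"
  then obtain n where n: "\<Omega> = {inverse (real (Suc n))..real (Suc n)}" by blast
  have sub: "\<Omega> \<subseteq> half_line" unfolding n by (auto intro: less_le_trans[of 0 "inverse (real (Suc n))"])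
  show "\<Omega> \<inter> space half_lebesgue \<in> sets half_lebesgue"
    using sub by (auto simp: sets_restrict_space_iff n)
  have "integrable (lebesgue_on \<Omega>) f"
    using assms sub unfolding locally_integrable_def n by blast
  then have "f \<in> borel_measurable (lebesgue_on \<Omega>)" by auto
  moreover have "restrict_space half_lebesgue \<Omega> = lebesgue_on \<Omega>"
    using sub by (simp add: restrict_restrict_space Int_absorb1 n)
  ultimately show "f \<in> borel_measurable (restrict_space half_lebesgue \<Omega>)" by simp
next
  show "space half_lebesgue \<subseteq> \<Union> (range (\<lambda>n. {inverse (real (Suc n))..real (Suc n)}))"
  proof
    fix x assume "x \<in> space half_lebesgue"
    then have "0 < x" by simp
    obtain n where n: "max x (inverse x) < real n" using reals_Archimedean2 by blast
    then have "inverse (real (Suc n)) \<le> x"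
      using \<open>0 < x\<close> by (simp add: inverse_le_iff_le[of "real (Suc n)" "inverse x", simplified] field_simps)
    with n show "x \<in> \<Union> (range (\<lambda>n. {inverse (real (Suc n))..real (Suc n)}))"
      by (auto intro!: exI[of _ n])
  qed
qed

lemma locally_integrable_diff:
  "locally_integrable f \<Longrightarrow> locally_integrable g \<Longrightarrow> locally_integrable (\<lambda>x. f x - g x)"
  unfolding locally_integrable_iff by (auto intro: set_integral_diff)

lemma ac_deriv_locally_integrable:
  assumes "ac_deriv F G" shows "locally_integrable F" "locally_integrable G"
proof -
  show "locally_integrable F"
    unfolding locally_integrable_iff
    by (auto intro: absolutely_integrable_continuous_real ac_deriv_continuous_Icc[OF assms])
  have "G absolutely_integrable_on {a..b}" if "0 < a" for a b
    using ac_derivD(1)[OF assms that, of b] by (cases "a \<le> b") auto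
  then show "locally_integrable G" by (simp add: locally_integrable_iff)
qed

lemma test_function_deriv:
  assumes "test_function \<phi>"
  shows "(\<phi> has_real_derivative deriv \<phi> x) (at x)" "continuous_on UNIV \<phi>" "continuous_on UNIV (deriv \<phi>)"
proof -
  have diff: "(deriv ^^ k) \<phi> differentiable_on UNIV" for k
    using assms by (simp add: test_function_def)
  show "(\<phi> has_real_derivative deriv \<phi> x) (at x)"
    using diff[of 0] by (simp add: differentiable_on_def DERIV_deriv_iff_real_differentiable)
  show "continuous_on UNIV \<phi>" "continuous_on UNIV (deriv \<phi>)"
    using differentiable_imp_continuous_on[OF diff[of 0]] differentiable_imp_continuous_on[OF diff[of 1]] by simp_all
qed

lemma test_function_support:
  assumes "test_function \<phi>"
  obtains a b where "0 < a" "a \<le> b" "\<forall>x. x \<notin> {a..b} \<longrightarrow> \<phi> x = 0 \<and> deriv \<phi> x = 0"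
proof -
  have "closure {x. \<phi> x \<noteq> 0} \<subseteq> half_line" "compact (closure {x. \<phi> x \<noteq> 0})"
    using assms by (auto simp: test_function_def)
  then obtain a b where ab: "0 < a" "a \<le> b" "closure {x. \<phi> x \<noteq> 0} \<subseteq> {a..b}"
    by (metis compact_half_line_subset_Icc)
  have z: "\<phi> x = 0" if "x \<notin> {a..b}" for x
    using ab(3) closure_subset[of "{x. \<phi> x \<noteq> 0}"] that by blast
  have z': "deriv \<phi> x = 0" if x: "x \<notin> {a..b}" for x
  proof (rule DERIV_unique[OF test_function_deriv(1)[OF assms]])
    have "((\<lambda>x. 0) has_real_derivative 0) (at x)" by simp
    then show "(\<phi> has_real_derivative 0) (at x)"
      by (rule has_field_derivative_transform_within_open[where S = "- {a..b}"])
        (use x in \<open>auto simp: z open_Compl\<close>)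
  qed
  from z z' have "\<forall>x. x \<notin> {a..b} \<longrightarrow> \<phi> x = 0 \<and> deriv \<phi> x = 0" by blast
  with ab show ?thesis by (metis that)
qed

lemma test_function_integrable_mult:
  assumes "locally_integrable f" "test_function \<phi>"
  shows "integrable half_lebesgue (\<lambda>x. f x * \<phi> x)" "integrable half_lebesgue (\<lambda>x. f x * deriv \<phi> x)"
proof -
  obtain a b where ab: "0 < a" "a \<le> b" "\<forall>x. x \<notin> {a..b} \<longrightarrow> \<phi> x = 0 \<and> deriv \<phi> x = 0"
    by (rule test_function_support[OF assms(2)])
  note c = test_function_deriv(2,3)[OF assms(2)]
  have "(\<lambda>x. \<psi> x * f x) absolutely_integrable_on {a..b}" if "continuous_on UNIV \<psi>" for \<psi>
    using assms(1) ab(1) continuous_on_subset[OF that]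
    by (intro absolutely_integrable_continuous_mult) (auto simp: locally_integrable_iff)
  from this[OF c(1)] this[OF c(2)]
  show "integrable half_lebesgue (\<lambda>x. f x * \<phi> x)" "integrable half_lebesgue (\<lambda>x. f x * deriv \<phi> x)"
    using ab by (auto intro!: integrable_half_supported[where a = a and b = b] simp: mult.commute)
qed

lemma ac_deriv_has_weak_deriv:
  assumes F: "ac_deriv F G" shows "has_weak_deriv F G"
  unfolding has_weak_deriv_def
proof (intro conjI allI impI)
  show loc: "locally_integrable F" "locally_integrable G"
    by (rule ac_deriv_locally_integrable[OF F])+
  fix \<phi> assume \<phi>: "test_function \<phi>"
  obtain a b where ab: "0 < a" "a \<le> b" "\<forall>x. x \<notin> {a..b} \<longrightarrow> \<phi> x = 0 \<and> deriv \<phi> x = 0"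
    by (rule test_function_support[OF \<phi>])
  note d = test_function_deriv(1)[OF \<phi>] and c = test_function_deriv(2,3)[OF \<phi>]
  let ?p = "\<lambda>x. G x * \<phi> x + F x * deriv \<phi> x"
  have "ac_deriv \<phi> (deriv \<phi>)"
    by (rule ac_deriv_C1[OF d continuous_on_subset[OF c(2)]]) simp
  note p = ac_deriv_mult[OF F this]
  \<comment> \<open>The interval is enlarged so that its endpoints lie outside
    \<open>{a..b}\<close>, where \<open>\<phi>\<close> is known to vanish.\<close>
  have ab': "0 < a / 2" "a / 2 \<le> b + 1" "a / 2 \<notin> {a..b}" "b + 1 \<notin> {a..b}" using ab by auto
  have "(LINT x|half_lebesgue. ?p x) = integral {a / 2..b + 1} ?p"
    by (rule integrable_half_supported(2)[OF ac_derivD(1)[OF p ab'(1,2)] ab'(1)]) (use ab in auto)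
  also have "\<dots> = 0"
    using ac_derivD(3)[OF p ab'(1,2)] ab(3)[rule_format, OF ab'(3)] ab(3)[rule_format, OF ab'(4)] by simp
  finally show "(LINT x|half_lebesgue. F x * deriv \<phi> x) = - (LINT x|half_lebesgue. G x * \<phi> x)"
    using test_function_integrable_mult[OF loc(1) \<phi>] test_function_integrable_mult[OF loc(2) \<phi>] by simp
qed

lemma AE_half_iff_negligible:
  "(AE x in half_lebesgue. P x) \<longleftrightarrow> negligible {x. 0 < x \<and> \<not> P x}"
proof -
  have "(AE x in half_lebesgue. P x) \<longleftrightarrow> (AE x in lebesgue. x \<in> half_line \<longrightarrow> P x)"
    by (rule AE_restrict_space_iff[OF half_line_Int])
  also have "\<dots> \<longleftrightarrow> (\<exists>N. negligible N \<and> {x. 0 < x \<and> \<not> P x} \<subseteq> N)"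
    by (simp add: eventually_ae_filter negligible_iff_null_sets Bex_def)
  also have "\<dots> \<longleftrightarrow> negligible {x. 0 < x \<and> \<not> P x}"
    using negligible_subset by blast
  finally show ?thesis .
qed

text \<open>Lebesgue differentiation: almost every value of \<open>h\<close> is the limit of
  averages over shrinking intervals, and these are all 0.\<close>

lemma AE_eq_0_of_interval_integrals:
  assumes h: "locally_integrable h" and zero: "\<And>a b. 0 < a \<Longrightarrow> a \<le> b \<Longrightarrow> integral {a..b} h = 0"
  shows "AE x in half_lebesgue. h x = 0"
proof -
  have "negligible {x. inverse (real (Suc n)) \<le> x \<and> h x \<noteq> 0}" for n
  proof -
    define c where "c = inverse (real (Suc n))"
    have "0 < c" by (simp add: c_def)
    \<comment> \<open>The cut-off is integrable over every bounded interval of the line, whereas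
      \<open>h\<close> is controlled only away from 0. The union over \<open>n\<close> recovers the
      half-line.\<close>
    let ?f = "\<lambda>x. if c \<le> x then h x else 0"
    have eq: "(\<lambda>x. if x \<in> {c..} then h x else 0) = ?f" by auto
    have "?f integrable_on cbox a b" for a b
    proof -
      have "h absolutely_integrable_on {max a c..b}"
        using h \<open>0 < c\<close> by (simp add: locally_integrable_iff)
      then have "h integrable_on ({c..} \<inter> {a..b})"
        by (simp add: Int_atLeastAtMost set_lebesgue_integral_eq_integral(1) max.commute)
      then show ?thesis
        using integrable_restrict_Int[where S = "{c..}" and f = h and T = "{a..b}"] by (simp add: eq)
    qed
    from integrable_ccontinuous_explicit[OF this] obtain N where N: "negligible N"
      "\<And>x e. x \<notin> N \<Longrightarrow> 0 < e \<Longrightarrow> \<exists>d>0. \<forall>t. 0 < t \<and> t < d \<longrightarrow>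
         norm (integral (cbox x (x + t *\<^sub>R One)) ?f /\<^sub>R t ^ DIM(real) - ?f x) < e"
      by blast
    have "{x. c \<le> x \<and> h x \<noteq> 0} \<subseteq> N"
    proof (rule subsetI, rule ccontr)
      fix x assume x: "x \<in> {x. c \<le> x \<and> h x \<noteq> 0}" and "x \<notin> N"
      with N(2)[of x "\<bar>h x\<bar>"] obtain d where d: "0 < d"
        "\<And>t. 0 < t \<Longrightarrow> t < d \<Longrightarrow> norm (integral {x..x + t} ?f / t - h x) < \<bar>h x\<bar>"
        by (auto simp: divide_inverse mult.commute)
      have "integral {x..x + d / 2} ?f = integral {x..x + d / 2} h"
        using x by (intro Henstock_Kurzweil_Integration.integral_cong) auto
      also have "\<dots> = 0" using x d \<open>0 < c\<close> by (intro zero) auto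
      finally show False using d(2)[of "d / 2"] d(1) by simp
    qed
    with N(1) show ?thesis unfolding c_def by (rule negligible_subset)
  qed
  then have "negligible (\<Union>n. {x. inverse (real (Suc n)) \<le> x \<and> h x \<noteq> 0})"
    by (intro negligible_countable_Union) auto
  moreover have "{x. 0 < x \<and> h x \<noteq> 0} \<subseteq> (\<Union>n. {x. inverse (real (Suc n)) \<le> x \<and> h x \<noteq> 0})"
  proof
    fix x assume x: "x \<in> {x. 0 < x \<and> h x \<noteq> 0}"
    then obtain n where "inverse (real (Suc n)) < x" using reals_Archimedean[of x] by auto
    with x show "x \<in> (\<Union>n. {x. inverse (real (Suc n)) \<le> x \<and> h x \<noteq> 0})"
      by (auto intro!: exI[of _ n])
  qed
  ultimately show ?thesis
    unfolding AE_half_iff_negligible by (rule negligible_subset)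
qed

text \<open>Bumps approximate indicators of intervals, so all interval integrals of \<open>h\<close>
  vanish. Testing is restricted to \<open>flat_algebra\<close> because
  \<open>AE_const_of_weak_deriv_0\<close> has to construct primitives of its test functions by
  \<open>test_function_primitive\<close>.\<close>

lemma fundamental_lemma:
  assumes h: "locally_integrable h"
    and zero: "\<And>\<psi> a b. flat_algebra \<psi> \<Longrightarrow> 0 < a \<Longrightarrow> a \<le> b \<Longrightarrow> (\<And>x. x \<notin> {a..b} \<Longrightarrow> \<psi> x = 0) \<Longrightarrow>
      (LINT x|half_lebesgue. h x * \<psi> x) = 0"
  shows "AE x in half_lebesgue. h x = 0"
proof (rule AE_eq_0_of_interval_integrals[OF h])
  fix a b :: real assume ab: "0 < a" "a \<le> b"
  have habs: "h absolutely_integrable_on {a..b}" using h ab by (simp add: locally_integrable_iff)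
  have "h absolutely_integrable_on {a<..<b}" by (rule set_integrable_subset[OF habs]) auto
  then have indh: "(\<lambda>x. indicator {a<..<b} x * h x) absolutely_integrable_on {a..b}"
    unfolding set_integrable_def
    by (rule Bochner_Integration.integrable_cong[THEN iffD1, OF refl, rotated]) (auto simp: indicator_def)
  have int: "integrable half_lebesgue (\<lambda>x. indicator {a<..<b} x * h x)"
    by (intro integrable_half_supported[where a = a and b = b])
      (use indh ab in auto)
  have meas: "h \<in> borel_measurable half_lebesgue" by (rule locally_integrable_measurable[OF h])
  have "(\<lambda>n. LINT x|half_lebesgue. h x * bump a b n x) \<longlonglongrightarrow> (LINT x|half_lebesgue. h x * indicator {a<..<b} x)"
  proof (rule integral_dominated_convergence[where w = "\<lambda>x. \<bar>indicator {a<..<b} x * h x\<bar>"])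
    show "(\<lambda>x. h x * indicator {a<..<b} x) \<in> borel_measurable half_lebesgue"
      using int by (auto simp: mult.commute)
    show "(\<lambda>x. h x * bump a b n x) \<in> borel_measurable half_lebesgue" for n
      by (intro borel_measurable_times meas continuous_imp_measurable_on_sets_lebesgue
          flat_algebra_continuous flat_algebra_bump) simp
    show "integrable half_lebesgue (\<lambda>x. \<bar>indicator {a<..<b} x * h x\<bar>)" using int by simp
    show "AE x in half_lebesgue. (\<lambda>n. h x * bump a b n x) \<longlonglongrightarrow> h x * indicator {a<..<b} x"
      by (intro AE_I2 tendsto_intros bump_tendsto)
    show "AE x in half_lebesgue. norm (h x * bump a b n x) \<le> \<bar>indicator {a<..<b} x * h x\<bar>" for n
    proof (rule AE_I2)
      fix x
      show "norm (h x * bump a b n x) \<le> \<bar>indicator {a<..<b} x * h x\<bar>"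
      proof (cases "a < x \<and> x < b")
        case True
        then show ?thesis
          using mult_left_mono[OF bump_bounds(2)[of a b n x], of "\<bar>h x\<bar>"] bump_bounds(1)[of a b n x]
          by (simp add: abs_mult)
      qed (auto simp: bump_eq)
    qed
  qed
  moreover have "(LINT x|half_lebesgue. h x * bump a b n x) = 0" for n
    by (rule zero[OF flat_algebra_bump ab bump_outside])
  ultimately have "(LINT x|half_lebesgue. h x * indicator {a<..<b} x) = 0"
    by (simp add: LIMSEQ_const_iff)
  also have "(LINT x|half_lebesgue. h x * indicator {a<..<b} x) = integral {a..b} (\<lambda>x. indicator {a<..<b} x * h x)"
    by (subst mult.commute, rule integrable_half_supported)
      (use indh ab in auto)
  also have "\<dots> = integral {a..b} h"
    by (rule integral_spike[of "{a, b}"]) auto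
  finally show "integral {a..b} h = 0" .
qed

text \<open>Since \<open>weak_deriv\<close> is an arbitrary choice, this is what identifies it,
  almost everywhere, with a weak derivative found by computation.\<close>

lemma has_weak_deriv_unique:
  assumes "has_weak_deriv f g" "has_weak_deriv f g'"
  shows "AE x in half_lebesgue. g x = g' x"
proof -
  have loc: "locally_integrable g" "locally_integrable g'"
    using assms by (auto simp: has_weak_deriv_def)
  have "AE x in half_lebesgue. g x - g' x = 0"
  proof (rule fundamental_lemma[OF locally_integrable_diff[OF loc]])
    fix \<psi> a b assume "flat_algebra \<psi>" "0 < a" "a \<le> b" "\<And>x. x \<notin> {a..b} \<Longrightarrow> \<psi> x = 0"
    then have \<psi>: "test_function \<psi>" by (metis test_function_flat_algebra)
    have "(LINT x|half_lebesgue. g x * \<psi> x) = (LINT x|half_lebesgue. g' x * \<psi> x)"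
      using assms \<psi> by (auto simp: has_weak_deriv_def)
    then show "(LINT x|half_lebesgue. (g x - g' x) * \<psi> x) = 0"
      using test_function_integrable_mult(1)[OF loc(1) \<psi>] test_function_integrable_mult(1)[OF loc(2) \<psi>]
      by (simp add: left_diff_distrib)
  qed
  then show ?thesis by simp
qed

lemma has_weak_deriv_diff:
  assumes "has_weak_deriv f f'" "has_weak_deriv g g'"
  shows "has_weak_deriv (\<lambda>x. f x - g x) (\<lambda>x. f' x - g' x)"
  unfolding has_weak_deriv_def
proof (intro conjI allI impI)
  have loc: "locally_integrable f" "locally_integrable f'" "locally_integrable g" "locally_integrable g'"
    using assms by (auto simp: has_weak_deriv_def)
  then show "locally_integrable (\<lambda>x. f x - g x)" "locally_integrable (\<lambda>x. f' x - g' x)"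
    by (auto intro: locally_integrable_diff)
  fix \<phi> assume \<phi>: "test_function \<phi>"
  note i = test_function_integrable_mult[OF _ \<phi>]
  have "(LINT x|half_lebesgue. f x * deriv \<phi> x) = - (LINT x|half_lebesgue. f' x * \<phi> x)"
    "(LINT x|half_lebesgue. g x * deriv \<phi> x) = - (LINT x|half_lebesgue. g' x * \<phi> x)"
    using assms \<phi> unfolding has_weak_deriv_def by blast+
  then show "(LINT x|half_lebesgue. (f x - g x) * deriv \<phi> x) = - (LINT x|half_lebesgue. (f' x - g' x) * \<phi> x)"
    unfolding left_diff_distrib
    by (simp add: Bochner_Integration.integral_diff[OF i(2)[OF loc(1)] i(2)[OF loc(3)]]
        Bochner_Integration.integral_diff[OF i(1)[OF loc(2)] i(1)[OF loc(4)]])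
qed

lemma locally_integrable_AE_cong:
  assumes "locally_integrable f" "AE x in half_lebesgue. f x = g x"
  shows "locally_integrable g"
  unfolding locally_integrable_iff
proof (intro allI impI)
  fix a b :: real assume "0 < a"
  then show "g absolutely_integrable_on {a..b}"
    using assms(1) assms(2)[unfolded AE_half_iff_negligible]
    by (rule_tac absolutely_integrable_spike[where f = f and S = "{x. 0 < x \<and> f x \<noteq> g x}"])
      (auto simp: locally_integrable_iff)
qed

lemma has_weak_deriv_AE_cong:
  assumes w: "has_weak_deriv f g" and ae: "AE x in half_lebesgue. f x = f' x"
  shows "has_weak_deriv f' g"
proof -
  have loc: "locally_integrable f" "locally_integrable g" using w by (auto simp: has_weak_deriv_def)
  have loc': "locally_integrable f'" by (rule locally_integrable_AE_cong[OF loc(1) ae])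
  have "(LINT x|half_lebesgue. f' x * deriv \<phi> x) = (LINT x|half_lebesgue. f x * deriv \<phi> x)" if "test_function \<phi>" for \<phi>
    using ae test_function_integrable_mult(2)[OF loc(1) that] test_function_integrable_mult(2)[OF loc' that]
    by (intro integral_cong_AE) auto
  with w loc loc' show ?thesis by (simp add: has_weak_deriv_def)
qed

text \<open>Subtracting from \<open>\<psi>\<close> a suitable multiple of one fixed bump
  \<open>\<rho>\<close> makes its integral 0. The result is the derivative of a test function, on
  which \<open>h\<close> acts as 0. So \<open>h\<close> acts on every \<open>\<psi>\<close> as the
  constant \<open>c\<close>, its average against \<open>\<rho>\<close>.\<close>

lemma AE_const_of_weak_deriv_0:
  assumes h: "locally_integrable h"
    and zero: "\<And>\<phi>. test_function \<phi> \<Longrightarrow> (LINT x|half_lebesgue. h x * deriv \<phi> x) = 0"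
  obtains c where "AE x in half_lebesgue. h x = c"
proof -
  define I :: "(real \<Rightarrow> real) \<Rightarrow> real" where "I \<psi> = (LINT x|half_lebesgue. \<psi> x)" for \<psi>
  define \<rho> where "\<rho> = bump 1 2 0"
  have \<rho>: "flat_algebra \<rho>" "\<And>x. x \<notin> {1..2} \<Longrightarrow> \<rho> x = 0"
    by (auto simp: \<rho>_def flat_algebra_bump bump_outside)
  have supp_int: "integrable half_lebesgue \<psi>" "I \<psi> = integral {a..b} \<psi>"
    if "flat_algebra \<psi>" "0 < a" "\<And>x. x \<notin> {a..b} \<Longrightarrow> \<psi> x = 0" for \<psi> a b
    unfolding I_def using that
    by (auto intro!: integrable_half_supported[where a = a and b = b] absolutely_integrable_continuous_real
        flat_algebra_continuous)
  have test: "test_function \<psi>" if "flat_algebra \<psi>" "0 < a" "\<And>x. x \<notin> {a..b} \<Longrightarrow> \<psi> x = 0" for \<psi> a b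
    using that by (rule test_function_flat_algebra)
  have "I \<rho> > 0"
  proof -
    have "I \<rho> \<noteq> 0"
    proof
      assume "I \<rho> = 0"
      then have "integral {1..2} \<rho> = 0" using supp_int(2)[OF \<rho>(1) _ \<rho>(2)] by simp
      then have "(\<rho> has_integral 0) {1..2}"
        using integrable_integral[OF integrable_continuous_interval[OF flat_algebra_continuous[OF \<rho>(1)]], of 1 2] by simp
      then have "(\<rho> has_integral 0) (cbox 1 2)" by simp
      \<comment> \<open>A nonnegative continuous function with integral 0 vanishes on the interval,
        but the bump is positive at the midpoint 3/2.\<close>
      from has_integral_0_cbox_imp_0[OF flat_algebra_continuous[OF \<rho>(1)] _ this, of "3/2"]
      show False by (auto simp: \<rho>_def bump_bounds bump_eq)
    qed
    moreover have "0 \<le> I \<rho>" unfolding I_def by (intro integral_nonneg_AE AE_I2) (simp add: \<rho>_def bump_bounds)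
    ultimately show ?thesis by simp
  qed
  define c where "c = I (\<lambda>x. h x * \<rho> x) / I \<rho>"
  have loc_c: "locally_integrable (\<lambda>x. c)"
    using ac_deriv_locally_integrable[OF ac_deriv_const[of c]] by simp
  have "AE x in half_lebesgue. h x - c = 0"
  proof (rule fundamental_lemma[OF locally_integrable_diff[OF h loc_c]])
    fix \<psi> :: "real \<Rightarrow> real" and a b :: real
    assume \<psi>: "flat_algebra \<psi>" "0 < a" "a \<le> b" "\<And>x. x \<notin> {a..b} \<Longrightarrow> \<psi> x = 0"
    define t where "t = I \<psi> / I \<rho>"
    define \<eta> where "\<eta> x = \<psi> x + (- t) * \<rho> x" for x
    have \<eta>: "flat_algebra \<eta>" unfolding \<eta>_def[abs_def]
      by (intro flat_algebra.intros \<psi> \<rho>)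
    have \<eta>_supp: "\<eta> x = 0" if "x \<notin> {min a 1..max b 2}" for x
    proof -
      have "x \<notin> {a..b}" "x \<notin> {1..2}" using that by auto
      then show ?thesis using \<psi>(4) \<rho>(2) by (simp add: \<eta>_def)
    qed
    have i: "integrable half_lebesgue \<psi>" "integrable half_lebesgue \<rho>"
      by (rule supp_int(1)[OF \<psi>(1,2,4)], assumption) (rule supp_int(1)[OF \<rho>(1) _ \<rho>(2)], simp_all)
    have "I \<eta> = I \<psi> - t * I \<rho>" using i by (simp add: I_def \<eta>_def)
    also have "\<dots> = 0" using \<open>I \<rho> > 0\<close> by (simp add: t_def)
    finally have "I \<eta> = 0" .
    moreover have "0 < min a 1" "min a 1 \<le> max b 2" using \<psi> by auto
    ultimately obtain \<phi> where "test_function \<phi>" "deriv \<phi> = \<eta>"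
      using test_function_primitive[OF \<eta> _ _ \<eta>_supp] supp_int(2)[OF \<eta> _ \<eta>_supp] by metis
    then have "(LINT x|half_lebesgue. h x * \<eta> x) = 0" using zero by metis
    moreover have ih: "integrable half_lebesgue (\<lambda>x. h x * \<psi> x)" "integrable half_lebesgue (\<lambda>x. h x * \<rho> x)"
      by (rule test_function_integrable_mult(1)[OF h test[OF \<psi>(1,2,4)]], assumption)
        (rule test_function_integrable_mult(1)[OF h test[OF \<rho>(1) _ \<rho>(2)]], simp_all)
    moreover have "(LINT x|half_lebesgue. h x * \<eta> x) = I (\<lambda>x. h x * \<psi> x) - t * I (\<lambda>x. h x * \<rho> x)"
    proof -
      have "(LINT x|half_lebesgue. h x * \<eta> x) = (LINT x|half_lebesgue. h x * \<psi> x - t * (h x * \<rho> x))"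
        by (intro Bochner_Integration.integral_cong) (auto simp: \<eta>_def algebra_simps)
      then show ?thesis using ih by (simp add: I_def)
    qed
    ultimately have "I (\<lambda>x. h x * \<psi> x) = c * I \<psi>" by (simp add: t_def c_def)
    then show "(LINT x|half_lebesgue. (h x - c) * \<psi> x) = 0"
      using ih i by (simp add: I_def left_diff_distrib)
  qed
  then show ?thesis by (intro that[of c]) simp
qed

text \<open>The primitive \<open>F0\<close> of \<open>g\<close> with base point 1 also has weak
  derivative \<open>g\<close>, so \<open>f - F0\<close> is constant almost everywhere.\<close>

lemma has_weak_deriv_imp_ac_deriv:
  assumes w: "has_weak_deriv f g"
  obtains F where "ac_deriv F g" "AE x in half_lebesgue. F x = f x"
proof -
  have loc: "locally_integrable f" "locally_integrable g" using w by (auto simp: has_weak_deriv_def)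
  have gi: "g integrable_on {a..b}" if "0 < a" for a b
    using loc(2) that by (auto simp: locally_integrable_iff intro: set_lebesgue_integral_eq_integral)
  define F0 where "F0 x = (if 1 \<le> x then integral {1..x} g else - integral {x..1} g)" for x
  have F0: "ac_deriv F0 g"
    unfolding ac_deriv_def
  proof (intro allI impI conjI)
    fix a b :: real assume ab: "0 < a \<and> a \<le> b"
    then show "g absolutely_integrable_on {a..b}" using loc(2) by (simp add: locally_integrable_iff)
    have comb: "integral {x..y} g + integral {y..t} g = integral {x..t} g" if "0 < x" "x \<le> y" "y \<le> t" for x y t
      using that by (intro Henstock_Kurzweil_Integration.integral_combine gi) auto
    show "integral {a..b} g = F0 b - F0 a"
      using ab comb[of 1 a b] comb[of a 1 b] comb[of a b 1] unfolding F0_def by auto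
  qed
  have w0: "has_weak_deriv F0 g" by (rule ac_deriv_has_weak_deriv[OF F0])
  obtain c where c: "AE x in half_lebesgue. f x - F0 x = c"
  proof (rule AE_const_of_weak_deriv_0)
    show "locally_integrable (\<lambda>x. f x - F0 x)"
      using w w0 by (auto simp: has_weak_deriv_def intro: locally_integrable_diff)
    show "(LINT x|half_lebesgue. (f x - F0 x) * deriv \<phi> x) = 0" if "test_function \<phi>" for \<phi>
      using has_weak_deriv_diff[OF w w0] that by (simp add: has_weak_deriv_def)
  qed
  have "ac_deriv (\<lambda>x. F0 x + c) g"
    using ac_deriv_add[OF F0 ac_deriv_const[of c]] by simp
  moreover have "AE x in half_lebesgue. F0 x + c = f x"
    using c by eventually_elim auto
  ultimately show ?thesis by (rule that)
qed

section \<open>The projection error\<close>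

context L2_weight
begin

text \<open>Gram-Schmidt, one vector at a time: \<open>r\<close> and \<open>s\<close> are the
  residuals of \<open>u\<close> and of the new vector after projection onto the earlier ones, and
  \<open>r\<close> is corrected along \<open>s\<close>. The vectors may be dependent; then
  \<open>s\<close> can have norm 0, and nonnegativity of the quadratic in \<open>t\<close> forces
  \<open>r\<close> to be orthogonal to \<open>s\<close> already.\<close>

lemma exists_orthogonal_projection:
  fixes n :: nat
  assumes e: "\<And>k. k < n \<Longrightarrow> e k \<in> L2_space \<rho>" and "u \<in> L2_space \<rho>"
  shows "\<exists>c. \<forall>k<n. L2_inner \<rho> (\<lambda>x. u x - (\<Sum>i<n. c i * e i x)) (e k) = 0"
  using assms
proof (induction n arbitrary: u)
  case (Suc n)
  let ?S = "\<lambda>c x. \<Sum>i<n. c i * e i x"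
  have S: "?S c \<in> L2_space \<rho>" for c
    using Suc.prems(1) by (intro L2_sum L2_cmult) auto
  obtain c where c: "\<And>k. k < n \<Longrightarrow> L2_inner \<rho> (\<lambda>x. u x - ?S c x) (e k) = 0"
    using Suc.IH[OF Suc.prems(1), of u] Suc.prems by auto
  obtain d where d: "\<And>k. k < n \<Longrightarrow> L2_inner \<rho> (\<lambda>x. e n x - ?S d x) (e k) = 0"
    using Suc.IH[OF Suc.prems(1), of "e n"] Suc.prems by auto
  define r where "r x = u x - ?S c x" for x
  define s where "s x = e n x - ?S d x" for x
  have rs: "r \<in> L2_space \<rho>" "s \<in> L2_space \<rho>"
    unfolding r_def[abs_def] s_def[abs_def] using Suc.prems S by (auto intro: L2_diff)
  have lin: "L2_inner \<rho> (\<lambda>x. r x - t * s x) f = L2_inner \<rho> r f - t * L2_inner \<rho> s f" if "f \<in> L2_space \<rho>" for t f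
    using L2_inner_diff[OF that rs(1) L2_cmult[OF rs(2), of t]]
    by (simp add: L2_inner_commute[of _ f] L2_inner_cmult)
  have "\<exists>t. L2_inner \<rho> r s - t * L2_inner \<rho> s s = 0"
  proof (cases "L2_inner \<rho> s s = 0")
    case True
    have q: "0 \<le> L2_inner \<rho> r r - 2 * t * L2_inner \<rho> r s" for t
    proof -
      have ts: "(\<lambda>x. r x - t * s x) \<in> L2_space \<rho>" by (intro L2_diff L2_cmult rs)
      have "0 \<le> L2_inner \<rho> (\<lambda>x. r x - t * s x) (\<lambda>x. r x - t * s x)"
        by (rule L2_inner_self_nonneg)
      also have "\<dots> = L2_inner \<rho> r (\<lambda>x. r x - t * s x) - t * L2_inner \<rho> s (\<lambda>x. r x - t * s x)"
        by (rule lin[OF ts])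
      also have "\<dots> = L2_inner \<rho> r r - 2 * t * L2_inner \<rho> r s"
        using True lin[OF rs(1)] lin[OF rs(2)] by (simp add: L2_inner_commute[of _ "\<lambda>x. r x - t * s x"] L2_inner_commute[of s r])
      finally show ?thesis .
    qed
    have "L2_inner \<rho> r s = 0"
    proof (rule ccontr)
      assume "L2_inner \<rho> r s \<noteq> 0"
      \<comment> \<open>At this \<open>t\<close> the nonnegative expression would be -1.\<close>
      with q[of "(L2_inner \<rho> r r + 1) / (2 * L2_inner \<rho> r s)"] show False by (simp add: field_simps)
    qed
    then show ?thesis by (intro exI[of _ 0]) simp
  next
    case False
    then show ?thesis by (intro exI[of _ "L2_inner \<rho> r s / L2_inner \<rho> s s"]) simp
  qed
  then obtain t where t: "L2_inner \<rho> r s - t * L2_inner \<rho> s s = 0" ..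
  define c' where "c' i = (if i = n then t else c i - t * d i)" for i
  have eq: "(\<lambda>x. u x - (\<Sum>i<Suc n. c' i * e i x)) = (\<lambda>x. r x - t * s x)"
  proof
    fix x
    have "(\<Sum>i<n. c' i * e i x) = ?S c x - t * ?S d x"
      by (simp add: c'_def sum_subtractf sum_distrib_left algebra_simps)
    then show "u x - (\<Sum>i<Suc n. c' i * e i x) = r x - t * s x"
      by (simp add: r_def s_def c'_def algebra_simps)
  qed
  have low: "L2_inner \<rho> (\<lambda>x. r x - t * s x) (e k) = 0" if "k < n" for k
    using lin[of "e k" t] c[OF that] d[OF that] Suc.prems(1)[of k] that by (simp add: r_def[abs_def] s_def[abs_def])
  have "L2_inner \<rho> (\<lambda>x. r x - t * s x) (e n) = L2_inner \<rho> (\<lambda>x. r x - t * s x) (\<lambda>x. s x + ?S d x)"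
    by (simp add: s_def)
  also have "\<dots> = L2_inner \<rho> (\<lambda>x. r x - t * s x) s + (\<Sum>i<n. d i * L2_inner \<rho> (\<lambda>x. r x - t * s x) (e i))"
    using Suc.prems(1) S rs
    by (subst L2_inner_add, auto intro!: L2_diff L2_cmult, subst L2_inner_sum)
      (auto intro!: L2_diff L2_cmult simp: L2_inner_cmult)
  also have "\<dots> = 0" using low t lin[OF rs(2)] by simp
  finally show ?case
    using low unfolding eq[symmetric] by (intro exI[of _ c'] allI impI) (auto simp only: less_Suc_eq)
qed simp

end

section \<open>Polynomials in \<open>z\<close> and the projection onto them\<close>

lemma poly_eq_sum_coeffs:
  fixes p :: "real poly"
  assumes "\<And>k. n \<le> k \<Longrightarrow> coeff p k = 0"
  shows "poly p x = (\<Sum>k<n. coeff p k * x ^ k)"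
proof -
  have "poly p x = (\<Sum>k\<le>degree p. coeff p k * x ^ k)" by (rule poly_altdef)
  also have "\<dots> = (\<Sum>k\<in>{..degree p} \<union> {..<n}. coeff p k * x ^ k)"
    by (rule sum.mono_neutral_left) (auto simp: coeff_eq_0)
  also have "\<dots> = (\<Sum>k<n. coeff p k * x ^ k)"
    by (rule sum.mono_neutral_right) (auto simp: assms not_less)
  finally show ?thesis .
qed

context mapped_weight
begin

text \<open>A genuine polynomial, so that finiteness of roots and iterated \<open>pderiv\<close> are
  available. The powers of \<open>\<beta> + 1\<close> compensate the factor in
  \<open>z\<close>.\<close>

definition z_poly :: "(nat \<Rightarrow> real) \<Rightarrow> nat \<Rightarrow> real poly" where
  "z_poly c M = (\<Sum>k\<le>M. monom (c k / (\<beta> + 1) ^ k) k)"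

lemma coeff_z_poly: "coeff (z_poly c M) k = (if k \<le> M then c k / (\<beta> + 1) ^ k else 0)"
  by (simp add: z_poly_def coeff_sum coeff_monom if_distrib cong: if_cong)

lemma powr_eq_z_power: "0 < x \<Longrightarrow> x powr (real k * \<gamma>) = z x ^ k / (\<beta> + 1) ^ k"
  using \<beta> by (simp add: z_def power_mult_distrib powr_powr mult.commute flip: powr_realpow)

lemma poly_z_poly: "0 < x \<Longrightarrow> poly (z_poly c M) (z x) = (\<Sum>k\<le>M. c k * x powr (real k * \<gamma>))"
  by (simp add: z_poly_def poly_sum poly_monom powr_eq_z_power)

lemma poly_z_L2: "- 1 < \<theta> \<Longrightarrow> (\<lambda>x. poly q (z x)) \<in> L2_space (W \<theta>)"
  unfolding poly_altdef by (intro w.L2_sum w.L2_cmult z_power_L2)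

lemma L2_half_line_cong:
  assumes "f \<in> L2_space (W \<theta>)" "\<And>x. 0 < x \<Longrightarrow> f x = g x"
  shows "g \<in> L2_space (W \<theta>)"
proof (rule w.L2_AE_cong[OF assms(1)])
  show "g \<in> borel_measurable half_lebesgue"
    using w.L2_measurable[OF assms(1)] assms(2) by (subst measurable_lebesgue_cong[of _ g f]) auto
qed (use assms(2) in \<open>auto intro!: AE_I2\<close>)

lemma P_space_L2: "- 1 < \<theta> \<Longrightarrow> p \<in> P_space \<gamma> M \<Longrightarrow> p \<in> L2_space (W \<theta>)"
proof -
  assume "- 1 < \<theta>" "p \<in> P_space \<gamma> M"
  then obtain c where "p = (\<lambda>x. \<Sum>k\<le>M. c k * x powr (real k * \<gamma>))" by (auto simp: P_space_def)
  with \<open>- 1 < \<theta>\<close> show ?thesis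
    by (intro L2_half_line_cong[OF poly_z_L2[of \<theta> "z_poly c M"]]) (simp_all add: poly_z_poly)
qed

lemma P_space_diff:
  assumes "p \<in> P_space \<gamma> M" "p' \<in> P_space \<gamma> M" shows "(\<lambda>x. p x - p' x) \<in> P_space \<gamma> M"
proof -
  from assms obtain c c' where "p = (\<lambda>x. \<Sum>k\<le>M. c k * x powr (real k * \<gamma>))"
    "p' = (\<lambda>x. \<Sum>k\<le>M. c' k * x powr (real k * \<gamma>))" by (auto simp: P_space_def)
  then have "(\<lambda>x. p x - p' x) = (\<lambda>x. \<Sum>k\<le>M. (c k - c' k) * x powr (real k * \<gamma>))"
    by (simp add: sum_subtractf left_diff_distrib)
  then show ?thesis by (auto simp: P_space_def)
qed

text \<open>Norm 0 makes a polynomial in \<open>z\<close> vanish almost everywhere on the half-line.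
  As \<open>z\<close> is injective there, a nonzero polynomial would have only finitely many zeros.
  It is the coefficients that vanish, so equality holds for total functions, as the definite
  description in \<open>proj\<close> demands.\<close>

lemma P_space_null:
  assumes p: "p \<in> P_space \<gamma> M" and zero: "L2_inner (W \<theta>) p p = 0" and \<theta>: "- 1 < \<theta>"
  shows "p = (\<lambda>x. 0)"
proof -
  from p obtain c where c: "p = (\<lambda>x. \<Sum>k\<le>M. c k * x powr (real k * \<gamma>))" by (auto simp: P_space_def)
  have "integrable half_lebesgue (\<lambda>x. p x * p x * W \<theta> x)"
    using P_space_L2[OF \<theta> p] by (intro w.L2_integrable_mult)
  then have "AE x in half_lebesgue. p x * p x * W \<theta> x = 0"
    using zero unfolding L2_inner_def
    by (subst (asm) integral_nonneg_eq_0_iff_AE) (auto intro!: AE_I2 simp: less_imp_le[OF W_pos])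
  then have "AE x in half_lebesgue. poly (z_poly c M) (z x) = 0"
    by (rule AE_mp) (auto intro!: AE_I2 simp: c poly_z_poly less_imp_neq[OF W_pos, symmetric])
  then have neg: "negligible {x. 0 < x \<and> poly (z_poly c M) (z x) \<noteq> 0}"
    by (simp add: AE_half_iff_negligible)
  have "z_poly c M = 0"
  proof (rule ccontr)
    assume "z_poly c M \<noteq> 0"
    have "inj_on z half_line"
      using \<beta> \<gamma> by (auto simp: inj_on_def z_def intro: powr_inj[THEN iffD1, of \<gamma>])
        (metis less_irrefl powr_less_mono2 linorder_neqE_linordered_idom less_imp_le)
    then have "finite {x \<in> half_line. z x \<in> {y. poly (z_poly c M) y = 0}}"
      using finite_vimage_IntI[OF poly_roots_finite[OF \<open>z_poly c M \<noteq> 0\<close>], of z half_line]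
      by (rule_tac finite_subset) auto
    then have "negligible ({x \<in> half_line. z x \<in> {y. poly (z_poly c M) y = 0}} \<union> {x. 0 < x \<and> poly (z_poly c M) (z x) \<noteq> 0})"
      by (rule negligible_Un[OF negligible_finite neg])
    then have "negligible {0<..<1::real}"
      by (rule negligible_subset) auto
    then show False
      using open_not_negligible[of "{0<..<1::real}"] by simp
  qed
  then have "c k = 0" if "k \<le> M" for k
    using coeff_z_poly[of c M k] that \<beta> by simp
  then show ?thesis by (simp add: c)
qed

lemma proj_properties:
  assumes \<theta>: "- 1 < \<theta>" and u: "u \<in> L2_space (W \<theta>)"
  shows "proj \<theta> \<beta> \<gamma> M u \<in> P_space \<gamma> M"
    and "\<And>w. w \<in> P_space \<gamma> M \<Longrightarrow> L2_inner (W \<theta>) (\<lambda>x. u x - proj \<theta> \<beta> \<gamma> M u x) w = 0"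
proof -
  let ?P = "\<lambda>p. p \<in> P_space \<gamma> M \<and> (\<forall>w \<in> P_space \<gamma> M. L2_inner (W \<theta>) (\<lambda>x. u x - p x) w = 0)"
  let ?e = "\<lambda>k x. x powr (real k * \<gamma>)"
  have e: "?e k \<in> L2_space (W \<theta>)" for k
  proof -
    have "?e k = (\<lambda>x. \<Sum>i\<le>k. (if i = k then 1 else 0) * x powr (real i * \<gamma>))"
      by (simp add: if_distrib[of "\<lambda>y. y * _"] cong: if_cong)
    then have "?e k \<in> P_space \<gamma> k"
      unfolding P_space_def by (intro CollectI exI[of _ "\<lambda>i. if i = k then 1 else 0"] conjI TrueI)
    then show ?thesis by (rule P_space_L2[OF \<theta>])
  qed
  from w.exists_orthogonal_projection[of "Suc M" ?e \<theta> u, OF e u] obtain c where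
    c: "\<forall>k<Suc M. L2_inner (W \<theta>) (\<lambda>x. u x - (\<Sum>i<Suc M. c i * ?e i x)) (?e k) = 0" by blast
  define p where "p x = (\<Sum>i\<le>M. c i * ?e i x)" for x
  have pP: "p \<in> P_space \<gamma> M" unfolding P_space_def p_def[abs_def] by blast
  have up: "(\<lambda>x. u x - p x) \<in> L2_space (W \<theta>)"
    by (intro w.L2_diff u P_space_L2[OF \<theta> pP])
  have "L2_inner (W \<theta>) (\<lambda>x. u x - p x) w = 0" if "w \<in> P_space \<gamma> M" for w
  proof -
    from that obtain d where d: "w = (\<lambda>x. \<Sum>k\<le>M. d k * ?e k x)" by (auto simp: P_space_def)
    show ?thesis
      unfolding d using c
      by (subst w.L2_inner_sum[OF up]) (auto intro!: w.L2_cmult e simp: w.L2_inner_cmult p_def lessThan_Suc_atMost less_Suc_eq_le)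
  qed
  with pP have "?P p" by blast
  moreover have "p1 = p2" if 1: "?P p1" and 2: "?P p2" for p1 p2
  proof -
    let ?d = "\<lambda>x. p1 x - p2 x"
    have d: "?d \<in> P_space \<gamma> M" using 1 2 by (intro P_space_diff) auto
    have L: "(\<lambda>x. u x - p1 x) \<in> L2_space (W \<theta>)" "(\<lambda>x. u x - p2 x) \<in> L2_space (W \<theta>)"
      by (intro w.L2_diff u P_space_L2[OF \<theta> conjunct1[OF 1]] P_space_L2[OF \<theta> conjunct1[OF 2]])+
    \<comment> \<open>Written as a difference of two errors, \<open>?d\<close> is orthogonal to
      every element of \<open>P_space\<close>, in particular to itself.\<close>
    have "L2_inner (W \<theta>) ?d ?d = L2_inner (W \<theta>) ?d (\<lambda>x. (u x - p2 x) - (u x - p1 x))" by simp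
    also have "\<dots> = 0"
      using 1 2 d by (subst w.L2_inner_diff[OF P_space_L2[OF \<theta> d] L(2,1)])
        (simp add: w.L2_inner_commute[of _ ?d])
    finally have "?d = (\<lambda>x. 0)" by (rule P_space_null[OF d _ \<theta>])
    then show ?thesis by (auto simp: fun_eq_iff)
  qed
  ultimately have "\<exists>!p. ?P p" by blast
  then have "?P (THE p. ?P p)" by (rule theI')
  then have "?P (proj \<theta> \<beta> \<gamma> M u)" unfolding proj_def .
  then show "proj \<theta> \<beta> \<gamma> M u \<in> P_space \<gamma> M"
    "\<And>w. w \<in> P_space \<gamma> M \<Longrightarrow> L2_inner (W \<theta>) (\<lambda>x. u x - proj \<theta> \<beta> \<gamma> M u x) w = 0" by blast+
qed

end

section \<open>Iterated mapped derivatives and the error estimate\<close>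

lemma weakly_differentiable_weak_deriv:
  "weakly_differentiable f \<Longrightarrow> has_weak_deriv f (weak_deriv f)"
  unfolding weakly_differentiable_def weak_deriv_def using someI_ex[of "has_weak_deriv f"] by simp

context mapped_weight
begin

abbreviation D :: "(real \<Rightarrow> real) \<Rightarrow> real \<Rightarrow> real" where "D \<equiv> mapped_deriv \<beta> \<gamma>"

lemma weak_deriv_eq_dz_D: "0 < x \<Longrightarrow> weak_deriv f x = dz x * D f x"
  using \<beta> \<gamma> by (simp add: mapped_deriv_def dz_def flip: powr_add)

lemma D_AE_eq:
  assumes w: "has_weak_deriv f (\<lambda>x. dz x * h x)"
  shows "AE x in half_lebesgue. D f x = h x"
proof -
  have "weakly_differentiable f" using w by (auto simp: weakly_differentiable_def)
  from has_weak_deriv_unique[OF weakly_differentiable_weak_deriv[OF this] w]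
  show ?thesis
  proof (rule AE_mp, intro AE_I2 impI)
    fix x assume "x \<in> space half_lebesgue" "weak_deriv f x = dz x * h x"
    then show "D f x = h x" using weak_deriv_eq_dz_D[of x f] dz_pos[of x] by simp
  qed
qed

lemma weakly_differentiable_D:
  assumes "weakly_differentiable f"
  obtains F where "ac_deriv F (\<lambda>x. dz x * D f x)" "AE x in half_lebesgue. F x = f x"
proof -
  from has_weak_deriv_imp_ac_deriv[OF weakly_differentiable_weak_deriv[OF assms]]
  obtain F where F: "ac_deriv F (weak_deriv f)" "AE x in half_lebesgue. F x = f x" .
  have "ac_deriv F (\<lambda>x. dz x * D f x)"
    by (rule ac_deriv_cong[THEN iffD1, OF _ _ F(1)]) (simp_all add: weak_deriv_eq_dz_D)
  then show ?thesis using F(2) by (rule that)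
qed

lemma has_weak_deriv_D:
  assumes "weakly_differentiable f" shows "has_weak_deriv f (\<lambda>x. dz x * D f x)"
proof -
  obtain F where "ac_deriv F (\<lambda>x. dz x * D f x)" "AE x in half_lebesgue. F x = f x"
    by (rule weakly_differentiable_D[OF assms])
  then show ?thesis by (blast intro: has_weak_deriv_AE_cong ac_deriv_has_weak_deriv)
qed

lemma D_measurable:
  assumes "weakly_differentiable f" shows "D f \<in> borel_measurable half_lebesgue"
proof -
  have "locally_integrable (\<lambda>x. dz x * D f x)"
    using has_weak_deriv_D[OF assms] by (simp add: has_weak_deriv_def)
  from locally_integrable_measurable[OF this]
  have "(\<lambda>x. (dz x * D f x) / dz x) \<in> borel_measurable half_lebesgue" by measurable
  then show ?thesis
    by (subst measurable_lebesgue_cong[of _ _ "\<lambda>x. (dz x * D f x) / dz x"]) (auto dest: dz_pos)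
qed

lemma poly_z_has_weak_deriv:
  "has_weak_deriv (\<lambda>x. poly q (z x)) (\<lambda>x. dz x * poly (pderiv q) (z x))"
  by (intro ac_deriv_has_weak_deriv ac_deriv_C1 DERIV_cong[OF DERIV_chain2[OF poly_DERIV z_deriv]]
      continuous_intros dz_continuous z_continuous) auto

lemma A_spaceD:
  assumes "u \<in> A_space \<theta> \<beta> \<gamma> \<mu>"
  shows "r \<le> \<mu> \<Longrightarrow> (D ^^ r) u \<in> L2_space (W (\<theta> + real r))"
    and "r < \<mu> \<Longrightarrow> weakly_differentiable ((D ^^ r) u)"
proof -
  show "(D ^^ r) u \<in> L2_space (W (\<theta> + real r))" if "r \<le> \<mu>"
    using assms that by (cases r) (auto simp: A_space_def)
  have "1 \<le> r + 1 \<and> r + 1 \<le> \<mu> \<longrightarrow> weakly_differentiable ((D ^^ (r + 1 - 1)) u)"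
    using assms unfolding A_space_def by blast
  then show "weakly_differentiable ((D ^^ r) u)" if "r < \<mu>"
    using that by simp
qed

text \<open>Every application of \<open>mapped_deriv\<close> chooses a new representative, so
  subtracting a polynomial commutes with its iterates only almost everywhere. The induction goes
  through because having a given weak derivative is insensitive to null sets.\<close>

lemma A_space_sub_poly:
  assumes \<theta>: "- 1 < \<theta>" and u: "u \<in> A_space \<theta> \<beta> \<gamma> \<mu>" and p: "\<forall>x>0. p x = poly q (z x)"
    and r: "r \<le> \<mu>"
  defines "v \<equiv> \<lambda>x. u x - p x"
  shows "AE x in half_lebesgue. (D ^^ r) v x = (D ^^ r) u x - poly ((pderiv ^^ r) q) (z x)"
    and "r < \<mu> \<Longrightarrow> weakly_differentiable ((D ^^ r) v)"
    and "(D ^^ r) v \<in> L2_space (W (\<theta> + real r))"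
proof -
  let ?h = "\<lambda>r x. (D ^^ r) u x - poly ((pderiv ^^ r) q) (z x)"
  have step: "has_weak_deriv ((D ^^ r) v) (\<lambda>x. dz x * ?h (Suc r) x)"
    if "AE x in half_lebesgue. (D ^^ r) v x = ?h r x" "r < \<mu>" for r
  proof -
    have "has_weak_deriv (?h r) (\<lambda>x. dz x * D ((D ^^ r) u) x - dz x * poly (pderiv ((pderiv ^^ r) q)) (z x))"
      by (intro has_weak_deriv_diff has_weak_deriv_D A_spaceD(2)[OF u that(2)] poly_z_has_weak_deriv)
    then have "has_weak_deriv (?h r) (\<lambda>x. dz x * ?h (Suc r) x)"
      by (simp add: right_diff_distrib)
    moreover have "AE x in half_lebesgue. ?h r x = (D ^^ r) v x"
      using that(1) by eventually_elim simp
    ultimately show ?thesis by (rule has_weak_deriv_AE_cong)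
  qed
  have ae: "AE x in half_lebesgue. (D ^^ r) v x = ?h r x" if "r \<le> \<mu>" for r
    using that
  proof (induction r)
    case 0
    show ?case by (intro AE_I2) (simp add: v_def p)
  next
    case (Suc r)
    then have "has_weak_deriv ((D ^^ r) v) (\<lambda>x. dz x * ?h (Suc r) x)" by (intro step) auto
    from D_AE_eq[OF this] show ?case by simp
  qed
  show "AE x in half_lebesgue. (D ^^ r) v x = ?h r x" by (rule ae[OF r])
  have wd: "weakly_differentiable ((D ^^ r) v)" if "r < \<mu>" for r
    using step[OF ae that] that unfolding weakly_differentiable_def by auto
  then show "r < \<mu> \<Longrightarrow> weakly_differentiable ((D ^^ r) v)" .
  have h: "?h r \<in> L2_space (W (\<theta> + real r))"
    using \<theta> by (intro w.L2_diff A_spaceD(1)[OF u r] poly_z_L2) simp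
  have "(D ^^ r) v \<in> borel_measurable half_lebesgue"
  proof (cases r)
    case 0
    have "v \<in> borel_measurable half_lebesgue"
      using w.L2_measurable[OF h] by (subst measurable_lebesgue_cong[of _ v "?h 0"]) (auto simp: v_def p 0)
    then show ?thesis by (simp add: 0)
  next
    case (Suc i)
    then show ?thesis using D_measurable[OF wd[of i]] r by simp
  qed
  then show "(D ^^ r) v \<in> L2_space (W (\<theta> + real r))"
    using ae[OF r] by (rule w.L2_AE_cong[OF h])
qed

text \<open>The inequality is applied to the absolutely continuous representative \<open>F\<close>,
  which has the same inner products as \<open>f\<close> and whose z-derivative is the very function
  \<open>D f\<close>.\<close>

lemma orthogonal_D_step:
  assumes \<theta>: "- 1 < \<theta>" and f: "weakly_differentiable f" "f \<in> L2_space (W \<theta>)" "D f \<in> L2_space (W (\<theta> + 1))"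
    and orth: "\<And>k. k < n \<Longrightarrow> L2_inner (W \<theta>) f (\<lambda>x. z x ^ k) = 0"
  shows "real n * L2_inner (W \<theta>) f f \<le> L2_inner (W (\<theta> + 1)) (D f) (D f)"
    and "\<And>k. Suc k < n \<Longrightarrow> L2_inner (W (\<theta> + 1)) (D f) (\<lambda>x. z x ^ k) = 0"
proof -
  obtain F where F: "ac_deriv F (\<lambda>x. dz x * D f x)" "AE x in half_lebesgue. F x = f x"
    by (rule weakly_differentiable_D[OF f(1)])
  have mf: "f \<in> borel_measurable half_lebesgue" "F \<in> borel_measurable half_lebesgue"
    using w.L2_measurable[OF f(2)] continuous_half_measurable[OF ac_deriv_continuous[OF F(1)]] by auto
  have FL: "F \<in> L2_space (W \<theta>)"
    by (rule w.L2_AE_cong[OF f(2) mf(2) F(2)])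
  have Fz: "L2_inner (W \<theta>) F (\<lambda>x. z x ^ k) = L2_inner (W \<theta>) f (\<lambda>x. z x ^ k)" for k
    by (rule w.L2_inner_AE_cong) (use mf F(2) in auto)
  have FF: "L2_inner (W \<theta>) F F = L2_inner (W \<theta>) f f"
    by (rule w.L2_inner_AE_cong) (use mf F(2) in auto)
  show "real n * L2_inner (W \<theta>) f f \<le> L2_inner (W (\<theta> + 1)) (D f) (D f)"
    using Poincare_orthogonal[OF \<theta> F(1) FL f(3), of n] orth by (simp add: Fz FF)
  show "L2_inner (W (\<theta> + 1)) (D f) (\<lambda>x. z x ^ k) = 0" if "Suc k < n" for k
    using integration_by_parts_step[OF \<theta> F(1) FL f(3), of k] orth[of k] orth[of "Suc k"] that
    by (simp only: Fz) simp
qed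

text \<open>Membership of the error belongs to the claim because \<open>L2_norm\<close> says nothing
  about functions outside the space. The Poincare inequality contributes the factor
  \<open>M + 1 - r\<close> at each order \<open>r\<close> from \<open>s\<close> to
  \<open>m - 1\<close>.\<close>

theorem projection_error:
  assumes \<theta>: "- 1 < \<theta>" and u: "u \<in> A_space \<theta> \<beta> \<gamma> \<mu>" and m: "m \<le> \<mu>" "m \<le> M + 1" and s: "s \<le> m"
  defines "v \<equiv> \<lambda>x. u x - proj \<theta> \<beta> \<gamma> M u x"
  shows "v \<in> A_space \<theta> \<beta> \<gamma> s"
    and "L2_norm (W (\<theta> + real s)) ((D ^^ s) v) \<le>
      sqrt (fact (M + 1 - m) / fact (M + 1 - s)) * L2_norm (W (\<theta> + real m)) ((D ^^ m) u)"
proof -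
  let ?p = "proj \<theta> \<beta> \<gamma> M u"
  have uL: "u \<in> L2_space (W \<theta>)" using A_spaceD(1)[OF u, of 0] by simp
  note proj = proj_properties[OF \<theta> uL, where M = M]
  obtain c where c: "?p = (\<lambda>x. \<Sum>k\<le>M. c k * x powr (real k * \<gamma>))"
    using proj(1) by (auto simp: P_space_def)
  define q where "q = z_poly c M"
  have p: "\<forall>x>0. ?p x = poly q (z x)"
    by (simp add: c q_def poly_z_poly)
  note v = A_space_sub_poly[OF \<theta> u p, folded v_def]
  show "v \<in> A_space \<theta> \<beta> \<gamma> s"
    using v(3)[of 0] v(2,3) m s by (auto simp: A_space_def)
  define V where "V r = L2_inner (W (\<theta> + real r)) ((D ^^ r) v) ((D ^^ r) v)" for r
  \<comment> \<open>The error is orthogonal to the \<open>M + 1\<close> powers up to degree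
    \<open>M\<close>, and each derivative loses one of them.\<close>
  have orth: "L2_inner (W (\<theta> + real r)) ((D ^^ r) v) (\<lambda>x. z x ^ k) = 0"
    if "r \<le> m" "k < M + 1 - r" for r k
    using that
  proof (induction r arbitrary: k)
    case 0
    have "L2_inner (W \<theta>) v (\<lambda>x. z x ^ k) = L2_inner (W \<theta>) v (\<lambda>x. (\<beta> + 1) ^ k * x powr (real k * \<gamma>))"
      unfolding L2_inner_def using \<beta> by (intro Bochner_Integration.integral_cong) (auto simp: powr_eq_z_power)
    also have "\<dots> = (\<beta> + 1) ^ k * L2_inner (W \<theta>) v (\<lambda>x. x powr (real k * \<gamma>))"
      by (rule w.L2_inner_cmult)
    also have "(\<lambda>x. x powr (real k * \<gamma>)) = (\<lambda>x. \<Sum>i\<le>M. (if i = k then 1 else 0) * x powr (real i * \<gamma>))"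
      using 0 by (simp add: if_distrib[of "\<lambda>y. y * _"] cong: if_cong)
    also have "L2_inner (W \<theta>) v \<dots> = 0"
      unfolding v_def P_space_def
      by (intro proj(2)) (unfold P_space_def, intro CollectI exI[of _ "\<lambda>i. if i = k then 1 else 0"] conjI TrueI refl)
    finally show ?case by simp
  next
    case (Suc r)
    have "L2_inner (W (\<theta> + real r + 1)) (D ((D ^^ r) v)) (\<lambda>x. z x ^ k) = 0"
      using Suc m \<theta> v(2)[of r] v(3)[of r] v(3)[of "Suc r"]
      by (intro orthogonal_D_step(2)[of _ _ "M + 1 - r"]) (auto simp: add_ac)
    then show ?case by (simp add: add_ac)
  qed
  have V_step: "real (M + 1 - r) * V r \<le> V (Suc r)" if "r < m" for r
  proof -
    have "real (M + 1 - r) * V r \<le> L2_inner (W (\<theta> + real r + 1)) (D ((D ^^ r) v)) (D ((D ^^ r) v))"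
      unfolding V_def using that m \<theta> v(2)[of r] v(3)[of r] v(3)[of "Suc r"]
      by (intro orthogonal_D_step(1)) (auto simp: add_ac intro!: orth)
    then show ?thesis by (simp add: V_def add_ac)
  qed
  \<comment> \<open>The factorial weights absorb the factors of \<open>V_step\<close>, so that the
    chain becomes monotone in the order of differentiation.\<close>
  have V_chain: "fact (M + 1 - s) * V s \<le> fact (M + 1 - m) * V m"
    using s
  proof (induction rule: inc_induct)
    case (step r)
    have "M + 1 - r = Suc (M + 1 - Suc r)" using step m by simp
    then have "fact (M + 1 - r) * V r = fact (M + 1 - Suc r) * (real (M + 1 - r) * V r)"
      by (simp only: fact_Suc) simp
    also have "\<dots> \<le> fact (M + 1 - Suc r) * V (Suc r)"
      using V_step[of r] step by (intro mult_left_mono) auto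
    also note step.IH
    finally show ?case .
  qed simp
  have V_le: "V m \<le> L2_inner (W (\<theta> + real m)) ((D ^^ m) u) ((D ^^ m) u)"
  proof -
    define Q where "Q = (pderiv ^^ m) q"
    define P where "P x = poly Q (z x)" for x
    have \<theta>m: "- 1 < \<theta> + real m" using \<theta> by simp
    have L: "(D ^^ m) v \<in> L2_space (W (\<theta> + real m))" "P \<in> L2_space (W (\<theta> + real m))"
      unfolding P_def using v(3)[OF m(1)] poly_z_L2[OF \<theta>m] by auto
    have "coeff Q k = 0" if "M + 1 - m \<le> k" for k
      using that m unfolding Q_def by (simp add: coeff_higher_pderiv q_def coeff_z_poly)
    \<comment> \<open>These are exactly the powers covered by \<open>orth\<close> at order
      \<open>m\<close>. For \<open>m = M + 1\<close> the sum is empty and the derivative of the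
      projection is 0.\<close>
    then have P_eq: "P = (\<lambda>x. \<Sum>k<M + 1 - m. coeff Q k * z x ^ k)"
      unfolding P_def by (subst poly_eq_sum_coeffs) auto
    have vP: "L2_inner (W (\<theta> + real m)) ((D ^^ m) v) P = 0"
      unfolding P_eq using L(1)
      by (subst w.L2_inner_sum) (auto intro!: w.L2_cmult z_power_L2 \<theta>m simp: w.L2_inner_cmult orth)
    have "L2_inner (W (\<theta> + real m)) ((D ^^ m) u) ((D ^^ m) u) =
        L2_inner (W (\<theta> + real m)) (\<lambda>x. (D ^^ m) v x + P x) (\<lambda>x. (D ^^ m) v x + P x)"
    proof (rule w.L2_inner_AE_cong)
      show "AE x in half_lebesgue. (D ^^ m) u x = (D ^^ m) v x + P x"
        using v(1)[OF m(1)] by eventually_elim (simp add: P_def Q_def)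
      then show "AE x in half_lebesgue. (D ^^ m) u x = (D ^^ m) v x + P x" .
    qed (use A_spaceD(1)[OF u m(1)] w.L2_add[OF L] in \<open>auto dest: w.L2_measurable\<close>)
    also have "\<dots> = V m + L2_inner (W (\<theta> + real m)) P P"
      unfolding V_def by (rule w.L2_inner_Pythagoras[OF L vP])
    finally show ?thesis using w.L2_inner_self_nonneg[of "\<theta> + real m" P] by simp
  qed
  have "V s \<le> fact (M + 1 - m) / fact (M + 1 - s) * L2_inner (W (\<theta> + real m)) ((D ^^ m) u) ((D ^^ m) u)"
  proof -
    have "fact (M + 1 - s) * V s \<le> fact (M + 1 - m) * L2_inner (W (\<theta> + real m)) ((D ^^ m) u) ((D ^^ m) u)"
      by (rule order_trans[OF V_chain mult_left_mono[OF V_le]]) simp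
    then show ?thesis by (simp add: field_simps)
  qed
  then show "L2_norm (W (\<theta> + real s)) ((D ^^ s) v) \<le>
      sqrt (fact (M + 1 - m) / fact (M + 1 - s)) * L2_norm (W (\<theta> + real m)) ((D ^^ m) u)"
    unfolding w.L2_norm_eq V_def real_sqrt_mult[symmetric] by (rule real_sqrt_le_mono)
qed

end

section \<open>The rate in \<open>M\<close>\<close>

lemma fact_ge_power:
  assumes "j \<le> \<mu>" "\<mu> \<le> M"
  shows "fact (M + 1 - j) * (real M / real \<mu>) ^ j \<le> fact (M + 1)"
  using assms(1)
proof (induction j)
  case (Suc j)
  have j: "real j \<le> real \<mu> - 1" using Suc.prems by linarith
  \<comment> \<open>The right side exceeds the left by
    \<open>(\<mu> - 1) * (M - \<mu>) + \<mu>\<close>.\<close>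
  have "real M \<le> real \<mu> * (real M + 2 - real \<mu>)"
    using assms mult_nonneg_nonneg[of "real \<mu> - 1" "real M - real \<mu>"] Suc.prems
    by (simp add: algebra_simps)
  then have "real M / real \<mu> \<le> real M + 2 - real \<mu>"
    using Suc.prems by (simp add: field_simps)
  \<comment> \<open>Since \<open>Suc j \<le> \<mu>\<close>, the new factor \<open>M + 1 - j\<close>
    is at least \<open>M + 2 - \<mu>\<close>.\<close>
  also have "\<dots> \<le> real (M + 1 - j)" using j Suc.prems assms by simp
  finally have le: "real M / real \<mu> \<le> real (M + 1 - j)" .
  have e: "M + 1 - j = Suc (M + 1 - Suc j)" using Suc.prems assms by simp
  have "fact (M + 1 - Suc j) * (real M / real \<mu>) ^ Suc j =
      (fact (M + 1 - Suc j) * (real M / real \<mu>) ^ j) * (real M / real \<mu>)" by simp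
  also have "\<dots> \<le> (fact (M + 1 - Suc j) * (real M / real \<mu>) ^ j) * real (M + 1 - j)"
    by (intro mult_left_mono le) simp
  also have "\<dots> = fact (M + 1 - j) * (real M / real \<mu>) ^ j"
    unfolding e by (simp only: fact_Suc) simp
  also have "\<dots> \<le> fact (M + 1)" using Suc by simp
  finally show ?case .
qed simp

text \<open>The quotient of \<open>(M + 1)!\<close> by \<open>(M + 1 - \<mu>)!\<close> has
  \<open>\<mu>\<close> factors, each at least \<open>M / \<mu>\<close>; this is the origin of the
  constant, the root of \<open>\<mu> ^ \<mu>\<close>.\<close>

lemma sqrt_fact_ratio_le:
  assumes "0 < \<mu>" "\<mu> \<le> M"
  shows "sqrt (fact (M + 1 - \<mu>) / fact (M + 1)) \<le> sqrt (real \<mu> ^ \<mu>) * real M powr (- real \<mu> / 2)"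
proof -
  have "0 < real M" using assms by simp
  have "fact (M + 1 - \<mu>) * real M ^ \<mu> \<le> real \<mu> ^ \<mu> * fact (M + 1)"
    using fact_ge_power[of \<mu> \<mu> M] assms by (simp add: power_divide field_simps)
  then have "fact (M + 1 - \<mu>) / fact (M + 1) \<le> real \<mu> ^ \<mu> * (1 / real M ^ \<mu>)"
    using \<open>0 < real M\<close> by (simp add: divide_simps mult.commute del: fact_Suc)
  then have "sqrt (fact (M + 1 - \<mu>) / fact (M + 1)) \<le> sqrt (real \<mu> ^ \<mu> * (1 / real M ^ \<mu>))"
    by (rule real_sqrt_le_mono)
  also have "\<dots> = sqrt (real \<mu> ^ \<mu>) * sqrt (1 / real M ^ \<mu>)" by (rule real_sqrt_mult)
  also have "sqrt (1 / real M ^ \<mu>) = real M powr (- real \<mu> / 2)"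
    using \<open>0 < real M\<close>
    by (simp add: powr_half_sqrt[symmetric] powr_minus_divide powr_divide powr_powr flip: powr_realpow)
  finally show ?thesis .
qed

text \<open>The number \<open>\<mu>\<close> is fixed outside, so that \<open>C\<close> can depend on
  nothing else. In \<open>M + 1 - m\<close> and \<open>M + 1 - s\<close> the addition comes first,
  which keeps the natural-number differences exact up to \<open>m = M + 1\<close>.\<close>

theorem theorem2p1:
  fixes \<mu> :: nat
  assumes "0 < \<mu>"
  shows
    "(\<forall>(M::nat) (m::nat) (s::nat) (\<theta>::real) (\<beta>::real) (\<gamma>::real) (u :: real \<Rightarrow> real).
        0 < M \<and> m = min \<mu> (M + 1) \<and> s \<le> m \<and>
        - 1 < \<theta> \<and> - 1 < \<beta> \<and> 0 < \<gamma> \<and> \<gamma> < 1 \<and> u \<in> A_space \<theta> \<beta> \<gamma> \<mu> \<longrightarrow>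
        (\<lambda>x. u x - proj \<theta> \<beta> \<gamma> M u x) \<in> A_space \<theta> \<beta> \<gamma> s \<and>
        L2_norm (weight (\<theta> + real s) \<beta> \<gamma>)
            ((mapped_deriv \<beta> \<gamma> ^^ s) (\<lambda>x. u x - proj \<theta> \<beta> \<gamma> M u x))
          \<le> sqrt (fact (M + 1 - m) / fact (M + 1 - s)) *
             L2_norm (weight (\<theta> + real m) \<beta> \<gamma>) ((mapped_deriv \<beta> \<gamma> ^^ m) u))
     \<and>
     (\<exists>C>0. \<forall>(M::nat) (\<beta>::real) (\<gamma>::real) (u :: real \<Rightarrow> real).
        0 < M \<and> \<mu> < M + 1 \<and> - 1 < \<beta> \<and> 0 < \<gamma> \<and> \<gamma> < 1 \<and> u \<in> A_space 0 \<beta> \<gamma> \<mu> \<longrightarrow>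
        L2_norm (weight 0 \<beta> \<gamma>) (\<lambda>x. u x - proj 0 \<beta> \<gamma> M u x)
          \<le> C * real M powr (- real \<mu> / 2) *
             L2_norm (weight (real \<mu>) \<beta> \<gamma>) ((mapped_deriv \<beta> \<gamma> ^^ \<mu>) u))"
proof (intro conjI)
  have mw: "mapped_weight \<beta> \<gamma>" if "- 1 < \<beta>" "0 < \<gamma>" for \<beta> \<gamma>
    using that by unfold_locales
  show "\<forall>(M::nat) (m::nat) (s::nat) (\<theta>::real) (\<beta>::real) (\<gamma>::real) (u :: real \<Rightarrow> real).
        0 < M \<and> m = min \<mu> (M + 1) \<and> s \<le> m \<and>
        - 1 < \<theta> \<and> - 1 < \<beta> \<and> 0 < \<gamma> \<and> \<gamma> < 1 \<and> u \<in> A_space \<theta> \<beta> \<gamma> \<mu> \<longrightarrow>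
        (\<lambda>x. u x - proj \<theta> \<beta> \<gamma> M u x) \<in> A_space \<theta> \<beta> \<gamma> s \<and>
        L2_norm (weight (\<theta> + real s) \<beta> \<gamma>)
            ((mapped_deriv \<beta> \<gamma> ^^ s) (\<lambda>x. u x - proj \<theta> \<beta> \<gamma> M u x))
          \<le> sqrt (fact (M + 1 - m) / fact (M + 1 - s)) *
             L2_norm (weight (\<theta> + real m) \<beta> \<gamma>) ((mapped_deriv \<beta> \<gamma> ^^ m) u)"
  proof (intro allI impI, elim conjE)
    fix M m s :: nat and \<theta> \<beta> \<gamma> :: real and u
    assume "m = min \<mu> (M + 1)" "s \<le> m" "- 1 < \<theta>" "- 1 < \<beta>" "0 < \<gamma>" "u \<in> A_space \<theta> \<beta> \<gamma> \<mu>"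
    with mapped_weight.projection_error[OF mw, of \<beta> \<gamma> \<theta> u \<mu> m M s]
    show "(\<lambda>x. u x - proj \<theta> \<beta> \<gamma> M u x) \<in> A_space \<theta> \<beta> \<gamma> s \<and>
        L2_norm (weight (\<theta> + real s) \<beta> \<gamma>)
            ((mapped_deriv \<beta> \<gamma> ^^ s) (\<lambda>x. u x - proj \<theta> \<beta> \<gamma> M u x))
          \<le> sqrt (fact (M + 1 - m) / fact (M + 1 - s)) *
             L2_norm (weight (\<theta> + real m) \<beta> \<gamma>) ((mapped_deriv \<beta> \<gamma> ^^ m) u)"
      by simp
  qed
  show "\<exists>C>0. \<forall>(M::nat) (\<beta>::real) (\<gamma>::real) (u :: real \<Rightarrow> real).
        0 < M \<and> \<mu> < M + 1 \<and> - 1 < \<beta> \<and> 0 < \<gamma> \<and> \<gamma> < 1 \<and> u \<in> A_space 0 \<beta> \<gamma> \<mu> \<longrightarrow>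
        L2_norm (weight 0 \<beta> \<gamma>) (\<lambda>x. u x - proj 0 \<beta> \<gamma> M u x)
          \<le> C * real M powr (- real \<mu> / 2) *
             L2_norm (weight (real \<mu>) \<beta> \<gamma>) ((mapped_deriv \<beta> \<gamma> ^^ \<mu>) u)"
  proof (intro exI[of _ "sqrt (real \<mu> ^ \<mu>)"] conjI allI impI, goal_cases)
    case 1
    show ?case using \<open>0 < \<mu>\<close> by simp
  next
    case (2 M \<beta> \<gamma> u)
    then interpret mapped_weight \<beta> \<gamma> by (intro mw) auto
    have "L2_norm (weight 0 \<beta> \<gamma>) (\<lambda>x. u x - proj 0 \<beta> \<gamma> M u x)
       \<le> sqrt (fact (M + 1 - \<mu>) / fact (M + 1)) * L2_norm (weight (real \<mu>) \<beta> \<gamma>) ((mapped_deriv \<beta> \<gamma> ^^ \<mu>) u)"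
      using projection_error(2)[of 0 u \<mu> \<mu> M 0] 2 by simp
    also have "\<dots> \<le> (sqrt (real \<mu> ^ \<mu>) * real M powr (- real \<mu> / 2)) * L2_norm (weight (real \<mu>) \<beta> \<gamma>) ((mapped_deriv \<beta> \<gamma> ^^ \<mu>) u)"
      using 2 \<open>0 < \<mu>\<close>
      by (intro mult_right_mono sqrt_fact_ratio_le) (auto simp: w.L2_norm_eq w.L2_inner_self_nonneg)
    finally show ?case .
  qed
qed

end
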